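(* Let $q$ be a prime power, $f_1=t-1$, and $\phi\in\Phi^*$. (1) Let $\mu=(\mu_1,\dots,\mu_r)\vdash n$ be a partition and $m$ a positive integer such that $n=m|\phi|$. Then the character value $\chi^{(m)(\phi)}_{\mu(f_1)}$ is the coefficient of $z^mw_1^{\mu_1}\cdots w_r^{\mu_r}$ in the formal series $$q^{n(\mu)}\prod_{1\le i<j\le r}\frac{w_i-w_j}{w_i-q^{-1}w_j}\ \prod_{i=1}^r\big[1-(-w_i)^{|\phi|}z\big],$$ where for $i<j$ the factor $\frac{w_i-w_j}{w_i-q^{-1}w_j}$ is expanded in nonnegative powers of $w_j/w_i$. (2) Let $\lambda=(\lambda_1,\dots,\lambda_l)\vdash m$ be a partition and $n$ a positive integer such that $n=m|\phi|$. Then the character value $\chi^{\lambda(\phi)}_{(n)(f_1)}$ is the coefficient of $z^nw_1^{\lambda_1}\cdots w_l^{\lambda_l}$ in the formal series $$\prod_{1\le i<j\le l}\Big(1-\frac{w_j}{w_i}\Big)\prod_{i=1}^l\big[1-(-z)^{|\phi|}w_i\big].$$ In particular, if $|\phi|=1$, then $$\chi^{\lambda(\phi)}_{(n)(f_1)}=\begin{cases}(-1)^{m+n}, & \text{if }\lambda=(1^m),\\ 0, & \text{otherwise.}\end{cases}$$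
   Context: $M_n=\mathbb F_{q^n}^\times\subset M=\overline{\mathbb F}_q^\times$; $M_n^*$ is the group of complex characters of $M_n$, with $M_m^*\subset M_n^*$ for $m\mid n$ (via the norm map); $M^*=\bigcup_n M_n^*$. The Frobenius $x\mapsto x^q$ acts on $M$ and $M^*$; $\Phi$ and $\Phi^*$ are the sets of its orbits in $M$ and $M^*$. Elements of $\Phi$ are identified with monic irreducible polynomials $f\ne t$ over $\mathbb F_q$, $|f|=\deg f$; $|\phi|$ is the size of $\phi\in\Phi^*$. $\mathcal F_G=\bigotimes_{\phi\in\Phi^*}\mathbb C[p_n(\phi):n\ge1]$ is the polynomial algebra on independent generators $p_n(\phi)$, with inner product in which the monomials $p_{\tilde{\boldsymbol\lambda}}=\prod_\phi p_{\tilde{\boldsymbol\lambda}(\phi)}(\phi)$ are orthogonal with $\langle p_{\tilde{\boldsymbol\lambda}},p_{\tilde{\boldsymbol\lambda}}\rangle=\prod_\phi z_{\tilde{\boldsymbol\lambda}(\phi)}$ ($z_\lambda=\prod_i i^{m_i}m_i!$ for $\lambda=(1^{m_1}2^{m_2}\cdots)$). For $f\in\Phi$ with root $x$, $$p_n(f)=\frac{(-1)^{n|f|-1}}{q^{n|f|}-1}\sum_{\xi\in M^*_{n|f|}}\overline{\xi(x)}\,p_{n|f|/|\phi_\xi|}(\phi_\xi),$$ where $\phi_\xi$ is the orbit of $\xi$; the $p_n(f)$ ($n\ge1$, $f\in\Phi$) are also algebraically independent generators of $\mathcal F_G$. In particular $p_n(f_1)=\frac{(-1)^{n-1}}{q^n-1}\sum_{|\phi|\,\mid\,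 n}|\phi|\,p_{n/|\phi|}(\phi)$. Here $\partial/\partial p_n(\phi)$ is taken with respect to the generators indexed by $\Phi^*$ and $\partial/\partial p_n(f)$ with respect to those indexed by $\Phi$. The operators $S_n(\phi)$, $Q_n(f_1)\in\mathrm{End}(\mathcal F_G)$, $n\in\mathbb Z$, are defined by $$\sum_{n\in\mathbb Z}S_n(\phi)z^n=\exp\Big(\sum_{n\ge1}\tfrac1n p_n(\phi)z^n\Big)\exp\Big(-\sum_{n\ge1}\tfrac{\partial}{\partial p_n(\phi)}z^{-n}\Big),$$ $$\sum_{n\in\mathbb Z}Q_n(f_1)z^{n}=\exp\Big(\sum_{n\ge1}\tfrac{q^{n}-1}{n}p_n(f_1)z^n\Big)\exp\Big(-\sum_{n\ge1}q^{-n}\tfrac{\partial}{\partial p_n(f_1)}z^{-n}\Big).$$ For a sequence $\alpha=(\alpha_1,\dots,\alpha_l)$, $S_\alpha(\phi)=S_{\alpha_1}(\phi)\cdots S_{\alpha_l}(\phi)$, and "$X.1$" is the operator $X$ applied to $1\in\mathcal F_G$. Characters: the irreducible characters of $\mathrm{GL}_n(\mathbb F_q)$ are parametrized (Green) by $\Phi^*$-colored partitions $\tilde{\boldsymbol\lambda}:\Phi^*\to\{\text{partitions}\}$ with $\sum_\phi|\phi||\tilde{\boldsymbol\lambda}(\phi)|=n$, and unipotent classes by partitions $\mu\vdash n$ (Jordan type), denoted $\mu(f_1)$. The value of $\chi^{\tilde{\boldsymbol\lambda}}$ on the unipotent class $\mu(f_1)$, $\mu=(\mu_1,\dots,\mu_r)$,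 is given by the known formula $$\chi^{\tilde{\boldsymbol\lambda}}_{\mu(f_1)}=q^{n(\mu)}\Big\langle\prod_{\phi\in\Phi^*}S_{\tilde{\boldsymbol\lambda}(\phi)}(\phi).1,\ Q_{\mu_1}(f_1)\cdots Q_{\mu_r}(f_1).1\Big\rangle,\qquad n(\mu)=\sum_i(i-1)\mu_i,$$ which may be taken as the definition. $\lambda(\phi)$ denotes the colored partition with value $\lambda$ at $\phi$ and empty elsewhere; $(m)(\phi)$ is the case $\lambda=(m)$. *)

theory Defs
  imports
    Complex_Main
    "HOL-Algebra.Algebraic_Closure_Type"
    "HOL-Combinatorics.Orbits"
    "HOL-Library.Cardinality"
    "HOL-Library.Poly_Mapping"
    "HOL-Computational_Algebra.Formal_Power_Series"
begin

text \<open>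
  Throughout, \<open>'a\<close> is the finite field \<open>F\<^sub>q\<close>, so that \<open>q = CARD('a)\<close>, and \<open>'a alg_closure\<close> is its
  algebraic closure.
\<close>

section \<open>The groups \<open>M\<close> and \<open>M\<^sup>*\<close> and their Frobenius orbits\<close>

definition M_level :: "nat \<Rightarrow> 'a::finite_field alg_closure set" where
  "M_level n = {x. x \<noteq> 0 \<and> x ^ (CARD('a) ^ n) = x}"

definition frob :: "'a::finite_field alg_closure \<Rightarrow> 'a alg_closure" where
  "frob x = x ^ CARD('a)"

text \<open>
  For \<open>m dvd n\<close>, the product of the conjugates of \<open>x \<in> M\<^sub>n\<close> over the field with \<open>q\<^sup>m\<close> elements.
\<close>
definition norm_map :: "nat \<Rightarrow> nat \<Rightarrow> 'a::finite_field alg_closure \<Rightarrow> 'a alg_closure" where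
  "norm_map m n x = (\<Prod>i<n div m. x ^ (CARD('a) ^ (m * i)))"

text \<open>
  Complex characters of \<open>M\<^sub>n\<close>, extended by \<open>0\<close> outside \<open>M\<^sub>n\<close>, so that distinct functions are
  distinct characters.
\<close>
definition char_level :: "nat \<Rightarrow> ('a::finite_field alg_closure \<Rightarrow> complex) set" where
  "char_level n = {\<xi>. (\<forall>x\<in>M_level n. \<forall>y\<in>M_level n. \<xi> (x * y) = \<xi> x * \<xi> y) \<and>
                      (\<forall>x\<in>M_level n. \<xi> x \<noteq> 0) \<and> (\<forall>x. x \<notin> M_level n \<longrightarrow> \<xi> x = 0)}"

definition inflate ::
    "nat \<Rightarrow> nat \<Rightarrow> ('a::finite_field alg_closure \<Rightarrow> complex) \<Rightarrow> 'a alg_closure \<Rightarrow> complex" where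
  "inflate m n \<xi> = (\<lambda>x. if x \<in> M_level n then \<xi> (norm_map m n x) else 0)"

text \<open>
  \<open>M\<^sup>*\<close> is the direct limit of the groups \<open>M\<^sub>n\<^sup>*\<close> along inflation: its elements are classes of
  pairs \<open>(n, \<xi>)\<close> with \<open>\<xi> \<in> M\<^sub>n\<^sup>*\<close>.
\<close>
type_synonym 'a lchar = "nat \<times> ('a alg_closure \<Rightarrow> complex)"

definition level_chars :: "'a::finite_field lchar set" where
  "level_chars = (SIGMA n:{0<..}. char_level n)"

definition char_eq :: "'a::finite_field lchar rel" where
  "char_eq = {((m, \<xi>), (n, \<eta>)). (m, \<xi>) \<in> level_chars \<and> (n, \<eta>) \<in> level_chars \<and>
                (\<exists>k>0. m dvd k \<and> n dvd k \<and> inflate m k \<xi> = inflate n k \<eta>)}"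

definition M_star :: "'a::finite_field lchar set set" where
  "M_star = quotient level_chars char_eq"

definition frob_star :: "'a::finite_field lchar set \<Rightarrow> 'a lchar set" where
  "frob_star C = (\<lambda>(n, \<xi>). (n, \<lambda>x. \<xi> (frob x))) ` C"

text \<open>
  An orbit in \<open>M\<close> is the root set of a monic irreducible polynomial \<open>f \<noteq> t\<close>, whose
  degree is the size of the orbit.
\<close>
typedef (overloaded) ('a::finite_field) Phi = "{orbit frob x | x :: 'a alg_closure. x \<noteq> 0}"
  morphisms Phi_set Abs_Phi
  by (rule exI[of _ "orbit frob 1"]) auto

typedef (overloaded) ('a::finite_field) Phi_star = "{orbit frob_star C | C :: 'a lchar set. C \<in> M_star}"
  morphisms Phi_star_set Abs_Phi_star
proof -
  define \<xi> :: "'a alg_closure \<Rightarrow> complex" where "\<xi> = (\<lambda>x. if x \<in> M_level 1 then 1 else 0)"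
  have "(1, \<xi>) \<in> level_chars"
    by (auto simp: level_chars_def char_level_def \<xi>_def M_level_def power_mult_distrib)
  hence "char_eq `` {(1, \<xi>)} \<in> M_star"
    unfolding M_star_def by (rule quotientI)
  thus ?thesis by blast
qed

definition Phi_size :: "'a::finite_field Phi \<Rightarrow> nat" where
  "Phi_size f = card (Phi_set f)"

definition Phi_star_size :: "'a::finite_field Phi_star \<Rightarrow> nat" where
  "Phi_star_size \<phi> = card (Phi_star_set \<phi>)"

text \<open>The polynomial \<open>t - 1\<close>, as the set of its roots.\<close>
definition f1 :: "'a::finite_field Phi" where
  "f1 = Abs_Phi {x. poly (map_poly to_ac [:-1, 1:]) x = 0}"

text \<open>\<open>\<phi>\<^sub>\<xi>\<close> for \<open>\<xi> \<in> M\<^sub>n\<^sup>*\<close>.\<close>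
definition char_orbit :: "nat \<Rightarrow> ('a::finite_field alg_closure \<Rightarrow> complex) \<Rightarrow> 'a Phi_star" where
  "char_orbit n \<xi> = Abs_Phi_star (orbit frob_star (char_eq `` {(n, \<xi>)}))"


section \<open>Polynomial algebras\<close>

type_synonym 'v cpoly = "('v \<Rightarrow>\<^sub>0 nat) \<Rightarrow>\<^sub>0 complex"

definition cst :: "complex \<Rightarrow> 'v cpoly" where
  "cst c = Poly_Mapping.single 0 c"

definition var :: "'v \<Rightarrow> 'v cpoly" where
  "var v = Poly_Mapping.single (Poly_Mapping.single v 1) 1"

definition pdiff :: "'v \<Rightarrow> 'v cpoly \<Rightarrow> 'v cpoly" where
  "pdiff v P = (\<Sum>m\<in>Poly_Mapping.keys P.
     Poly_Mapping.single (m - Poly_Mapping.single v 1)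
       (of_nat (Poly_Mapping.lookup m v) * Poly_Mapping.lookup P m))"

definition peval :: "('v \<Rightarrow> 'w cpoly) \<Rightarrow> 'v cpoly \<Rightarrow> 'w cpoly" where
  "peval g P = (\<Sum>m\<in>Poly_Mapping.keys P. cst (Poly_Mapping.lookup P m) *
     (\<Prod>v\<in>Poly_Mapping.keys m. g v ^ Poly_Mapping.lookup m v))"

text \<open>
  Partial derivative of \<open>u\<close> with respect to a system \<open>g\<close> of algebraically independent generators
  (for which \<open>peval g\<close> is bijective): write \<open>u\<close> as a polynomial in the \<open>g v\<close> and differentiate it.
\<close>
definition pdiff_wrt :: "('v \<Rightarrow> 'w cpoly) \<Rightarrow> 'v \<Rightarrow> 'w cpoly \<Rightarrow> 'w cpoly" where
  "pdiff_wrt g v u = peval g (pdiff v (inv_into UNIV (peval g) u))"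

text \<open>
  The algebra \<open>\<F>\<^sub>G\<close>. To have no generator \<open>p\<^sub>0(\<phi>)\<close>, indices are shifted: the variable \<open>(\<phi>, k)\<close> is
  \<open>p\<^bsub>k+1\<^esub>(\<phi>)\<close>.
\<close>
type_synonym 'a FG = "('a Phi_star \<times> nat) cpoly"

definition p_star :: "nat \<Rightarrow> 'a::finite_field Phi_star \<Rightarrow> 'a FG" where
  "p_star n \<phi> = var (\<phi>, n - 1)"

text \<open>
  A monomial \<open>m\<close> is \<open>p\<^bsub>\<lambda>\<^esub>\<close> for the colored partition \<open>\<lambda>\<close> in which \<open>k + 1\<close> is a part of \<open>\<lambda>(\<phi>)\<close>
  with multiplicity \<open>lookup m (\<phi>, k)\<close>; \<open>z_monom m\<close> is the product of the \<open>z\<^bsub>\<lambda>(\<phi>)\<^esub>\<close>.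
\<close>
definition z_monom :: "(('a::finite_field Phi_star \<times> nat) \<Rightarrow>\<^sub>0 nat) \<Rightarrow> nat" where
  "z_monom m = (\<Prod>(\<phi>, k)\<in>Poly_Mapping.keys m.
     (k + 1) ^ Poly_Mapping.lookup m (\<phi>, k) * fact (Poly_Mapping.lookup m (\<phi>, k)))"

definition inner_FG :: "'a::finite_field FG \<Rightarrow> 'a FG \<Rightarrow> complex" where
  "inner_FG u v = (\<Sum>m\<in>Poly_Mapping.keys u.
     Poly_Mapping.lookup u m * cnj (Poly_Mapping.lookup v m) * of_nat (z_monom m))"

text \<open>
  The value does not depend on the choice of the root \<open>x\<close> of \<open>f\<close>.
\<close>
definition p_Phi :: "nat \<Rightarrow> 'a::finite_field Phi \<Rightarrow> 'a FG" where
  "p_Phi n f = (let N = n * Phi_size f; x = (SOME x. x \<in> Phi_set f) in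
     cst ((-1) ^ (N - 1) / (of_nat CARD('a) ^ N - 1)) *
     (\<Sum>\<xi>\<in>char_level N. cst (cnj (\<xi> x)) *
        p_star (N div Phi_star_size (char_orbit N \<xi>)) (char_orbit N \<xi>)))"

definition d_star :: "nat \<Rightarrow> 'a::finite_field Phi_star \<Rightarrow> 'a FG \<Rightarrow> 'a FG" where
  "d_star n \<phi> = pdiff (\<phi>, n - 1)"

definition d_Phi :: "nat \<Rightarrow> 'a::finite_field Phi \<Rightarrow> 'a FG \<Rightarrow> 'a FG" where
  "d_Phi n f = pdiff_wrt (\<lambda>(g, k). p_Phi (k + 1) g) (f, n - 1)"


section \<open>Vertex operators\<close>

text \<open>
  Formal power series in one variable whose coefficients are operators on \<open>\<F>\<^sub>G\<close>, as sequences of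
  coefficients.
\<close>
type_synonym 'a opseries = "nat \<Rightarrow> 'a FG \<Rightarrow> 'a FG"

definition op_mult :: "'a::finite_field opseries \<Rightarrow> 'a opseries \<Rightarrow> 'a opseries" where
  "op_mult A B = (\<lambda>k u. \<Sum>i\<le>k. A i (B (k - i) u))"

definition op_one :: "'a::finite_field opseries" where
  "op_one = (\<lambda>k u. if k = 0 then u else 0)"

text \<open>
  \<open>exp (\<Sum>n\<ge>1. A n t\<^sup>n)\<close>. The value \<open>A 0\<close> is ignored; hence the \<open>j\<close>-th power of the exponent has no
  coefficient below \<open>t\<^sup>j\<close> and the exponential series may be cut off at \<open>j = k\<close>.
\<close>
definition op_exp :: "'a::finite_field opseries \<Rightarrow> 'a opseries" where
  "op_exp A = (\<lambda>k u. \<Sum>j\<le>k. cst (1 / fact j) *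
     (op_mult (\<lambda>n v. if n = 0 then 0 else A n v) ^^ j) op_one k u)"

text \<open>
  Coefficient of \<open>z\<^sup>n\<close> in \<open>exp (\<Sum>k\<ge>1. A k z\<^sup>k) exp (\<Sum>k\<ge>1. B k z\<^bsup>-k\<^esup>)\<close>. In the operators below the
  \<open>B k\<close> lower degrees, so that only finitely many terms are nonzero on a given \<open>u\<close>.
\<close>
definition vertex_op ::
    "'a::finite_field opseries \<Rightarrow> 'a opseries \<Rightarrow> int \<Rightarrow> 'a FG \<Rightarrow> 'a FG" where
  "vertex_op A B n u =
     (\<Sum>(i, j) | int i - int j = n \<and> op_exp B j u \<noteq> 0. op_exp A i (op_exp B j u))"

definition S_op :: "'a::finite_field Phi_star \<Rightarrow> int \<Rightarrow> 'a FG \<Rightarrow> 'a FG" where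
  "S_op \<phi> = vertex_op (\<lambda>n u. cst (1 / of_nat n) * p_star n \<phi> * u) (\<lambda>n u. - d_star n \<phi> u)"

definition Q_op :: "int \<Rightarrow> 'a::finite_field FG \<Rightarrow> 'a FG" where
  "Q_op = vertex_op
     (\<lambda>n u. cst ((of_nat CARD('a) ^ n - 1) / of_nat n) * p_Phi n f1 * u)
     (\<lambda>n u. - (cst (1 / of_nat CARD('a) ^ n) * d_Phi n f1 u))"

definition S_seq :: "'a::finite_field Phi_star \<Rightarrow> nat list \<Rightarrow> 'a FG \<Rightarrow> 'a FG" where
  "S_seq \<phi> \<alpha> u = foldr (\<lambda>k. S_op \<phi> (int k)) \<alpha> u"

definition Q_seq :: "nat list \<Rightarrow> 'a::finite_field FG \<Rightarrow> 'a FG" where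
  "Q_seq \<mu> u = foldr (\<lambda>k. Q_op (int k)) \<mu> u"


section \<open>Character values on unipotent classes\<close>

definition is_partition :: "nat list \<Rightarrow> nat \<Rightarrow> bool" where
  "is_partition \<mu> n \<longleftrightarrow> sorted_wrt (\<ge>) \<mu> \<and> 0 \<notin> set \<mu> \<and> sum_list \<mu> = n"

definition n_part :: "nat list \<Rightarrow> nat" where
  "n_part \<mu> = (\<Sum>i<length \<mu>. i * \<mu> ! i)"

text \<open>
  \<open>L\<close> is a colored partition, \<open>\<mu>\<close> the Jordan type of a unipotent class. The operators \<open>S_seq \<phi>\<close> for
  different \<open>\<phi>\<close> act on different tensor factors of \<open>\<F>\<^sub>G\<close>, so their product applied to \<open>1\<close> is
  the product in \<open>\<F>\<^sub>G\<close> of their values at \<open>1\<close>.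
\<close>
definition char_value :: "('a::finite_field Phi_star \<Rightarrow> nat list) \<Rightarrow> nat list \<Rightarrow> complex" where
  "char_value L \<mu> = of_nat CARD('a) ^ n_part \<mu> *
     inner_FG (\<Prod>\<phi> | L \<phi> \<noteq> []. S_seq \<phi> (L \<phi>) 1) (Q_seq \<mu> 1)"

definition single_color :: "nat list \<Rightarrow> 'a::finite_field Phi_star \<Rightarrow> 'a Phi_star \<Rightarrow> nat list" where
  "single_color \<nu> \<phi> = (\<lambda>_. [])(\<phi> := \<nu>)"


section \<open>Formal series in \<open>z, w\<^sub>1, w\<^sub>2, \<dots>\<close> with integer exponents\<close>

text \<open>\<open>W i\<close> is \<open>w\<^bsub>i+1\<^esub>\<close>, in accordance with list indexing.\<close>
datatype svar = Z | W nat

text \<open>A series is the function assigning to an exponent vector its coefficient.\<close>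
type_synonym series = "(svar \<Rightarrow>\<^sub>0 int) \<Rightarrow> complex"

definition s_monom :: "complex \<Rightarrow> (svar \<Rightarrow>\<^sub>0 int) \<Rightarrow> series" where
  "s_monom c e = (\<lambda>e'. if e' = e then c else 0)"

definition s_minus :: "series \<Rightarrow> series \<Rightarrow> series" where
  "s_minus F G = (\<lambda>e. F e - G e)"

text \<open>
  Cauchy product. The product of two series exists only if all these sums are finite, which is the
  case for the products formed below: they involve polynomials and power series in \<open>w\<^sub>j / w\<^sub>i\<close> with
  \<open>i < j\<close> only.
\<close>
definition s_mult :: "series \<Rightarrow> series \<Rightarrow> series" where
  "s_mult F G = (\<lambda>e. \<Sum>d | F d \<noteq> 0 \<and> G (e - d) \<noteq> 0. F d * G (e - d))"

definition s_prod :: "series list \<Rightarrow> series" where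
  "s_prod Fs = foldr s_mult Fs (s_monom 1 0)"

text \<open>The substitution \<open>g (w\<^sub>j / w\<^sub>i)\<close> in a power series \<open>g\<close>.\<close>
definition in_ratio :: "complex fps \<Rightarrow> nat \<Rightarrow> nat \<Rightarrow> series" where
  "in_ratio g i j = (\<lambda>e. \<Sum>k | e = Poly_Mapping.single (W j) (int k) - Poly_Mapping.single (W i) (int k).
                         fps_nth g k)"

definition s_prod_pairs :: "nat \<Rightarrow> (nat \<Rightarrow> nat \<Rightarrow> series) \<Rightarrow> series" where
  "s_prod_pairs r F = s_prod (concat (map (\<lambda>i. map (F i) [i + 1..<r]) [0..<r]))"

definition s_prod_single :: "nat \<Rightarrow> (nat \<Rightarrow> series) \<Rightarrow> series" where
  "s_prod_single r F = s_prod (map F [0..<r])"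

text \<open>
  With \<open>t = w\<^sub>j / w\<^sub>i\<close> one has \<open>(w\<^sub>i - w\<^sub>j) / (w\<^sub>i - q\<^bsup>-1\<^esup> w\<^sub>j) = (1 - t) / (1 - q\<^bsup>-1\<^esup> t)\<close>, and
  division of power series is the expansion in nonnegative powers of \<open>t\<close>.
\<close>
definition series1 :: "nat \<Rightarrow> nat \<Rightarrow> nat list \<Rightarrow> series" where
  "series1 q d \<mu> = (let r = length \<mu> in
     s_mult (s_monom (of_nat q ^ n_part \<mu>) 0)
     (s_mult
       (s_prod_pairs r (in_ratio ((1 - fps_X) / (1 - fps_const (1 / of_nat q) * fps_X))))
       (s_prod_single r (\<lambda>i. s_minus (s_monom 1 0)
          (s_monom ((-1) ^ d) (Poly_Mapping.single (W i) (int d) + Poly_Mapping.single Z 1))))))"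

definition series2 :: "nat \<Rightarrow> nat \<Rightarrow> series" where
  "series2 d l =
     s_mult
       (s_prod_pairs l (in_ratio (1 - fps_X)))
       (s_prod_single l (\<lambda>i. s_minus (s_monom 1 0)
          (s_monom ((-1) ^ d) (Poly_Mapping.single Z (int d) + Poly_Mapping.single (W i) 1))))"

text \<open>The monomial \<open>z\<^sup>m w\<^sub>1\<^bsup>\<mu>\<^sub>1\<^esup> \<cdots> w\<^sub>r\<^bsup>\<mu>\<^sub>r\<^esup>\<close>.\<close>
definition s_exp :: "nat \<Rightarrow> nat list \<Rightarrow> svar \<Rightarrow>\<^sub>0 int" where
  "s_exp m \<mu> = Poly_Mapping.single Z (int m) +
     (\<Sum>i<length \<mu>. Poly_Mapping.single (W i) (int (\<mu> ! i)))"

end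

theory Submission
  imports Defs
begin

text \<open>
  Both character values are inner products of a word in the operators \<open>S\<^sub>k(\<phi>)\<close> and a word in the
  operators \<open>Q\<^sub>k(f\<^sub>1)\<close>, both applied to \<open>1\<close>, and in each part of the proposition one of the two words
  has length one.

  Such an operator is \<open>\<Sum>\<^sub>j E\<^bsub>a+j\<^esub> T\<^sub>j\<close>, where \<open>E(w) = \<Sum> E\<^sub>k w\<^sup>k\<close> is the exponential of a
  multiplication and \<open>T\<close> the exponential of a derivation.  The exponential of a derivation is
  multiplicative (\<open>T_mult\<close>) and \<open>E(w)\<close> is an eigenvector of the derivation (\<open>derivation_E\<close>), so that
  moving \<open>T\<close> past a vertex operator with variable \<open>w\<^sub>j\<close> only costs a scalar series \<open>c(w\<^sub>j / w\<^sub>i)\<close>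
  (\<open>T_vop\<close>).  Once all \<open>T\<close>'s have reached the vector \<open>1\<close>, which they fix, a word with \<open>r\<close> letters has
  become \<open>\<Prod>\<^bsub>i<j\<^esub> c(w\<^sub>j / w\<^sub>i) \<Prod>\<^sub>i E(w\<^sub>i)\<close>.  The contraction \<open>c(t)\<close> is \<open>(1 - t) / (1 - t / q)\<close> for
  \<open>Q\<close> and \<open>1 - t\<close> for \<open>S\<close> (\<open>ratio_coeff\<close>).

  The word of length one is a coefficient of an exponential \<open>E'(z)\<close> of the other kind.
  Multiplication by the exponent of \<open>E(w)\<close> is adjoint to a derivation (\<open>inner_aQ\<close>, \<open>inner_aS\<close>) which
  has \<open>E'(z)\<close> as an eigenvector as well.  Hence each factor \<open>E(w\<^sub>i)\<close> may be removed from the inner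
  product at the cost of a scalar, and this scalar is a factor \<open>1 - (-w\<^sub>i)\<^bsup>d\<^esup> z\<close> or
  \<open>1 - (-z)\<^bsup>d\<^esup> w\<^sub>i\<close> of the claimed series, where \<open>d\<close> is the size of \<open>\<phi>\<close> (\<open>inner_S_E_Q_E\<close>,
  \<open>inner_S_E_mult_Q_E\<close>).  Both parts are instances of one statement about vertex operators and a family
  of functionals with this property (\<open>coefficient_eq\<close>).  The values for \<open>d = 1\<close> come from the same
  property: the functional only sees \<open>E\<^sub>0\<close> and \<open>E\<^sub>1\<close>, so a part \<open>a \<ge> 2\<close> of \<open>\<lambda>\<close> gives \<open>0\<close>, and a
  part \<open>1\<close> may be split off (\<open>L_vop_pos\<close>).

  What makes \<open>S\<close> and \<open>Q\<close> interact is the expression of \<open>\<partial>/\<partial>p\<^sub>n(f\<^sub>1)\<close> through the derivatives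
  \<open>\<partial>/\<partial>p\<^sub>k(\<phi>)\<close>, given by the derivation \<open>unip_deriv n\<close>.  It takes the values \<open>\<delta>\<close> on the
  generators \<open>p\<^sub>k(f)\<close> (\<open>unip_deriv_p_Phi\<close>); this rests on the orthogonality relation
  \<open>\<Sum>\<^sub>\<xi> \<xi>(x) = 0\<close> for \<open>x \<noteq> 1\<close> (\<open>sum_char_level\<close>) and on the fact that an orbit \<open>\<phi>\<close> whose size
  divides \<open>n\<close> is represented by exactly \<open>d\<close> characters of \<open>M\<^sub>n\<close> (\<open>card_chars_in_orbit\<close>), which is a
  consequence of Hilbert 90 (\<open>char_descent\<close>).
\<close>

section \<open>Polynomial algebras\<close>

abbreviation "lk \<equiv> Poly_Mapping.lookup"

lemma cpoly_single_sum: "P = (\<Sum>m\<in>Poly_Mapping.keys P. Poly_Mapping.single m (lk P m))"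
  by (rule poly_mapping_eqI) (simp add: lookup_sum lookup_single when_def in_keys_iff)

lemma cst_add: "cst (a + b) = cst a + cst b"
  by (simp add: cst_def single_add)

lemma cst_mult: "cst (a * b) = cst a * cst b"
  by (simp add: cst_def mult_single)

lemma cst_0 [simp]: "cst 0 = 0"
  by (simp add: cst_def)

lemma cst_1 [simp]: "cst 1 = 1"
  by (simp add: cst_def)

lemma cst_uminus: "cst (- a) = - cst a"
  by (simp add: cst_def single_uminus)

lemma cst_of_nat: "cst (of_nat n) = of_nat n"
  by (induction n) (simp_all add: cst_add)

lemma cst_sum: "cst (sum f A) = (\<Sum>x\<in>A. cst (f x))"
  by (induction A rule: infinite_finite_induct) (simp_all add: cst_add)

lemma cst_mult_single: "cst c * Poly_Mapping.single m x = Poly_Mapping.single m (c * x)"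
  by (simp add: cst_def mult_single)

lemma lookup_cst_mult [simp]: "lk (cst c * u) m = c * lk u m"
proof -
  have "cst c * u = (\<Sum>k\<in>Poly_Mapping.keys u. Poly_Mapping.single k (c * lk u k))"
    using arg_cong[OF cpoly_single_sum[of u], of "\<lambda>w. cst c * w"]
    by (simp only: sum_distrib_left cst_mult_single)
  then show ?thesis
    by (simp add: lookup_sum lookup_single when_def in_keys_iff)
qed

lemma cst_cancel:
  assumes "c \<noteq> 0" "cst c * u = cst c * v" shows "u = v"
proof -
  have "cst (inverse c) * (cst c * u) = cst (inverse c) * (cst c * v)" using assms by simp
  then show ?thesis using assms(1) by (simp add: mult.assoc[symmetric] cst_mult[symmetric])
qed

lemma cpoly_induct [case_names cst var add mult]:
  assumes cst: "\<And>c. P (cst c)" and var: "\<And>v. P (var v)"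
    and add: "\<And>u v. P u \<Longrightarrow> P v \<Longrightarrow> P (u + v)" and mult: "\<And>u v. P u \<Longrightarrow> P v \<Longrightarrow> P (u * v)"
  shows "P (u :: 'v cpoly)"
proof -
  have pow: "P (var v ^ n)" for v n
    by (induction n) (use cst[of 1] var mult in auto)
  have varpow: "var v ^ n = Poly_Mapping.single (Poly_Mapping.single v n) 1" for v :: 'v and n
    by (induction n) (simp_all add: var_def mult_single single_add[symmetric])
  have mon: "P (Poly_Mapping.single m 1)" for m
  proof (induction m rule: update_induct)
    case const
    then show ?case using cst[of 1] by (simp add: cst_def)
  next
    case (update f a b)
    have "Poly_Mapping.update a b f = Poly_Mapping.single a b + f"
      by (rule poly_mapping_eqI)
        (use update in \<open>auto simp: lookup_update lookup_add lookup_single when_def in_keys_iff\<close>)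
    then have "Poly_Mapping.single (Poly_Mapping.update a b f) (1::complex)
        = var a ^ b * Poly_Mapping.single f 1"
      by (simp add: varpow mult_single)
    then show ?case using mult pow update by metis
  qed
  have sing: "P (Poly_Mapping.single m c)" for m c
    using mult[OF cst[of c] mon[of m]] by (simp add: cst_mult_single)
  have "P (\<Sum>m\<in>A. Poly_Mapping.single m (lk u m))" if "finite A" for A
    using that by (induction A) (use cst[of 0] add sing in auto)
  from this[of "Poly_Mapping.keys u"] show ?thesis
    using cpoly_single_sum[of u] by simp
qed

section \<open>Partial derivatives\<close>

lemma lookup_pdiff: "lk (pdiff v P) m = (of_nat (lk m v) + 1) * lk P (m + Poly_Mapping.single v 1)"
proof -
  let ?e = "Poly_Mapping.single v (1::nat)"
  have "lk (pdiff v P) m = (\<Sum>k\<in>Poly_Mapping.keys P. (if k - ?e = m then of_nat (lk k v) * lk P k else 0))"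
    unfolding pdiff_def by (simp add: lookup_sum lookup_single when_def)
  also have "\<dots> = (\<Sum>k\<in>Poly_Mapping.keys P. (if k = m + ?e then of_nat (lk k v) * lk P k else 0))"
  proof (rule sum.cong)
    fix k
    have "k = m + ?e" if "k - ?e = m" "lk k v \<noteq> 0"
    proof (rule poly_mapping_eqI)
      fix i
      show "lk k i = lk (m + ?e) i"
        using that by (auto simp: lookup_add lookup_single lookup_minus when_def that(1)[symmetric])
    qed
    moreover have "(m + ?e) - ?e = m" by simp
    ultimately show "(if k - ?e = m then of_nat (lk k v) * lk P k else 0) =
        (if k = m + ?e then of_nat (lk k v) * lk P k else 0)"
      by (metis mult_zero_left of_nat_0)
  qed simp
  also have "\<dots> = (of_nat (lk m v) + 1) * lk P (m + ?e)"
    by (simp add: in_keys_iff lookup_add algebra_simps)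
  finally show ?thesis .
qed

lemma pdiff_add: "pdiff v (P + Q) = pdiff v P + pdiff v Q"
  by (rule poly_mapping_eqI) (simp add: lookup_pdiff lookup_add algebra_simps)

lemma pdiff_sum: "pdiff v (sum f A) = (\<Sum>x\<in>A. pdiff v (f x))"
proof (induction A rule: infinite_finite_induct)
  case (insert x F)
  then show ?case by (simp add: pdiff_add)
qed (simp_all add: pdiff_def)

lemma pdiff_cst_mult: "pdiff v (cst c * P) = cst c * pdiff v P"
  by (rule poly_mapping_eqI) (simp add: lookup_pdiff)

lemma pdiff_commute: "pdiff v (pdiff w P) = pdiff w (pdiff v P)"
proof (rule poly_mapping_eqI)
  fix m
  show "lk (pdiff v (pdiff w P)) m = lk (pdiff w (pdiff v P)) m"
    by (cases "v = w") (simp_all add: lookup_pdiff lookup_add add_ac lookup_single)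
qed

lemma pdiff_single:
  "pdiff v (Poly_Mapping.single k c) = Poly_Mapping.single (k - Poly_Mapping.single v 1) (of_nat (lk k v) * c)"
  by (cases "c = 0") (simp_all add: pdiff_def)

lemma pdiff_mult: "pdiff v (P * Q) = pdiff v P * Q + P * pdiff v Q"
proof -
  let ?e = "Poly_Mapping.single v (1::nat)"
  have single: "pdiff v (Poly_Mapping.single k a * Poly_Mapping.single l b)
     = pdiff v (Poly_Mapping.single k a) * Poly_Mapping.single l b
       + Poly_Mapping.single k a * pdiff v (Poly_Mapping.single l b)" for k l :: "'a \<Rightarrow>\<^sub>0 nat" and a b
  proof -
    have 1: "Poly_Mapping.single (k + l - ?e) (of_nat (lk k v) * (a * b))
      = Poly_Mapping.single (k - ?e + l) (of_nat (lk k v) * (a * b))"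
    proof (cases "lk k v = 0")
      case False
      then have "k + l - ?e = k - ?e + l"
        by (intro poly_mapping_eqI) (auto simp: lookup_add lookup_minus lookup_single when_def)
      then show ?thesis by simp
    qed simp
    have 2: "Poly_Mapping.single (k + l - ?e) (of_nat (lk l v) * (a * b))
      = Poly_Mapping.single (k + (l - ?e)) (of_nat (lk l v) * (a * b))"
    proof (cases "lk l v = 0")
      case False
      then have "k + l - ?e = k + (l - ?e)"
        by (intro poly_mapping_eqI) (auto simp: lookup_add lookup_minus lookup_single when_def)
      then show ?thesis by simp
    qed simp
    have "pdiff v (Poly_Mapping.single k a * Poly_Mapping.single l b) =
        Poly_Mapping.single (k + l - ?e) (of_nat (lk k v) * (a * b)) +
        Poly_Mapping.single (k + l - ?e) (of_nat (lk l v) * (a * b))"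
      by (simp add: mult_single pdiff_single single_add[symmetric] lookup_add algebra_simps)
    then show ?thesis
      unfolding 1 2 by (simp add: mult_single pdiff_single algebra_simps)
  qed
  have "pdiff v (P * Q) = pdiff v ((\<Sum>k\<in>Poly_Mapping.keys P. Poly_Mapping.single k (lk P k)) *
      (\<Sum>l\<in>Poly_Mapping.keys Q. Poly_Mapping.single l (lk Q l)))"
    using cpoly_single_sum[of P] cpoly_single_sum[of Q] by simp
  also have "\<dots> = pdiff v (\<Sum>k\<in>Poly_Mapping.keys P. Poly_Mapping.single k (lk P k)) *
      (\<Sum>l\<in>Poly_Mapping.keys Q. Poly_Mapping.single l (lk Q l)) +
      (\<Sum>k\<in>Poly_Mapping.keys P. Poly_Mapping.single k (lk P k)) *
      pdiff v (\<Sum>l\<in>Poly_Mapping.keys Q. Poly_Mapping.single l (lk Q l))"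
    by (simp add: sum_product pdiff_sum single sum.distrib)
  also have "\<dots> = pdiff v P * Q + P * pdiff v Q"
    using cpoly_single_sum[of P] cpoly_single_sum[of Q] by simp
  finally show ?thesis .
qed

lemma pdiff_cst [simp]: "pdiff v (cst c) = 0"
  by (simp add: cst_def pdiff_single)

lemma pdiff_var: "pdiff v (var w) = (if v = w then 1 else 0)"
  by (simp add: var_def pdiff_single lookup_single)

section \<open>Evaluation\<close>

lemma peval_superset:
  assumes "finite A" "Poly_Mapping.keys P \<subseteq> A"
  shows "peval g P = (\<Sum>m\<in>A. cst (lk P m) * (\<Prod>v\<in>Poly_Mapping.keys m. g v ^ lk m v))"
  unfolding peval_def
  by (rule sum.mono_neutral_left) (use assms in \<open>auto simp: in_keys_iff\<close>)

lemma peval_add: "peval g (P + Q) = peval g P + peval g Q"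
proof -
  let ?A = "Poly_Mapping.keys P \<union> Poly_Mapping.keys Q"
  have "Poly_Mapping.keys (P + Q) \<subseteq> ?A" by (rule keys_add)
  then show ?thesis
    by (subst (1 2 3) peval_superset[of ?A])
      (auto simp: lookup_add cst_add distrib_right sum.distrib)
qed

lemma peval_sum: "peval g (sum f A) = (\<Sum>x\<in>A. peval g (f x))"
proof (induction A rule: infinite_finite_induct)
  case (insert x F)
  then show ?case by (simp add: peval_add)
qed (simp_all add: peval_def)

lemma peval_single: "peval g (Poly_Mapping.single m c) = cst c * (\<Prod>v\<in>Poly_Mapping.keys m. g v ^ lk m v)"
  by (cases "c = 0") (simp_all add: peval_def)

lemma peval_mult: "peval g (P * Q) = peval g P * peval g Q"
proof -
  have sup: "(\<Prod>v\<in>Poly_Mapping.keys m. g v ^ lk m v) = (\<Prod>v\<in>A. g v ^ lk m v)"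
    if "finite A" "Poly_Mapping.keys m \<subseteq> A" for m A
    by (rule prod.mono_neutral_left) (use that in \<open>auto simp: in_keys_iff\<close>)
  have single: "peval g (Poly_Mapping.single k a * Poly_Mapping.single l b)
     = peval g (Poly_Mapping.single k a) * peval g (Poly_Mapping.single l b)" for k l a b
  proof -
    let ?A = "Poly_Mapping.keys k \<union> Poly_Mapping.keys l"
    have "Poly_Mapping.keys (k + l) \<subseteq> ?A" by (rule keys_add)
    then show ?thesis
      unfolding mult_single peval_single
      by (subst (1 2 3) sup[of ?A])
        (auto simp: lookup_add cst_mult power_add prod.distrib mult_ac)
  qed
  have "peval g (P * Q) = peval g ((\<Sum>k\<in>Poly_Mapping.keys P. Poly_Mapping.single k (lk P k)) *
      (\<Sum>l\<in>Poly_Mapping.keys Q. Poly_Mapping.single l (lk Q l)))"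
    using cpoly_single_sum[of P] cpoly_single_sum[of Q] by simp
  also have "\<dots> = peval g (\<Sum>k\<in>Poly_Mapping.keys P. Poly_Mapping.single k (lk P k)) *
      peval g (\<Sum>l\<in>Poly_Mapping.keys Q. Poly_Mapping.single l (lk Q l))"
    by (simp add: sum_product peval_sum single)
  also have "\<dots> = peval g P * peval g Q"
    using cpoly_single_sum[of P] cpoly_single_sum[of Q] by simp
  finally show ?thesis .
qed

lemma peval_cst [simp]: "peval g (cst c) = cst c"
  by (simp add: cst_def peval_single)

lemma peval_var [simp]: "peval g (var v) = g v"
  by (simp add: var_def peval_single lookup_single)

text \<open>
  A derivation is determined by its values on the generators, so on polynomial expressions in the
  \<open>g v\<close> the derivation \<open>D\<close> is the formal partial derivative.
\<close>
lemma derivation_peval: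
  assumes add: "\<And>u v. D (u + v) = D u + D v"
    and mult: "\<And>u v. D (u * v) = D u * v + u * D v"
    and cst: "\<And>c. D (cst c) = 0"
    and gen: "\<And>v. D (g v) = (if v = w then 1 else 0)"
  shows "D (peval g P) = peval g (pdiff w P)"
proof (induction P rule: cpoly_induct)
  case (cst c)
  show ?case using assms(3) peval_cst[of g 0] by simp
next
  case (var v)
  show ?case using peval_cst[of g 0] peval_cst[of g 1] by (simp add: gen pdiff_var)
next
  case (add u v)
  then show ?case by (simp add: peval_add assms(1) pdiff_add)
next
  case (mult u v)
  then show ?case by (simp add: peval_mult peval_add assms(2) pdiff_mult)
qed

text \<open>
  By the previous lemma the value does not depend on the preimage under \<open>peval g\<close> which is chosen
  by \<open>inv_into\<close>.
\<close>
lemma pdiff_wrt_eq_derivation: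
  assumes "\<And>u v. D (u + v) = D u + D v"
    and "\<And>u v. D (u * v) = D u * v + u * D v"
    and "\<And>c. D (cst c) = 0"
    and "\<And>v. D (g v) = (if v = w then 1 else 0)"
    and "u \<in> range (peval g)"
  shows "pdiff_wrt g w u = D u"
  unfolding pdiff_wrt_def
  using derivation_peval[of D g w "inv_into UNIV (peval g) u", OF assms(1-4)] assms(5)
  by (simp add: f_inv_into_f)

section \<open>The inner product\<close>

lemma inner_superset:
  assumes "finite A" "Poly_Mapping.keys u \<subseteq> A"
  shows "inner_FG u v = (\<Sum>m\<in>A. lk u m * cnj (lk v m) * of_nat (z_monom m))"
  unfolding inner_FG_def
  by (rule sum.mono_neutral_left) (use assms in \<open>auto simp: in_keys_iff\<close>)

lemma inner_add_left: "inner_FG (u + u') v = inner_FG u v + inner_FG u' v"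
proof -
  let ?A = "Poly_Mapping.keys u \<union> Poly_Mapping.keys u'"
  have "Poly_Mapping.keys (u + u') \<subseteq> ?A" by (rule keys_add)
  then show ?thesis
    by (subst (1 2 3) inner_superset[of ?A])
      (auto simp: lookup_add distrib_right sum.distrib)
qed

lemma inner_cnj: "cnj (inner_FG u v) = inner_FG v u"
proof -
  let ?A = "Poly_Mapping.keys u \<union> Poly_Mapping.keys v"
  show ?thesis
    by (subst (1 2) inner_superset[of ?A]) (auto simp: mult_ac)
qed

lemma inner_add_right: "inner_FG u (v + v') = inner_FG u v + inner_FG u v'"
  by (metis inner_cnj inner_add_left complex_cnj_add)

lemma inner_cst_left: "inner_FG (cst c * u) v = c * inner_FG u v"
proof -
  have "Poly_Mapping.keys (cst c * u) \<subseteq> Poly_Mapping.keys u"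
    by (auto simp: in_keys_iff)
  then show ?thesis
    by (subst (1 2) inner_superset[of "Poly_Mapping.keys u"]) (auto simp: sum_distrib_left mult.assoc)
qed

lemma inner_cst_right: "inner_FG u (cst c * v) = cnj c * inner_FG u v"
  by (metis inner_cnj inner_cst_left complex_cnj_mult)

lemma inner_0_left [simp]: "inner_FG 0 v = 0"
  by (simp add: inner_FG_def)

lemma inner_0_right [simp]: "inner_FG v 0 = 0"
  by (simp add: inner_FG_def)

lemma inner_sum_left: "inner_FG (sum f A) v = (\<Sum>x\<in>A. inner_FG (f x) v)"
  by (induction A rule: infinite_finite_induct) (simp_all add: inner_add_left)

lemma inner_sum_right: "inner_FG v (sum f A) = (\<Sum>x\<in>A. inner_FG v (f x))"
  by (induction A rule: infinite_finite_induct) (simp_all add: inner_add_right)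

lemma inner_1_1: "inner_FG 1 1 = 1"
  by (simp add: inner_FG_def z_monom_def)

lemma z_monom_superset:
  assumes "finite A" "Poly_Mapping.keys m \<subseteq> A"
  shows "z_monom m = (\<Prod>v\<in>A. (snd v + 1) ^ lk m v * fact (lk m v))"
  unfolding z_monom_def case_prod_unfold
  by (rule prod.mono_neutral_cong_left) (use assms in \<open>auto simp: in_keys_iff\<close>)

lemma z_monom_add_var:
  "z_monom (m + Poly_Mapping.single (\<phi>, k) 1) = (k + 1) * (lk m (\<phi>, k) + 1) * z_monom m"
proof -
  let ?e = "Poly_Mapping.single (\<phi>, k) (1::nat)"
  let ?A = "insert (\<phi>, k) (Poly_Mapping.keys m)"
  have sub: "Poly_Mapping.keys (m + ?e) \<subseteq> ?A"
    using keys_add[of m ?e] by (auto simp: keys_single)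
  have "z_monom (m + ?e) = ((k + 1) ^ (lk m (\<phi>, k) + 1) * fact (lk m (\<phi>, k) + 1)) *
      (\<Prod>v\<in>Poly_Mapping.keys m - {(\<phi>, k)}. (snd v + 1) ^ lk m v * fact (lk m v))"
  proof -
    have "lk (m + ?e) v = lk m v" if "v \<noteq> (\<phi>, k)" for v
      using that by (simp add: lookup_add lookup_single_not_eq)
    moreover have "lk (m + ?e) (\<phi>, k) = lk m (\<phi>, k) + 1"
      by (simp add: lookup_add)
    ultimately show ?thesis
      by (subst z_monom_superset[OF _ sub]) (simp_all add: prod.insert_remove)
  qed
  moreover have "z_monom m = ((k + 1) ^ (lk m (\<phi>, k)) * fact (lk m (\<phi>, k))) *
      (\<Prod>v\<in>Poly_Mapping.keys m - {(\<phi>, k)}. (snd v + 1) ^ lk m v * fact (lk m v))"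
    by (subst z_monom_superset[of ?A]) (auto simp: prod.insert_remove)
  ultimately show ?thesis by (simp add: algebra_simps)
qed

lemma lookup_var_mult:
  "lk (var v * u) (m + Poly_Mapping.single v 1) = lk u m"
  "lk m v = 0 \<Longrightarrow> lk (var v * u) m = 0"
proof -
  let ?e = "Poly_Mapping.single v (1::nat)"
  have eq: "var v * u = (\<Sum>k\<in>Poly_Mapping.keys u. Poly_Mapping.single (?e + k) (lk u k))"
    using arg_cong[OF cpoly_single_sum[of u], of "\<lambda>w. var v * w"]
    by (simp only: sum_distrib_left var_def mult_single mult_1)
  show "lk (var v * u) (m + ?e) = lk u m"
    unfolding eq
    by (simp add: lookup_sum lookup_single when_def in_keys_iff add.commute[of ?e] del: One_nat_def)
  show "lk (var v * u) m = 0" if "lk m v = 0"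
  proof -
    have "?e + k \<noteq> m" for k
      using that by (auto simp: lookup_add)
    then show ?thesis unfolding eq by (simp add: lookup_sum lookup_single)
  qed
qed

text \<open>
  Adding a part \<open>k + 1\<close> of multiplicity \<open>m\<close> multiplies \<open>z\<^sub>\<lambda>\<close> by \<open>(k + 1) (m + 1)\<close>; the factor
  \<open>m + 1\<close> is the one produced by differentiation, and \<open>k + 1\<close> remains.
\<close>
lemma inner_var_left: "inner_FG (var (\<phi>, k) * u) v = of_nat (k + 1) * inner_FG u (pdiff (\<phi>, k) v)"
proof -
  let ?e = "Poly_Mapping.single (\<phi>, k) (1::nat)"
  let ?B = "(\<lambda>m. m + ?e) ` Poly_Mapping.keys u"
  have sub: "Poly_Mapping.keys (var (\<phi>, k) * u) \<subseteq> ?B"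
  proof
    fix m assume m: "m \<in> Poly_Mapping.keys (var (\<phi>, k) * u)"
    then have nz: "lk m (\<phi>, k) \<noteq> 0" using lookup_var_mult(2)[of m "(\<phi>, k)" u] by (auto simp: in_keys_iff)
    have "m = (m - ?e) + ?e"
      by (rule poly_mapping_eqI) (use nz in \<open>auto simp: lookup_add lookup_minus lookup_single when_def\<close>)
    moreover have "lk u (m - ?e) \<noteq> 0"
      using m lookup_var_mult(1)[of "(\<phi>, k)" u "m - ?e"] calculation by (auto simp: in_keys_iff)
    ultimately show "m \<in> ?B" by (auto simp: in_keys_iff)
  qed
  have "inner_FG (var (\<phi>, k) * u) v =
     (\<Sum>m\<in>Poly_Mapping.keys u. lk u m * cnj (lk v (m + ?e)) * of_nat (z_monom (m + ?e)))"
    by (subst inner_superset[OF _ sub])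
      (auto simp: sum.reindex inj_on_def lookup_var_mult simp del: of_nat_mult One_nat_def)
  also have "\<dots> = of_nat (k + 1) * inner_FG u (pdiff (\<phi>, k) v)"
    unfolding inner_FG_def sum_distrib_left
    by (rule sum.cong) (auto simp: z_monom_add_var lookup_pdiff algebra_simps simp del: One_nat_def)
  finally show ?thesis .
qed

lemma inner_var_right: "inner_FG u (var (\<phi>, k) * v) = of_nat (k + 1) * inner_FG (pdiff (\<phi>, k) u) v"
proof -
  have "inner_FG u (var (\<phi>, k) * v) = cnj (inner_FG (var (\<phi>, k) * v) u)"
    by (rule inner_cnj[symmetric])
  also have "\<dots> = of_nat (k + 1) * cnj (inner_FG v (pdiff (\<phi>, k) u))"
    unfolding inner_var_left complex_cnj_mult complex_cnj_of_nat ..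
  finally show ?thesis unfolding inner_cnj .
qed

section \<open>Exponentials of commuting operators\<close>

lemma FG_of_nat_cancel:
  fixes u v :: "'v cpoly"
  assumes "k > 0" "of_nat k * u = of_nat k * v" shows "u = v"
  by (rule cst_cancel[of "of_nat k"]) (use assms in \<open>simp_all add: cst_of_nat\<close>)

lemma of_nat_split_mult:
  "i \<le> k \<Longrightarrow> of_nat k * u = of_nat i * u + of_nat (k - i) * (u :: 'b::comm_ring_1)"
  by (simp add: distrib_right[symmetric] of_nat_add[symmetric] del: of_nat_add of_nat_diff)

lemma sum_triangle_swap:
  "(\<Sum>i\<le>k. \<Sum>l\<le>k - i. f i l) = (\<Sum>l\<le>k. \<Sum>i\<le>k - l. f i (l::nat) :: 'b::comm_monoid_add)"
proof -
  have eq: "{..k - i} = {l. l \<in> {..k} \<and> i + l \<le> k}" "{..k - i} = {l. l \<in> {..k} \<and> l + i \<le> k}"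
    if "i \<le> k" for i
    using that by auto
  have "(\<Sum>i\<le>k. \<Sum>l\<le>k - i. f i l) = (\<Sum>i\<le>k. \<Sum>l | l \<in> {..k} \<and> i + l \<le> k. f i l)"
    by (intro sum.cong) (auto simp: eq(1))
  also have "\<dots> = (\<Sum>l\<le>k. \<Sum>i | i \<in> {..k} \<and> i + l \<le> k. f i l)"
    by (rule sum.swap_restrict) auto
  also have "\<dots> = (\<Sum>l\<le>k. \<Sum>i\<le>k - l. f i l)"
    by (intro sum.cong) (auto simp: eq(2))
  finally show ?thesis .
qed

lemma sum_triangle_diag:
  "(\<Sum>i\<le>(k::nat). \<Sum>l\<le>k - i. f i l) = (\<Sum>m\<le>k. \<Sum>i\<le>m. f i (m - i) :: 'b::comm_monoid_add)"
proof -
  have "(\<Sum>i\<le>k. \<Sum>l\<le>k - i. f i l) = (\<Sum>(i, l)\<in>(SIGMA i:{..k}. {..k - i}). f i l)"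
    by (subst sum.Sigma) auto
  also have "(SIGMA i:{..k}. {..k - i}) = {(i, l). i + l \<le> k}"
    by auto
  finally show ?thesis
    by (simp add: sum.triangle_reindex_eq)
qed

text \<open>
  All facts about \<open>X = exp A\<close> below are derived from the differential equation \<open>X' = A' X\<close>, that
  is, from the recursion \<open>k X\<^sub>k = \<Sum>\<^sub>i i A\<^sub>i X\<^bsub>k-i\<^esub>\<close>, instead of the exponential series.
\<close>
locale commuting_ops =
  fixes A :: "'a::finite_field opseries"
  assumes add: "A n (u + v) = A n u + A n v"
    and scale: "A n (cst c * u) = cst c * A n u"
    and comm: "A n (A m u) = A m (A n u)"
begin

text \<open>The exponential ignores the coefficient with index \<open>0\<close>.\<close>
definition A' :: "'a opseries" where
  "A' n v = (if n = 0 then 0 else A n v)"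

definition pow :: "nat \<Rightarrow> 'a opseries" where
  "pow j = (op_mult A' ^^ j) op_one"

lemma A'_add: "A' n (u + v) = A' n u + A' n v"
  by (simp add: A'_def add)

lemma A'_scale: "A' n (cst c * u) = cst c * A' n u"
  by (simp add: A'_def scale)

lemma A'_comm: "A' n (A' m u) = A' m (A' n u)"
  using scale[of _ 0] comm by (simp add: A'_def)

lemma A'_0 [simp]: "A' n 0 = 0"
  using A'_scale[of n 0] by simp

lemma A'_sum: "A' n (sum f I) = (\<Sum>x\<in>I. A' n (f x))"
  by (induction I rule: infinite_finite_induct) (simp_all add: A'_add)

lemma A'_of_nat: "A' n (of_nat k * u) = of_nat k * A' n u"
  using A'_scale[of n "of_nat k" u] by (simp add: cst_of_nat)

lemma pow_0: "pow 0 k u = (if k = 0 then u else 0)"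
  by (simp add: pow_def op_one_def)

lemma pow_Suc: "pow (Suc j) k u = (\<Sum>i\<le>k. A' i (pow j (k - i) u))"
  by (simp add: pow_def op_mult_def)

lemma pow_below: "k < j \<Longrightarrow> pow j k u = 0"
proof (induction j arbitrary: k)
  case (Suc j)
  have "A' i (pow j (k - i) u) = 0" if "i \<le> k" for i
    using that Suc by (cases "i = 0") (auto simp: A'_def[of 0])
  then show ?case by (simp add: pow_Suc)
qed simp

text \<open>
  This is \<open>(A\<^bsup>j+1\<^esup>)' = (j + 1) A' A\<^sup>j\<close>; here the \<open>A\<^sub>n\<close> have to commute.
\<close>
lemma pow_deriv:
  "of_nat k * pow (Suc j) k u = of_nat (Suc j) * (\<Sum>i\<le>k. of_nat i * A' i (pow j (k - i) u))"
proof (induction j arbitrary: k)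
  case 0
  have "of_nat k * A' i (pow 0 (k - i) u) = of_nat i * A' i (pow 0 (k - i) u)" if "i \<le> k" for i
    using that by (cases "i = k") (auto simp: pow_0)
  then show ?case by (simp add: pow_Suc sum_distrib_left)
next
  case (Suc j)
  let ?S = "\<Sum>i\<le>k. of_nat i * A' i (pow (Suc j) (k - i) u)"
  have "of_nat k * pow (Suc (Suc j)) k u = (\<Sum>i\<le>k. of_nat k * A' i (pow (Suc j) (k - i) u))"
    by (simp add: pow_Suc[of "Suc j"] sum_distrib_left)
  also have "\<dots> = (\<Sum>i\<le>k. of_nat i * A' i (pow (Suc j) (k - i) u)
      + A' i (of_nat (k - i) * pow (Suc j) (k - i) u))"
    by (intro sum.cong refl, unfold A'_of_nat, rule of_nat_split_mult) simp
  also have "\<dots> = ?S + (\<Sum>i\<le>k. A' i (of_nat (k - i) * pow (Suc j) (k - i) u))"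
    by (simp add: sum.distrib)
  also have "(\<Sum>i\<le>k. A' i (of_nat (k - i) * pow (Suc j) (k - i) u)) =
      of_nat (Suc j) * (\<Sum>i\<le>k. \<Sum>l\<le>k - i. of_nat l * A' l (A' i (pow j (k - l - i) u)))"
    unfolding sum_distrib_left[of "of_nat (Suc j)"] Suc A'_of_nat A'_sum
    by (intro sum.cong refl arg_cong[of _ _ "\<lambda>w. of_nat (Suc j) * w"])
      (simp add: A'_comm[of _ _ "pow j _ u"] add.commute)
  also have "(\<Sum>i\<le>k. \<Sum>l\<le>k - i. of_nat l * A' l (A' i (pow j (k - l - i) u))) = ?S"
    by (subst sum_triangle_swap) (simp add: pow_Suc A'_sum sum_distrib_left)
  finally show ?case by (simp add: algebra_simps)
qed

lemma op_exp_pow: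
  assumes "k \<le> N" shows "op_exp A k u = (\<Sum>j\<le>N. cst (1 / fact j) * pow j k u)"
proof -
  have "op_exp A k u = (\<Sum>j\<le>k. cst (1 / fact j) * pow j k u)"
    by (simp add: op_exp_def pow_def A'_def[abs_def])
  also have "\<dots> = (\<Sum>j\<le>N. cst (1 / fact j) * pow j k u)"
    by (rule sum.mono_neutral_left) (use assms in \<open>auto simp: pow_below\<close>)
  finally show ?thesis .
qed

lemma op_exp_0: "op_exp A 0 u = u"
  by (simp add: op_exp_pow[of 0 0] pow_0)

text \<open>
  Differentiate the exponential series term by term.
\<close>
lemma op_exp_rec: "of_nat k * op_exp A k u = (\<Sum>i\<le>k. of_nat i * A i (op_exp A (k - i) u))"
proof (cases k)
  case (Suc n)
  have fact: "cst (1 / fact (Suc j)) * (of_nat (Suc j) * w) = cst (1 / fact j) * w" for j and w :: "'a FG"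
    by (simp add: cst_of_nat[symmetric] mult.assoc[symmetric] cst_mult[symmetric] del: of_nat_Suc)
  have "of_nat k * op_exp A k u = (\<Sum>j\<le>Suc n. cst (1 / fact j) * (of_nat k * pow j k u))"
    unfolding op_exp_pow[OF eq_imp_le[OF Suc]] sum_distrib_left by (simp only: mult.left_commute)
  also have "\<dots> = (\<Sum>j\<le>n. cst (1 / fact (Suc j)) * (of_nat k * pow (Suc j) k u))"
    by (subst sum.atMost_Suc_shift) (simp add: pow_0 Suc)
  also have "\<dots> = (\<Sum>j\<le>n. cst (1 / fact j) * (\<Sum>i\<le>k. of_nat i * A' i (pow j (k - i) u)))"
    by (simp only: pow_deriv fact)
  also have "\<dots> = (\<Sum>i\<le>k. \<Sum>j\<le>n. of_nat i * A' i (cst (1 / fact j) * pow j (k - i) u))"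
    by (subst sum.swap) (simp add: sum_distrib_left A'_scale mult.left_commute)
  also have "\<dots> = (\<Sum>i\<le>k. of_nat i * A' i (\<Sum>j\<le>n. cst (1 / fact j) * pow j (k - i) u))"
    by (simp add: A'_sum sum_distrib_left)
  also have "\<dots> = (\<Sum>i\<le>k. of_nat i * A i (op_exp A (k - i) u))"
  proof (rule sum.cong)
    fix i
    show "of_nat i * A' i (\<Sum>j\<le>n. cst (1 / fact j) * pow j (k - i) u) = of_nat i * A i (op_exp A (k - i) u)"
      using op_exp_pow[of "k - i" n u] Suc by (cases "i = 0") (simp_all add: A'_def)
  qed simp
  finally show ?thesis .
qed simp

end

section \<open>Vertex operators\<close>

text \<open>
  The data of a vertex operator: \<open>\<Sum> a\<^sub>n z\<^sup>n\<close> is the exponent of the multiplication part and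
  \<open>\<Sum> D\<^sub>n z\<^bsup>-n\<^esup>\<close> that of the derivation part.  As the commutators \<open>D\<^sub>n(a\<^sub>k)\<close> are scalars, nonzero
  only for \<open>n = k\<close>, the two exponentials commute up to the scalar series \<open>exp (\<Sum> b\<^sub>n t\<^sup>n)\<close>.  Its
  coefficients \<open>c\<^sub>n\<close> are characterized by the differential equation of the exponential function.
\<close>
locale vertex_ops =
  fixes a :: "nat \<Rightarrow> 'a::finite_field FG" and D :: "'a opseries" and b c :: "nat \<Rightarrow> complex"
  assumes D_add: "D n (u + v) = D n u + D n v"
    and D_mult: "D n (u * v) = D n u * v + u * D n v"
    and D_cst: "D n (cst x) = 0"
    and D_comm: "D n (D m u) = D m (D n u)"
    and D_a: "n > 0 \<Longrightarrow> k > 0 \<Longrightarrow> D n (a k) = (if n = k then cst (b n) else 0)"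
    and D_var: "\<exists>x. D n (var w) = cst x"
    and D_var_finite: "finite {n. D n (var w) \<noteq> 0}"
    and c_0: "c 0 = 1"
    and c_rec: "of_nat n * c n = (\<Sum>i\<le>n. of_nat i * (b i * c (n - i)))"
begin

lemma D_scale: "D n (cst x * u) = cst x * D n u"
  by (simp add: D_mult D_cst)

lemma D_0 [simp]: "D n 0 = 0"
  using D_cst[of n 0] by simp

lemma D_of_nat: "D n (of_nat k * u) = of_nat k * D n u"
  using D_scale[of n "of_nat k" u] by (simp add: cst_of_nat)

lemma D_sum: "D n (sum f I) = (\<Sum>x\<in>I. D n (f x))"
  by (induction I rule: infinite_finite_induct) (simp_all add: D_add)

sublocale D: commuting_ops D
  by unfold_locales (simp_all add: D_add D_scale D_comm)

sublocale M: commuting_ops "\<lambda>n u. a n * u"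
  by unfold_locales (simp_all add: algebra_simps)

abbreviation T :: "'a opseries" where "T \<equiv> op_exp D"

definition E :: "int \<Rightarrow> 'a FG" where
  "E k = (if k < 0 then 0 else op_exp (\<lambda>n u. a n * u) (nat k) 1)"

lemma M_pow: "M.pow j k u = M.pow j k 1 * u"
  by (induction j arbitrary: k)
    (auto simp: M.pow_0 M.pow_Suc M.A'_def sum_distrib_right mult.assoc intro!: sum.cong)

lemma op_exp_M: "op_exp (\<lambda>n u. a n * u) k u = E (int k) * u"
proof -
  have "op_exp (\<lambda>n u. a n * u) k u = (\<Sum>j\<le>k. cst (1 / fact j) * (M.pow j k 1 * u))"
    by (subst M.op_exp_pow[of k k]) (simp_all add: M_pow[symmetric])
  then show ?thesis
    by (simp add: E_def M.op_exp_pow[of k k] sum_distrib_right mult.assoc)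
qed

lemma E_neg [simp]: "k < 0 \<Longrightarrow> E k = 0"
  by (simp add: E_def)

lemma E_nonzero: "E k \<noteq> 0 \<Longrightarrow> k \<ge> 0"
  using E_neg[of k] by linarith

lemma E_0 [simp]: "E 0 = 1"
  by (simp add: E_def M.op_exp_0)

lemma E_rec: "of_nat k * E (int k) = (\<Sum>i\<le>k. of_nat i * (a i * E (int k - int i)))"
proof -
  have "of_nat k * E (int k) = (\<Sum>i\<le>k. of_nat i * (a i * op_exp (\<lambda>n u. a n * u) (k - i) 1))"
    using M.op_exp_rec[of k 1] by (simp add: op_exp_M)
  also have "\<dots> = (\<Sum>i\<le>k. of_nat i * (a i * E (int k - int i)))"
    by (intro sum.cong) (auto simp: E_def nat_diff_distrib)
  finally show ?thesis .
qed

lemma T_0 [simp]: "T 0 u = u"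
  by (rule D.op_exp_0)

lemma T_rec: "of_nat k * T k u = (\<Sum>i\<le>k. of_nat i * D i (T (k - i) u))"
  by (rule D.op_exp_rec)

text \<open>
  In the recursion for \<open>T\<close> the summand with \<open>i = 0\<close> vanishes, so it determines \<open>T\<close>.
\<close>
lemma T_eqI:
  assumes "f 0 = u" "\<And>k. k > 0 \<Longrightarrow> of_nat k * f k = (\<Sum>i\<le>k. of_nat i * D i (f (k - i)))"
  shows "T k u = f k"
proof (induction k rule: less_induct)
  case (less k)
  show ?case
  proof (cases "k = 0")
    case False
    have "of_nat k * T k u = of_nat k * f k"
      unfolding T_rec assms(2)[OF False[unfolded neq0_conv]]
    proof (rule sum.cong)
      fix i assume "i \<in> {..k}"
      then show "of_nat i * D i (T (k - i) u) = of_nat i * D i (f (k - i))"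
        using less[of "k - i"] by (cases "i = 0") auto
    qed simp
    then show ?thesis by (rule FG_of_nat_cancel[OF False[unfolded neq0_conv]])
  qed (simp add: assms(1))
qed

lemma T_add: "T k (u + v) = T k u + T k v"
  by (rule T_eqI[of "\<lambda>k. T k u + T k v"]) (simp_all add: distrib_left T_rec D_add sum.distrib)

lemma T_scale: "T k (cst x * u) = cst x * T k u"
proof (rule T_eqI[of "\<lambda>k. cst x * T k u"])
  fix k
  show "of_nat k * (cst x * T k u) = (\<Sum>i\<le>k. of_nat i * D i (cst x * T (k - i) u))"
    by (simp add: mult.left_commute[of _ "cst x"] T_rec sum_distrib_left D_scale)
qed simp

lemma T_zero [simp]: "T k 0 = 0"
  using T_scale[of k 0] by simp

lemma T_of_nat: "T k (of_nat n * u) = of_nat n * T k u"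
  using T_scale[of k "of_nat n" u] by (simp add: cst_of_nat)

lemma T_sum: "T k (sum f I) = (\<Sum>x\<in>I. T k (f x))"
  by (induction I rule: infinite_finite_induct) (simp_all add: T_add)

lemma D_T: "D n (T k u) = T k (D n u)"
proof (rule T_eqI[of "\<lambda>k. D n (T k u)", symmetric])
  fix k
  show "of_nat k * D n (T k u) = (\<Sum>i\<le>k. of_nat i * D i (D n (T (k - i) u)))"
    by (simp add: D_of_nat[symmetric] T_rec D_sum D_comm)
qed simp

lemma T_T: "T j (T k u) = T k (T j u)"
proof (rule T_eqI[of "\<lambda>j. T k (T j u)"])
  fix j
  have "of_nat j * T k (T j u) = T k (of_nat j * T j u)" by (simp only: T_of_nat)
  also have "\<dots> = T k (\<Sum>i\<le>j. of_nat i * D i (T (j - i) u))" by (simp only: T_rec)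
  also have "\<dots> = (\<Sum>i\<le>j. of_nat i * D i (T k (T (j - i) u)))"
    by (simp only: T_sum T_of_nat D_T[of _ k])
  finally show "of_nat j * T k (T j u) = (\<Sum>i\<le>j. of_nat i * D i (T k (T (j - i) u)))" .
qed simp

text \<open>
  The exponential of a derivation is an algebra homomorphism: by the Leibniz rule the product on the
  right-hand side satisfies the recursion which determines the left-hand side.
\<close>
lemma T_mult: "T k (u * v) = (\<Sum>i\<le>k. T i u * T (k - i) v)"
proof (rule T_eqI[of "\<lambda>k. \<Sum>i\<le>k. T i u * T (k - i) v"])
  fix k :: nat
  have 1: "(\<Sum>i\<le>k. \<Sum>l\<le>k - i. of_nat i * (D i (T l u) * T (k - i - l) v)) =
      (\<Sum>m\<le>k. of_nat m * (T m u * T (k - m) v))"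
    by (subst sum_triangle_diag)
      (simp add: mult.assoc[symmetric] T_rec[of _ u] sum_distrib_right)
  have 2: "(\<Sum>i\<le>k. \<Sum>l\<le>k - i. of_nat i * (T l u * D i (T (k - i - l) v))) =
      (\<Sum>l\<le>k. of_nat (k - l) * (T l u * T (k - l) v))"
  proof (subst sum_triangle_swap, rule sum.cong)
    fix l
    have "of_nat (k - l) * (T l u * T (k - l) v) = T l u * (of_nat (k - l) * T (k - l) v)"
      by (rule mult.left_commute)
    also have "\<dots> = (\<Sum>i\<le>k - l. T l u * (of_nat i * D i (T (k - l - i) v)))"
      by (simp only: T_rec sum_distrib_left)
    also have "\<dots> = (\<Sum>i\<le>k - l. of_nat i * (T l u * D i (T (k - i - l) v)))"
      by (intro sum.cong refl) (simp add: mult.left_commute add.commute)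
    finally show "(\<Sum>i\<le>k - l. of_nat i * (T l u * D i (T (k - i - l) v))) =
      of_nat (k - l) * (T l u * T (k - l) v)" ..
  qed simp
  have "(\<Sum>i\<le>k. of_nat i * D i (\<Sum>l\<le>k - i. T l u * T (k - i - l) v)) =
      (\<Sum>i\<le>k. \<Sum>l\<le>k - i. of_nat i * (D i (T l u) * T (k - i - l) v)) +
      (\<Sum>i\<le>k. \<Sum>l\<le>k - i. of_nat i * (T l u * D i (T (k - i - l) v)))"
    by (simp add: D_sum D_mult sum_distrib_left distrib_left sum.distrib)
  also have "\<dots> = of_nat k * (\<Sum>i\<le>k. T i u * T (k - i) v)"
    unfolding 1 2 sum_distrib_left sum.distrib[symmetric]
    by (intro sum.cong refl, rule of_nat_split_mult[symmetric]) simp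
  finally show "of_nat k * (\<Sum>i\<le>k. T i u * T (k - i) v) =
      (\<Sum>i\<le>k. of_nat i * D i (\<Sum>l\<le>k - i. T l u * T (k - i - l) v))" ..
qed simp

lemma T_cst: "T j (cst x) = (if j = 0 then cst x else 0)"
  by (rule T_eqI) (auto simp: D_cst if_distrib[of "D _"] cong: if_cong)

lemma T_1: "T j 1 = (if j = 0 then 1 else 0)"
  using T_cst[of j 1] by simp

text \<open>
  The coefficientwise form of \<open>\<delta>(exp a(z)) = \<delta>(a(z)) exp a(z)\<close>.  The derivation is arbitrary
  because the lemma is also needed for derivations which are not among the \<open>D\<^sub>n\<close>.
\<close>
lemma derivation_E:
  assumes \<delta>_add: "\<And>u v. \<delta> (u + v) = \<delta> u + \<delta> v"
    and \<delta>_mult: "\<And>u v. \<delta> (u * v) = \<delta> u * v + u * \<delta> v"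
    and \<delta>_cst: "\<And>x. \<delta> (cst x) = 0"
    and \<delta>_a: "\<And>k. k > 0 \<Longrightarrow> \<delta> (a k) = (if k = n then cst \<beta> else 0)"
    and "n > 0"
  shows "\<delta> (E k) = cst \<beta> * E (k - int n)"
proof (induction "nat k" arbitrary: k rule: less_induct)
  case less
  have \<delta>_of_nat: "\<delta> (of_nat k * u) = of_nat k * \<delta> u" for k u
    using \<delta>_mult[of "cst (of_nat k)" u] by (simp add: \<delta>_cst) (simp add: cst_of_nat)
  have \<delta>_sum: "\<delta> (sum f I) = (\<Sum>x\<in>I. \<delta> (f x))" for f :: "nat \<Rightarrow> 'a FG" and I
    using \<delta>_cst[of 0]
    by (induction I rule: infinite_finite_induct) (simp_all add: \<delta>_add)
  show ?case
  proof (cases "k \<le> 0")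
    case True
    then show ?thesis using \<open>n > 0\<close> \<delta>_cst[of 0] \<delta>_cst[of 1] by (cases "k = 0") auto
  next
    case False
    then obtain m where k: "k = int m" "m > 0" by (metis nonneg_int_cases not_le zero_less_imp_eq_int)
    have IH: "\<delta> (E (k - int i)) = cst \<beta> * E (k - int i - int n)" if "i > 0" for i
      using less that False by simp
    have "of_nat m * \<delta> (E k) = (\<Sum>i\<le>m. of_nat i * (\<delta> (a i) * E (k - int i) + a i * \<delta> (E (k - int i))))"
      unfolding k \<delta>_of_nat[of m, symmetric] E_rec \<delta>_sum \<delta>_of_nat \<delta>_mult[of "a _"] ..
    also have "\<dots> = (\<Sum>i\<le>m. of_nat i * (if i = n then cst \<beta> * E (k - int n) else 0) +
        cst \<beta> * (of_nat i * (a i * E (k - int n - int i))))"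
    proof (rule sum.cong)
      fix i
      show "of_nat i * (\<delta> (a i) * E (k - int i) + a i * \<delta> (E (k - int i))) =
        of_nat i * (if i = n then cst \<beta> * E (k - int n) else 0) +
        cst \<beta> * (of_nat i * (a i * E (k - int n - int i)))"
        by (cases "i = 0") (auto simp: IH \<delta>_a algebra_simps)
    qed simp
    also have "\<dots> = (if n \<le> m then of_nat n * (cst \<beta> * E (k - int n)) else 0) +
        cst \<beta> * (\<Sum>i\<le>m. of_nat i * (a i * E (k - int n - int i)))"
      by (simp add: sum.distrib sum_distrib_left if_distrib[of "\<lambda>x. _ * x"] cong: if_cong)
    also have "\<dots> = of_nat m * (cst \<beta> * E (k - int n))"
    proof (cases "n \<le> m")
      case True
      have "(\<Sum>i\<le>m. of_nat i * (a i * E (k - int n - int i))) =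
          (\<Sum>i\<le>m - n. of_nat i * (a i * E (k - int n - int i)))"
      proof (rule sum.mono_neutral_right)
        have "k - int n - int i < 0" if "i \<in> {..m} - {..m - n}" for i
          using k that by auto
        then show "\<forall>i\<in>{..m} - {..m - n}. of_nat i * (a i * E (k - int n - int i)) = 0"
          by simp
      qed auto
      also have "\<dots> = of_nat (m - n) * E (k - int n)"
        using E_rec[of "m - n"] k True by (simp add: of_nat_diff)
      finally show ?thesis
        using True of_nat_split_mult[OF True, of "cst \<beta> * E (k - int n)"]
        by (simp add: mult.left_commute)
    next
      case False
      then show ?thesis using k by simp
    qed
    finally show ?thesis using k(2) by (rule FG_of_nat_cancel[rotated])
  qed
qed

lemma D_E: "n > 0 \<Longrightarrow> D n (E k) = cst (b n) * E (k - int n)"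
  by (rule derivation_E) (auto simp: D_add D_mult D_cst D_a)

lemma T_E: "T j (E k) = cst (c j) * E (k - int j)"
proof (rule T_eqI)
  fix j :: nat
  have "(\<Sum>i\<le>j. of_nat i * D i (cst (c (j - i)) * E (k - int (j - i)))) =
      (\<Sum>i\<le>j. cst (of_nat i * (b i * c (j - i))) * E (k - int j))"
  proof (rule sum.cong)
    fix i assume "i \<in> {..j}"
    then show "of_nat i * D i (cst (c (j - i)) * E (k - int (j - i))) =
        cst (of_nat i * (b i * c (j - i))) * E (k - int j)"
      by (cases "i = 0") (simp_all add: D_scale D_E cst_mult cst_of_nat of_nat_diff mult_ac)
  qed simp
  also have "\<dots> = of_nat j * (cst (c j) * E (k - int j))"
    unfolding sum_distrib_right[symmetric] cst_sum[symmetric] c_rec[symmetric]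
    by (simp add: cst_mult cst_of_nat mult.assoc)
  finally show "of_nat j * (cst (c j) * E (k - int j)) =
      (\<Sum>i\<le>j. of_nat i * D i (cst (c (j - i)) * E (k - int (j - i))))" ..
qed (simp add: c_0)

lemma T_E_mult: "T j (E k * u) = (\<Sum>i\<le>j. cst (c i) * (E (k - int i) * T (j - i) u))"
  by (simp add: T_mult T_E mult.assoc)

lemma T_var: "j > 0 \<Longrightarrow> T j (var v) = D j (var v)"
proof -
  have "T j (var v) = (if j = 0 then var v else D j (var v))"
  proof (rule T_eqI)
    fix k :: nat assume "k > 0"
    have "of_nat i * D i (if k - i = 0 then var v else D (k - i) (var v)) =
        (if i = k then of_nat k * D k (var v) else 0)" if "i \<le> k" for i
    proof (cases "i = k")
      case False
      then show ?thesis using that D_var[of "k - i" v] by (auto simp: D_cst)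
    qed simp
    then show "of_nat k * (if k = 0 then var v else D k (var v)) =
        (\<Sum>i\<le>k. of_nat i * D i (if k - i = 0 then var v else D (k - i) (var v)))"
      using \<open>k > 0\<close> by simp
  qed simp
  then show "j > 0 \<Longrightarrow> T j (var v) = D j (var v)" by simp
qed

text \<open>
  The elements with this property form a subalgebra that contains the generators.  The lemma makes
  the sums that define vertex operators finite.
\<close>
lemma T_locally_finite: "\<exists>J. \<forall>j>J. T j u = 0"
proof (induction u rule: cpoly_induct)
  case (cst x)
  show ?case by (auto simp: T_cst)
next
  case (var v)
  obtain J where "\<forall>n\<in>{n. D n (var v) \<noteq> 0}. n \<le> J"
    using D_var_finite[of v] finite_nat_set_iff_bounded_le by blast
  then have "T j (var v) = 0" if "j > J" for j
    using that by (subst T_var) (auto simp: not_le[symmetric])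
  then show ?case by blast
next
  case (add u v)
  then obtain J J' where "\<forall>j>J. T j u = 0" "\<forall>j>J'. T j v = 0" by blast
  then have "\<forall>j>max J J'. T j (u + v) = 0" by (simp add: T_add)
  then show ?case by blast
next
  case (mult u v)
  then obtain J J' where J: "\<forall>j>J. T j u = 0" "\<forall>j>J'. T j v = 0" by blast
  have "T j (u * v) = 0" if "j > J + J'" for j
  proof -
    have "T i u * T (j - i) v = 0" for i
      using J that by (cases "i > J") auto
    then show ?thesis by (simp add: T_mult)
  qed
  then show ?case by blast
qed

definition vop :: "int \<Rightarrow> 'a FG \<Rightarrow> 'a FG" where
  "vop m u = (\<Sum>j | T j u \<noteq> 0. E (m + int j) * T j u)"

lemma T_support_finite: "finite {j. T j u \<noteq> 0}"
proof -
  obtain J where "\<forall>j>J. T j u = 0" using T_locally_finite by blast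
  then have "{j. T j u \<noteq> 0} \<subseteq> {..J}" by (auto simp: not_less[symmetric])
  then show ?thesis by (rule finite_subset) simp
qed

lemma vertex_op_eq_vop: "vertex_op (\<lambda>n u. a n * u) D m u = vop m u"
proof -
  let ?J = "{j. T j u \<noteq> 0}" and ?J' = "{j. T j u \<noteq> 0 \<and> m + int j \<ge> 0}"
  have "vertex_op (\<lambda>n u. a n * u) D m u =
      (\<Sum>(i, j) | int i - int j = m \<and> T j u \<noteq> 0. E (int i) * T j u)"
    by (simp add: vertex_op_def op_exp_M)
  also have "\<dots> = (\<Sum>j\<in>?J'. E (m + int j) * T j u)"
    by (rule sum.reindex_bij_witness[of _ "\<lambda>j. (nat (m + int j), j)" snd]) auto
  also have "\<dots> = vop m u"
    unfolding vop_def
    by (rule sum.mono_neutral_left) (auto simp: T_support_finite intro!: E_nonzero)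
  finally show ?thesis .
qed

lemma vop_bounded:
  assumes "\<And>j. j > J \<Longrightarrow> T j u = 0" shows "vop m u = (\<Sum>j\<le>J. E (m + int j) * T j u)"
  unfolding vop_def
  by (rule sum.mono_neutral_left) (use assms in \<open>auto simp: not_less[symmetric]\<close>)

lemma vop_1: "vop m 1 = E m"
  by (subst vop_bounded[of 0]) (simp_all add: T_1)

lemma vop_add: "vop m (u + v) = vop m u + vop m v"
proof -
  obtain J J' where J: "\<forall>j>J. T j u = 0" "\<forall>j>J'. T j v = 0" using T_locally_finite by metis
  have "vop m u = (\<Sum>j\<le>max J J'. E (m + int j) * T j u)"
    "vop m v = (\<Sum>j\<le>max J J'. E (m + int j) * T j v)"
    "vop m (u + v) = (\<Sum>j\<le>max J J'. E (m + int j) * T j (u + v))"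
    by (rule vop_bounded; use J in \<open>simp add: T_add\<close>)+
  then show ?thesis by (simp add: T_add distrib_left sum.distrib)
qed

lemma vop_scale: "vop m (cst x * u) = cst x * vop m u"
proof -
  obtain J where J: "\<forall>j>J. T j u = 0" using T_locally_finite by metis
  have "vop m u = (\<Sum>j\<le>J. E (m + int j) * T j u)"
    "vop m (cst x * u) = (\<Sum>j\<le>J. E (m + int j) * T j (cst x * u))"
    by (rule vop_bounded; use J in \<open>simp add: T_scale\<close>)+
  then show ?thesis by (simp add: T_scale sum_distrib_left mult.left_commute)
qed

lemma vop_zero [simp]: "vop m 0 = 0"
  by (simp add: vop_def)

lemma vop_eq_0:
  assumes "\<And>j. j > J \<Longrightarrow> T j u = 0" "m + int J < 0" shows "vop m u = 0"
proof -
  have "E (m + int j) * T j u = 0" if "j \<le> J" for j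
    using assms(2) that by simp
  then show ?thesis by (subst vop_bounded[of J]) (use assms(1) in auto)
qed

text \<open>
  The exchange relation: moving \<open>T\<close> to the right past a vertex operator produces the contraction
  series with coefficients \<open>c\<^sub>i\<close> and lowers the index of the operator.
\<close>
lemma T_vop: "T j (vop m u) = (\<Sum>i\<le>j. cst (c i) * vop (m - int i) (T (j - i) u))"
proof -
  obtain J where J: "\<And>j. j > J \<Longrightarrow> T j u = 0" using T_locally_finite by metis
  have J': "T l (T i u) = 0" if "l > J" for l i
    using J[OF that] by (simp add: T_T[of l i])
  have "T j (vop m u) = (\<Sum>l\<le>J. \<Sum>i\<le>j. cst (c i) * (E (m + int l - int i) * T (j - i) (T l u)))"
    by (simp add: vop_bounded[OF J] T_sum T_E_mult)
  also have "\<dots> = (\<Sum>i\<le>j. cst (c i) * (\<Sum>l\<le>J. E (m - int i + int l) * T l (T (j - i) u)))"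
    by (subst sum.swap) (simp add: sum_distrib_left T_T algebra_simps)
  also have "\<dots> = (\<Sum>i\<le>j. cst (c i) * vop (m - int i) (T (j - i) u))"
    by (simp add: vop_bounded[OF J'])
  finally show ?thesis .
qed

end

section \<open>Formal series\<close>

definition finite_support :: "series \<Rightarrow> bool" where
  "finite_support F \<longleftrightarrow> finite {e. F e \<noteq> 0}"

text \<open>
  Multiplication by \<open>W j / W i\<close> with \<open>i < j\<close> lowers none of the sums of the exponents of
  \<open>W t, \<dots>, W (r - 1)\<close>, and raises the one for \<open>t = j\<close>.  Hence series for which these sums are bounded below may be
  multiplied by any power series in \<open>W j / W i\<close>: each coefficient of the product is a finite sum.
\<close>
definition tail :: "nat \<Rightarrow> nat \<Rightarrow> (svar \<Rightarrow>\<^sub>0 int) \<Rightarrow> int" where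
  "tail r t e = (\<Sum>i\<in>{t..<r}. lk e (W i))"

definition tail_bounded :: "nat \<Rightarrow> series \<Rightarrow> bool" where
  "tail_bounded r F \<longleftrightarrow> (\<exists>C. \<forall>e. F e \<noteq> 0 \<longrightarrow> (\<forall>t. C \<le> tail r t e))"

definition ratio_exp :: "nat \<Rightarrow> nat \<Rightarrow> nat \<Rightarrow> svar \<Rightarrow>\<^sub>0 int" where
  "ratio_exp i j k = Poly_Mapping.single (W j) (int k) - Poly_Mapping.single (W i) (int k)"

lemma tail_diff: "tail r t (d - e) = tail r t d - tail r t e"
  by (simp add: tail_def lookup_minus sum_subtractf)

lemma lookup_ratio_exp:
  "lk (ratio_exp i j k) v = (if v = W j then int k else 0) - (if v = W i then int k else 0)"
  by (auto simp: ratio_exp_def lookup_minus lookup_single when_def)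

lemma tail_ratio_exp:
  assumes "i < j" "j < r"
  shows "tail r t (ratio_exp i j k) = (if i < t \<and> t \<le> j then int k else 0)"
proof -
  have "tail r t (ratio_exp i j k) =
      (\<Sum>n\<in>{t..<r}. if n = j then int k else 0) - (\<Sum>n\<in>{t..<r}. if n = i then int k else 0)"
    by (simp add: tail_def lookup_ratio_exp sum_subtractf)
  then show ?thesis using assms by auto
qed

lemma s_mult_nonzeroE:
  assumes "s_mult F G e \<noteq> 0" obtains d where "F d \<noteq> 0" "G (e - d) \<noteq> 0"
  using assms unfolding s_mult_def by (auto elim: sum.not_neutral_contains_not_neutral)

lemma s_mult_commute: "s_mult F G = s_mult G F"
proof
  fix e
  show "s_mult F G e = s_mult G F e"
    unfolding s_mult_def
    by (rule sum.reindex_bij_witness[of _ "\<lambda>d. e - d" "\<lambda>d. e - d"]) auto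
qed

lemma s_mult_finite_right:
  assumes "finite A" "{d. G d \<noteq> 0} \<subseteq> A"
  shows "s_mult F G e = (\<Sum>d\<in>A. F (e - d) * G d)"
proof -
  have "s_mult F G e = (\<Sum>d | G d \<noteq> 0 \<and> F (e - d) \<noteq> 0. F (e - d) * G d)"
    unfolding s_mult_def
    by (rule sum.reindex_bij_witness[of _ "\<lambda>d. e - d" "\<lambda>d. e - d"]) auto
  also have "\<dots> = (\<Sum>d\<in>A. F (e - d) * G d)"
    by (rule sum.mono_neutral_left) (use assms in auto)
  finally show ?thesis .
qed

lemma s_mult_monom_one: "s_mult F (s_monom 1 0) = F"
proof
  fix e
  show "s_mult F (s_monom 1 0) e = F e"
    by (subst s_mult_finite_right[of "{0}"]) (auto simp: s_monom_def)
qed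

lemma s_mult_const: "s_mult (s_monom x 0) F e = x * F e"
  by (subst s_mult_commute, subst s_mult_finite_right[of "{0}"]) (auto simp: s_monom_def)

lemma finite_support_monom: "finite_support (s_monom x d)"
  unfolding finite_support_def by (rule finite_subset[of _ "{d}"]) (auto simp: s_monom_def)

lemma finite_support_minus: "finite_support F \<Longrightarrow> finite_support G \<Longrightarrow> finite_support (s_minus F G)"
  unfolding finite_support_def
  by (rule finite_subset[of _ "{e. F e \<noteq> 0} \<union> {e. G e \<noteq> 0}"]) (auto simp: s_minus_def)

lemma s_mult_support_subset:
  "{e. s_mult F G e \<noteq> 0} \<subseteq> (\<lambda>(d, d'). d + d') ` ({e. F e \<noteq> 0} \<times> {e. G e \<noteq> 0})"
proof
  fix e assume "e \<in> {e. s_mult F G e \<noteq> 0}"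
  then obtain d where "F d \<noteq> 0" "G (e - d) \<noteq> 0" by (auto elim: s_mult_nonzeroE)
  then show "e \<in> (\<lambda>(d, d'). d + d') ` ({e. F e \<noteq> 0} \<times> {e. G e \<noteq> 0})"
    by (intro image_eqI[of _ _ "(d, e - d)"]) auto
qed

lemma finite_support_mult: "finite_support F \<Longrightarrow> finite_support G \<Longrightarrow> finite_support (s_mult F G)"
  unfolding finite_support_def by (rule finite_subset[OF s_mult_support_subset]) auto

lemma finite_support_prod: "(\<And>F. F \<in> set Fs \<Longrightarrow> finite_support F) \<Longrightarrow> finite_support (s_prod Fs)"
  by (induction Fs) (auto simp: s_prod_def finite_support_monom finite_support_mult)

text \<open>
  Formal series with integer exponents do not form a ring, and the Cauchy product is not associative
  in general.  This lemma and \<open>s_mult_ratio_assoc\<close> are the two cases in which all sums involved are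
  finite.
\<close>
lemma s_mult_assoc_finite:
  assumes "finite_support S" "finite_support B"
  shows "s_mult (s_mult P S) B = s_mult P (s_mult S B)"
proof
  fix e
  let ?S = "{d. S d \<noteq> 0}" and ?B = "{d. B d \<noteq> 0}"
  define U where "U = (\<lambda>(d, d'). d + d') ` (?S \<times> ?B)"
  have fin: "finite ?S" "finite ?B" "finite U"
    using assms by (auto simp: finite_support_def U_def)
  have "s_mult P (s_mult S B) e = (\<Sum>x\<in>U. P (e - x) * (\<Sum>d\<in>?B. S (x - d) * B d))"
    using s_mult_support_subset[of S B] fin
    by (subst s_mult_finite_right[of U]) (auto simp: U_def s_mult_finite_right[of ?B])
  also have "\<dots> = (\<Sum>d\<in>?B. \<Sum>x\<in>U. P (e - x) * (S (x - d) * B d))"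
    by (simp only: sum_distrib_left) (rule sum.swap)
  also have "\<dots> = (\<Sum>d\<in>?B. \<Sum>d'\<in>?S. P (e - d - d') * (S d' * B d))"
  proof (rule sum.cong)
    fix d assume d: "d \<in> ?B"
    have "(\<Sum>x\<in>U. P (e - x) * (S (x - d) * B d)) = (\<Sum>x\<in>(\<lambda>d'. d + d') ` ?S. P (e - x) * (S (x - d) * B d))"
    proof (rule sum.mono_neutral_right)
      show "(\<lambda>d'. d + d') ` ?S \<subseteq> U" using d by (auto simp: U_def intro!: image_eqI[of _ _ "(_, d)"])
      show "\<forall>x\<in>U - (\<lambda>d'. d + d') ` ?S. P (e - x) * (S (x - d) * B d) = 0"
        by (auto simp: image_iff) (metis add_diff_cancel_left' diff_add_cancel add.commute)
    qed (rule fin)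
    also have "\<dots> = (\<Sum>d'\<in>?S. P (e - d - d') * (S d' * B d))"
      by (subst sum.reindex) (auto simp: inj_on_def algebra_simps)
    finally show "(\<Sum>x\<in>U. P (e - x) * (S (x - d) * B d)) = (\<Sum>d'\<in>?S. P (e - d - d') * (S d' * B d))" .
  qed simp
  also have "\<dots> = s_mult (s_mult P S) B e"
    using fin by (simp add: s_mult_finite_right[of ?B] s_mult_finite_right[of ?S] sum_distrib_right mult.assoc)
  finally show "s_mult (s_mult P S) B e = s_mult P (s_mult S B) e" ..
qed

lemma ratio_exp_eq_iff: "i \<noteq> j \<Longrightarrow> ratio_exp i j k = ratio_exp i j k' \<longleftrightarrow> k = k'"
  by (auto simp: lookup_ratio_exp dest!: arg_cong[of "ratio_exp i j k" _ "\<lambda>e. lk e (W j)"])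

lemma in_ratio_exp:
  assumes "i \<noteq> j"
  shows "in_ratio g i j (ratio_exp i j k) = fps_nth g k"
proof -
  have "{k'. ratio_exp i j k = Poly_Mapping.single (W j) (int k') - Poly_Mapping.single (W i) (int k')} = {k}"
    using ratio_exp_eq_iff[OF assms] by (auto simp: ratio_exp_def)
  then show ?thesis by (simp add: in_ratio_def)
qed

lemma in_ratio_nonzeroE:
  assumes "in_ratio g i j d \<noteq> 0" obtains k where "d = ratio_exp i j k"
  using assms unfolding in_ratio_def ratio_exp_def
  by (auto elim: sum.not_neutral_contains_not_neutral)

lemma s_mult_ratio:
  assumes "i \<noteq> j" and "\<And>k. k > N \<Longrightarrow> F (e - ratio_exp i j k) = 0"
  shows "s_mult (in_ratio g i j) F e = (\<Sum>k\<le>N. fps_nth g k * F (e - ratio_exp i j k))"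
proof -
  have inj: "inj_on (ratio_exp i j) {..N}"
    using assms(1) by (simp add: inj_on_def ratio_exp_eq_iff)
  have "s_mult (in_ratio g i j) F e = (\<Sum>d\<in>ratio_exp i j ` {..N}. in_ratio g i j d * F (e - d))"
    unfolding s_mult_def
  proof (rule sum.mono_neutral_left)
    show "{d. in_ratio g i j d \<noteq> 0 \<and> F (e - d) \<noteq> 0} \<subseteq> ratio_exp i j ` {..N}"
    proof
      fix d assume d: "d \<in> {d. in_ratio g i j d \<noteq> 0 \<and> F (e - d) \<noteq> 0}"
      then obtain k where "d = ratio_exp i j k" by (auto elim: in_ratio_nonzeroE)
      then show "d \<in> ratio_exp i j ` {..N}" using d assms(2)[of k] by (cases "k \<le> N") auto
    qed
  qed auto
  then show ?thesis
    using assms(1) by (simp add: sum.reindex[OF inj] in_ratio_exp)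
qed

lemma tail_bounded_ratio_bound:
  assumes "tail_bounded r F" "i < j" "j < r"
  shows "\<exists>N. \<forall>k>N. F (e - ratio_exp i j k) = 0"
proof -
  obtain C where C: "\<And>e t. F e \<noteq> 0 \<Longrightarrow> C \<le> tail r t e"
    using assms(1) by (auto simp: tail_bounded_def)
  have "F (e - ratio_exp i j k) = 0" if "k > nat (tail r j e - C)" for k
  proof (rule ccontr)
    assume "F (e - ratio_exp i j k) \<noteq> 0"
    from C[OF this, of j] show False
      using that assms(2,3) by (simp add: tail_diff tail_ratio_exp)
  qed
  then show ?thesis by blast
qed

lemma tail_bounded_ratio:
  assumes "tail_bounded r F" "i < j" "j < r"
  shows "tail_bounded r (s_mult (in_ratio g i j) F)"
proof -
  obtain C where C: "\<And>e t. F e \<noteq> 0 \<Longrightarrow> C \<le> tail r t e"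
    using assms(1) by (auto simp: tail_bounded_def)
  have "C \<le> tail r t e" if nz: "s_mult (in_ratio g i j) F e \<noteq> 0" for e t
  proof -
    obtain d where d: "in_ratio g i j d \<noteq> 0" "F (e - d) \<noteq> 0" using nz by (rule s_mult_nonzeroE)
    then obtain k where "d = ratio_exp i j k" by (auto elim: in_ratio_nonzeroE)
    then show ?thesis using C[OF d(2), of t] assms(2,3) by (auto simp: tail_diff tail_ratio_exp split: if_splits)
  qed
  then show ?thesis by (auto simp: tail_bounded_def)
qed

lemma tail_bounded_one: "tail_bounded r (s_monom 1 0)"
  unfolding tail_bounded_def by (rule exI[of _ 0]) (auto simp: s_monom_def tail_def)

text \<open>
  Since \<open>S\<close> has finite support, one bound \<open>N\<close> works for all summands, and the two finite sums can be
  interchanged.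
\<close>
lemma s_mult_ratio_assoc:
  assumes "tail_bounded r P" "i < j" "j < r" "finite_support S"
  shows "s_mult (s_mult (in_ratio g i j) P) S = s_mult (in_ratio g i j) (s_mult P S)"
proof
  fix e
  let ?S = "{d. S d \<noteq> 0}"
  have fin: "finite ?S" using assms(4) by (simp add: finite_support_def)
  have "\<forall>d. \<exists>N. \<forall>k>N. P (e - d - ratio_exp i j k) = 0"
    using tail_bounded_ratio_bound[OF assms(1-3)] by blast
  then obtain f where f: "\<And>d k. k > f d \<Longrightarrow> P (e - d - ratio_exp i j k) = 0"
    by metis
  define N where "N = (\<Sum>d\<in>?S. f d)"
  have N: "f d \<le> N" if "d \<in> ?S" for d
    unfolding N_def using fin that by (intro member_le_sum) auto
  have P0: "P (e - d - ratio_exp i j k) = 0" if "d \<in> ?S" "k > N" for d k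
    using f N that by (meson order.strict_trans1)
  have ij: "i \<noteq> j" using assms(2) by simp
  have "s_mult (s_mult (in_ratio g i j) P) S e =
      (\<Sum>d\<in>?S. (\<Sum>k\<le>N. fps_nth g k * P (e - d - ratio_exp i j k)) * S d)"
    using P0 by (auto simp: s_mult_finite_right[OF fin] s_mult_ratio[OF ij] intro!: sum.cong)
  also have "\<dots> = (\<Sum>k\<le>N. fps_nth g k * (\<Sum>d\<in>?S. P (e - ratio_exp i j k - d) * S d))"
    unfolding sum_distrib_left sum_distrib_right
    by (subst sum.swap) (simp add: mult.assoc diff_right_commute diff_diff_eq add.commute)
  also have "\<dots> = s_mult (in_ratio g i j) (s_mult P S) e"
  proof (subst s_mult_ratio[OF ij, of N])
    fix k assume "k > N"
    then show "s_mult P S (e - ratio_exp i j k) = 0"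
      using P0 by (simp add: s_mult_finite_right[OF fin] diff_diff_eq add.commute)
  qed (simp add: s_mult_finite_right[OF fin])
  finally show "s_mult (s_mult (in_ratio g i j) P) S e = s_mult (in_ratio g i j) (s_mult P S) e" .
qed

definition is_ratio :: "nat \<Rightarrow> series \<Rightarrow> bool" where
  "is_ratio r F \<longleftrightarrow> (\<exists>g i j. i < j \<and> j < r \<and> F = in_ratio g i j)"

lemma is_ratioI: "i < j \<Longrightarrow> j < r \<Longrightarrow> is_ratio r (in_ratio g i j)"
  unfolding is_ratio_def by blast

lemma tail_bounded_foldr:
  assumes "\<And>F. F \<in> set Fs \<Longrightarrow> is_ratio r F" "tail_bounded r P"
  shows "tail_bounded r (foldr s_mult Fs P)"
  using assms(1)
proof (induction Fs)
  case (Cons F Fs)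
  then have "is_ratio r F" "tail_bounded r (foldr s_mult Fs P)" by auto
  then show ?case by (auto simp: is_ratio_def intro: tail_bounded_ratio)
qed (simp add: assms(2))

lemma foldr_ratio_assoc:
  assumes "\<And>F. F \<in> set Fs \<Longrightarrow> is_ratio r F" "tail_bounded r P" "finite_support S"
  shows "s_mult (foldr s_mult Fs P) S = foldr s_mult Fs (s_mult P S)"
  using assms(1)
proof (induction Fs)
  case (Cons F Fs)
  obtain g i j where F: "i < j" "j < r" "F = in_ratio g i j"
    using Cons.prems[of F] by (auto simp: is_ratio_def)
  have "tail_bounded r (foldr s_mult Fs P)" using Cons.prems assms(2) by (intro tail_bounded_foldr) auto
  then show ?case
    using Cons by (simp add: F s_mult_ratio_assoc[OF _ F(1,2) assms(3)])
qed simp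

section \<open>Coefficients as values of vertex operators\<close>

text \<open>
  The functionals \<open>L z\<close> are the coefficients of a series in a formal variable \<open>z\<close>, for which multiplying
  the argument by \<open>\<Sum> E\<^sub>k w\<^sup>k\<close> amounts to multiplying the value by \<open>1 - \<sigma> w\<^bsup>\<kappa>\<^esup> z\<^bsup>\<zeta>\<^esup>\<close>.
\<close>
locale vertex_pairing = vertex_ops +
  fixes L :: "int \<Rightarrow> 'a FG \<Rightarrow> complex" and \<kappa> \<zeta> :: nat and \<sigma> :: complex
  assumes \<kappa>_pos: "\<kappa> > 0"
    and L_add: "L z (u + v) = L z u + L z v"
    and L_scale: "L z (cst (c i) * u) = c i * L z u"
    and L_1: "L z 1 = (if z = 0 then 1 else 0)"
    and L_E: "L z (E k * u) = (if k = 0 then L z u else 0) -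
                (if k = int \<kappa> then \<sigma> * L (z - int \<zeta>) u else 0)"
begin

lemma L_0 [simp]: "L z 0 = 0"
  using L_add[of z 0 0] by simp

lemma L_sum: "L z (sum f I) = (\<Sum>x\<in>I. L z (f x))"
  by (induction I rule: infinite_finite_induct) (simp_all add: L_add)

definition vops :: "(svar \<Rightarrow>\<^sub>0 int) \<Rightarrow> nat list \<Rightarrow> 'a FG \<Rightarrow> 'a FG" where
  "vops e is u = foldr (\<lambda>i. vop (lk e (W i))) is u"

lemma vops_add: "vops e is (u + v) = vops e is u + vops e is v"
  by (induction "is") (simp_all add: vops_def vop_add)

lemma vops_scale: "vops e is (cst x * u) = cst x * vops e is u"
  by (induction "is") (simp_all add: vops_def vop_scale)

lemma vops_0 [simp]: "vops e is 0 = 0"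
  by (induction "is") (simp_all add: vops_def)

lemma vops_sum: "vops e is (sum f I) = (\<Sum>x\<in>I. vops e is (f x))"
  by (induction I rule: infinite_finite_induct) (simp_all add: vops_add)

lemma vops_cong: "(\<And>i. i \<in> set is \<Longrightarrow> lk e (W i) = lk e' (W i)) \<Longrightarrow> vops e is u = vops e' is u"
  by (induction "is") (simp_all add: vops_def)

context
  fixes r :: nat
begin

definition single_factor :: "nat \<Rightarrow> series" where
  "single_factor i = s_minus (s_monom 1 0)
     (s_monom \<sigma> (Poly_Mapping.single (W i) (int \<kappa>) + Poly_Mapping.single Z (int \<zeta>)))"

definition pairs_from :: "nat \<Rightarrow> series" where
  "pairs_from s = s_prod (concat (map (\<lambda>i. map (in_ratio (Abs_fps c) i) [i + 1..<r]) [s..<r]))"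

definition singles_from :: "nat \<Rightarrow> series" where
  "singles_from s = s_prod (map single_factor [s..<r])"

definition supported_from :: "nat \<Rightarrow> (svar \<Rightarrow>\<^sub>0 int) \<Rightarrow> bool" where
  "supported_from s e \<longleftrightarrow> (\<forall>i. i < s \<or> r \<le> i \<longrightarrow> lk e (W i) = 0)"

abbreviation Y :: "nat \<Rightarrow> (svar \<Rightarrow>\<^sub>0 int) \<Rightarrow> 'a FG" where
  "Y s e \<equiv> vops e [s..<r] 1"

lemma single_factor_mult:
  "s_mult (single_factor i) F e =
     F e - \<sigma> * F (e - (Poly_Mapping.single (W i) (int \<kappa>) + Poly_Mapping.single Z (int \<zeta>)))"
proof -
  let ?d = "Poly_Mapping.single (W i) (int \<kappa>) + Poly_Mapping.single Z (int \<zeta>)"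
  have "lk ?d (W i) \<noteq> 0" using \<kappa>_pos by (simp add: lookup_add lookup_single)
  then have "?d \<noteq> 0" by (metis lookup_zero)
  then show ?thesis
    by (subst s_mult_commute, subst s_mult_finite_right[of "{0, ?d}"])
      (auto simp: single_factor_def s_minus_def s_monom_def)
qed

lemma finite_support_single_factor: "finite_support (single_factor i)"
  by (simp add: single_factor_def finite_support_minus finite_support_monom)

lemma finite_support_singles: "finite_support (singles_from s)"
  unfolding singles_from_def by (rule finite_support_prod) (auto simp: finite_support_single_factor)

lemma pairs_from_ratios:
  "F \<in> set (concat (map (\<lambda>i. map (in_ratio (Abs_fps c) i) [i + 1..<r]) [s..<r])) \<Longrightarrow> is_ratio r F"
  by (auto intro!: is_ratioI)

lemma tail_bounded_pairs: "tail_bounded r (pairs_from s)"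
  unfolding pairs_from_def s_prod_def
  by (rule tail_bounded_foldr[OF pairs_from_ratios tail_bounded_one])

text \<open>
  All factors which involve \<open>W s\<close> are moved to the front: this is the induction step in the number
  of variables.
\<close>
lemma pairs_singles_step:
  assumes "s < r"
  shows "s_mult (pairs_from s) (singles_from s) =
    foldr s_mult (map (in_ratio (Abs_fps c) s) [s + 1..<r])
      (s_mult (single_factor s) (s_mult (pairs_from (s + 1)) (singles_from (s + 1))))"
proof -
  let ?row = "map (in_ratio (Abs_fps c) s) [s + 1..<r]"
  have pairs: "pairs_from s = foldr s_mult ?row (pairs_from (s + 1))"
    using assms by (simp add: pairs_from_def s_prod_def upt_conv_Cons)
  have singles: "singles_from s = s_mult (single_factor s) (singles_from (s + 1))"
    using assms by (simp add: singles_from_def s_prod_def upt_conv_Cons)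
  have "s_mult (pairs_from s) (singles_from s) = foldr s_mult ?row (s_mult (pairs_from (s + 1)) (singles_from s))"
    unfolding pairs
  proof (rule foldr_ratio_assoc[of _ r])
    show "is_ratio r F" if "F \<in> set ?row" for F
      using that by (auto intro!: is_ratioI)
  qed (simp_all add: tail_bounded_pairs finite_support_singles)
  also have "s_mult (pairs_from (s + 1)) (singles_from s) =
      s_mult (pairs_from (s + 1)) (s_mult (singles_from (s + 1)) (single_factor s))"
    unfolding singles by (simp only: s_mult_commute)
  also have "\<dots> = s_mult (s_mult (pairs_from (s + 1)) (singles_from (s + 1))) (single_factor s)"
    by (rule s_mult_assoc_finite[symmetric, OF finite_support_singles finite_support_single_factor])
  also have "\<dots> = s_mult (single_factor s) (s_mult (pairs_from (s + 1)) (singles_from (s + 1)))"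
    by (rule s_mult_commute)
  finally show ?thesis .
qed

text \<open>
  The \<open>T\<close>'s of the vertex operator in position \<open>s\<close> stand immediately to the left of the operator
  in position \<open>j\<close>, the contractions with the positions \<open>s + 1, \<dots>, j - 1\<close> being left out.  From
  \<open>j = s + 1\<close> to \<open>j = r\<close> this interpolates between the full vertex operator in position \<open>s\<close> and
  multiplication by \<open>E\<close>.
\<close>
definition V :: "nat \<Rightarrow> nat \<Rightarrow> (svar \<Rightarrow>\<^sub>0 int) \<Rightarrow> complex" where
  "V s j e = (\<Sum>l | T l (Y j e) \<noteq> 0.
     L (lk e Z) (E (lk e (W s) + int l) * vops e [s + 1..<j] (T l (Y j e))))"

lemma V_bounded:
  assumes "\<And>l. l > J \<Longrightarrow> T l (Y j e) = 0"
  shows "V s j e = (\<Sum>l\<le>J. L (lk e Z) (E (lk e (W s) + int l) * vops e [s + 1..<j] (T l (Y j e))))"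
  unfolding V_def
  by (rule sum.mono_neutral_left) (use assms in \<open>auto simp: not_less[symmetric]\<close>)

lemma V_row_end:
  "V s r e = L (lk e Z) (E (lk e (W s)) * Y (s + 1) e)"
  by (subst V_bounded[of 0]) (simp_all add: vops_def T_1)

lemma V_row_start:
  "s < r \<Longrightarrow> V s (s + 1) e = L (lk e Z) (Y s e)"
  by (simp add: V_def vops_def upt_conv_Cons vop_def L_sum)

text \<open>
  The exchange relation \<open>T_vop\<close> for the operator in position \<open>j\<close>: the index \<open>e\<^sub>j\<close> drops by \<open>k\<close> and
  the index \<open>e\<^sub>s\<close> rises by \<open>k\<close>, which is a shift of the exponent by that of \<open>(W j / W s)\<^sup>k\<close>.
\<close>
lemma V_step:
  assumes sj: "s < j" "j < r"
  obtains N where "\<And>k. k > N \<Longrightarrow> V s (j + 1) (e - ratio_exp s j k) = 0"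
    and "V s j e = (\<Sum>k\<le>N. c k * V s (j + 1) (e - ratio_exp s j k))"
proof -
  define v where "v = Y (j + 1) e"
  define a where "a = lk e (W j)"
  obtain J where J: "\<And>l. l > J \<Longrightarrow> T l v = 0" using T_locally_finite by metis
  define N where "N = nat \<bar>a\<bar> + J"
  define h where "h k l = L (lk e Z) (E (lk e (W s) + int k + int l) *
      vops e [s + 1..<j] (vop (a - int k) (T l v)))" for k l
  have h0: "h k l = 0" if "k > N \<or> l > J" for k l
  proof -
    have "vop (a - int k) (T l v) = 0"
    proof (cases "l > J")
      case True
      then show ?thesis by (simp add: J)
    next
      case False
      then have "a - int k + int J < 0" using that by (auto simp: N_def)
      moreover have "T m (T l v) = 0" if "m > J" for m
        using J[OF that] by (simp add: T_T[of m l])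
      ultimately show ?thesis by (intro vop_eq_0[of J]) auto
    qed
    then show ?thesis by (simp add: h_def)
  qed
  have Vk: "V s (j + 1) (e - ratio_exp s j k) = (\<Sum>l\<le>J. h k l)" for k
  proof -
    have Yk: "Y (j + 1) (e - ratio_exp s j k) = v"
      unfolding v_def by (rule vops_cong) (use sj in \<open>auto simp: lookup_minus lookup_ratio_exp\<close>)
    have row: "vops (e - ratio_exp s j k) [s + 1..<j + 1] u = vops e [s + 1..<j] (vop (a - int k) u)" for u
    proof -
      have "vops (e - ratio_exp s j k) [s + 1..<j + 1] u =
          vops (e - ratio_exp s j k) [s + 1..<j] (vop (a - int k) u)"
        using sj by (simp add: vops_def a_def lookup_minus lookup_ratio_exp)
      also have "\<dots> = vops e [s + 1..<j] (vop (a - int k) u)"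
        by (rule vops_cong) (auto simp: lookup_minus lookup_ratio_exp)
      finally show ?thesis .
    qed
    show ?thesis
      by (subst V_bounded[of J])
        (use J sj in \<open>simp_all only: Yk row h_def\<close>, auto simp: lookup_minus lookup_ratio_exp h_def add_ac)
  qed
  have "V s j e = (\<Sum>k\<le>N. c k * (\<Sum>l\<le>J. h k l))"
  proof -
    have Yj: "Y j e = vop a v"
      using sj by (simp add: vops_def upt_conv_Cons v_def a_def)
    have Tl: "T l (Y j e) = (\<Sum>i\<le>l. cst (c i) * vop (a - int i) (T (l - i) v))" for l
      by (simp add: Yj T_vop)
    have summand: "L (lk e Z) (E (lk e (W s) + int l) * vops e [s + 1..<j] (T l (Y j e))) =
        (\<Sum>i\<le>l. c i * h i (l - i))" for l
    proof -
      have "E (lk e (W s) + int l) * vops e [s + 1..<j] (T l (Y j e)) =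
          (\<Sum>i\<le>l. cst (c i) * (E (lk e (W s) + int l) * vops e [s + 1..<j] (vop (a - int i) (T (l - i) v))))"
        by (simp add: Tl vops_sum vops_scale sum_distrib_left mult.left_commute)
      then show ?thesis
        by (simp add: L_sum L_scale h_def)
    qed
    have "T l (Y j e) = 0" if "l > N + J" for l
    proof -
      have "vop (a - int i) (T (l - i) v) = 0" if "i \<le> l" for i
      proof (cases "l - i > J")
        case False
        then have "a - int i + int J < 0" using \<open>l > N + J\<close> that by (auto simp: N_def)
        moreover have "T m (T (l - i) v) = 0" if "m > J" for m
          using J[OF that] by (simp add: T_T[of m "l - i"])
        ultimately show ?thesis by (intro vop_eq_0[of J]) auto
      qed (simp add: J)
      then show ?thesis by (simp add: Tl)
    qed
    then have "V s j e = (\<Sum>l\<le>N + J. \<Sum>i\<le>l. c i * h i (l - i))"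
      by (subst V_bounded[of "N + J"]) (simp_all only: summand)
    also have "\<dots> = (\<Sum>i\<le>N + J. \<Sum>l\<le>N + J - i. c i * h i l)"
      by (rule sum_triangle_diag[symmetric])
    \<comment> \<open>the triangle \<open>i + l \<le> N + J\<close> contains the box \<open>i \<le> N\<close>, \<open>l \<le> J\<close>, outside of which \<open>h\<close> vanishes\<close>
    also have "\<dots> = (\<Sum>i\<le>N. \<Sum>l\<le>N + J - i. c i * h i l)"
      by (rule sum.mono_neutral_right) (auto simp: h0)
    also have "\<dots> = (\<Sum>i\<le>N. \<Sum>l\<le>J. c i * h i l)"
      by (intro sum.cong refl sum.mono_neutral_right) (auto simp: h0)
    finally show ?thesis by (simp add: sum_distrib_left)
  qed
  then show ?thesis
    by (intro that[of N]) (simp_all add: Vk[unfolded Suc_eq_plus1[symmetric]] h0)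
qed

lemma supported_ratio:
  assumes "s < j" "j < r" shows "supported_from s (e - ratio_exp s j k) = supported_from s e"
proof -
  have "lk (ratio_exp s j k) (W i) = 0" if "i < s \<or> r \<le> i" for i
    using that assms by (auto simp: lookup_ratio_exp)
  then show ?thesis by (simp add: supported_from_def lookup_minus)
qed

text \<open>
  Downward induction on \<open>j\<close>.  At \<open>j = r\<close> no vertex operator is left to the right of the \<open>T\<close>'s, which
  fix \<open>1\<close>, and the remaining multiplication by \<open>E\<close> is the factor \<open>1 - \<sigma> (W s)\<^bsup>\<kappa>\<^esup> Z\<^bsup>\<zeta>\<^esup>\<close>.  The support condition
  says that the series only involves \<open>W s, \<dots>, W (r - 1)\<close> and \<open>Z\<close>.
\<close>
lemma row_products:
  assumes G: "\<And>e. G e = (if supported_from (s + 1) e then L (lk e Z) (Y (s + 1) e) else 0)"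
    and "s < j" "j \<le> r"
  shows "foldr s_mult (map (in_ratio (Abs_fps c) s) [j..<r]) (s_mult (single_factor s) G) e =
      (if supported_from s e then V s j e else 0)"
  using assms(3,2)
proof (induction j arbitrary: e rule: inc_induct)
  case base
  let ?d = "Poly_Mapping.single (W s) (int \<kappa>) + Poly_Mapping.single Z (int \<zeta>)"
  have d: "lk (e - ?d) (W i) = lk e (W i) - (if i = s then int \<kappa> else 0)" "lk (e - ?d) Z = lk e Z - int \<zeta>" for i
    by (auto simp: lookup_minus lookup_add lookup_single when_def)
  have Y: "Y (s + 1) (e - ?d) = Y (s + 1) e"
    by (rule vops_cong) (auto simp: d)
  have supp: "supported_from (s + 1) e \<longleftrightarrow> supported_from s e \<and> lk e (W s) = 0"
    "supported_from (s + 1) (e - ?d) \<longleftrightarrow> supported_from s e \<and> lk e (W s) = int \<kappa>"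
    using \<open>s < r\<close> by (auto simp: supported_from_def d less_Suc_eq)
  have "s_mult (single_factor s) G e = (if supported_from s e then V s r e else 0)"
    using \<kappa>_pos by (auto simp: single_factor_mult G supp Y d V_row_end L_E simp del: One_nat_def)
  then show ?case by simp
next
  case (step j)
  obtain N where N: "\<And>k. k > N \<Longrightarrow> V s (j + 1) (e - ratio_exp s j k) = 0"
    "V s j e = (\<Sum>k\<le>N. c k * V s (j + 1) (e - ratio_exp s j k))"
    using V_step[of s j e] step by metis
  have IH: "foldr s_mult (map (in_ratio (Abs_fps c) s) [Suc j..<r]) (s_mult (single_factor s) G) =
      (\<lambda>e. if supported_from s e then V s (j + 1) e else 0)"
    using step by auto
  have "foldr s_mult (map (in_ratio (Abs_fps c) s) [j..<r]) (s_mult (single_factor s) G) e =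
      s_mult (in_ratio (Abs_fps c) s j) (\<lambda>e. if supported_from s e then V s (j + 1) e else 0) e"
    using step by (simp add: upt_conv_Cons IH)
  also have "\<dots> = (\<Sum>k\<le>N. c k * (if supported_from s e then V s (j + 1) (e - ratio_exp s j k) else 0))"
    using step N by (subst s_mult_ratio[of s j N]) (auto simp: supported_ratio)
  also have "\<dots> = (if supported_from s e then V s j e else 0)"
    by (simp add: N(2))
  finally show ?case .
qed

lemma pairs_singles_coefficient:
  assumes "s \<le> r"
  shows "s_mult (pairs_from s) (singles_from s) e = (if supported_from s e then L (lk e Z) (Y s e) else 0)"
  using assms
proof (induction s arbitrary: e rule: inc_induct)
  case base
  have "e = 0 \<longleftrightarrow> supported_from r e \<and> lk e Z = 0"
  proof
    assume e: "supported_from r e \<and> lk e Z = 0"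
    show "e = 0"
    proof (rule poly_mapping_eqI)
      fix v show "lk e v = lk 0 v"
        using e by (cases v) (auto simp: supported_from_def not_less[symmetric])
    qed
  qed (simp add: supported_from_def)
  then show ?case
    by (simp add: pairs_from_def singles_from_def s_prod_def s_mult_monom_one vops_def L_1)
      (simp add: s_monom_def)
next
  case (step s)
  have "s_mult (pairs_from s) (singles_from s) e =
      foldr s_mult (map (in_ratio (Abs_fps c) s) [s + 1..<r])
        (s_mult (single_factor s) (s_mult (pairs_from (s + 1)) (singles_from (s + 1)))) e"
    using step by (simp only: pairs_singles_step)
  also have "\<dots> = (if supported_from s e then V s (s + 1) e else 0)"
    by (rule row_products) (use step in auto)
  finally show ?case unfolding V_row_start[OF step(2)] .
qed

end

lemma coefficient_eq:
  "s_mult (s_prod_pairs (length \<mu>) (in_ratio (Abs_fps c)))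
     (s_prod_single (length \<mu>) single_factor) (s_exp m \<mu>) =
   L (int m) (foldr (\<lambda>k. vop (int k)) \<mu> 1)"
proof -
  let ?r = "length \<mu>" and ?e = "s_exp m \<mu>"
  have Z: "lk ?e Z = int m"
    by (simp add: s_exp_def lookup_add lookup_sum lookup_single)
  have W: "lk ?e (W i) = (if i < ?r then int (\<mu> ! i) else 0)" for i
    by (simp add: s_exp_def lookup_add lookup_sum lookup_single when_def)
  have "vops ?e [0..<?r] 1 = foldr (\<lambda>k. vop (int k)) (map (nth \<mu>) [0..<?r]) 1"
    unfolding vops_def foldr_map by (rule foldr_cong) (auto simp: W)
  then have Y: "vops ?e [0..<?r] 1 = foldr (\<lambda>k. vop (int k)) \<mu> 1"
    by (simp only: map_nth)
  show ?thesis
    using pairs_singles_coefficient[of 0 ?r ?e]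
    by (simp add: pairs_from_def singles_from_def s_prod_pairs_def s_prod_single_def Y Z
        supported_from_def W)
qed

text \<open>
  For \<open>\<kappa> = 1\<close> the functionals only see \<open>E\<^sub>0\<close> and \<open>E\<^sub>1\<close>, and \<open>E\<^bsub>n+j\<^esub>\<close> is one of these only for \<open>n = 1\<close>
  and \<open>j = 0\<close>.
\<close>
lemma L_vop_pos:
  assumes "\<kappa> = 1" "n > 0"
  shows "L z (vop n u) = (if n = 1 then - \<sigma> * L (z - int \<zeta>) u else 0)"
proof -
  obtain J where J: "\<And>l. l > J \<Longrightarrow> T l u = 0" using T_locally_finite by metis
  have "L z (vop n u) = (\<Sum>j\<le>J. L z (E (n + int j) * T j u))"
    by (simp add: vop_bounded[OF J] L_sum)
  also have "\<dots> = (\<Sum>j\<le>J. if j = 0 \<and> n = 1 then - \<sigma> * L (z - int \<zeta>) u else 0)"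
    by (rule sum.cong) (use assms in \<open>auto simp: L_E\<close>)
  finally show ?thesis by (auto simp: sum.delta)
qed

end

section \<open>Roots of unity and the Frobenius map\<close>

lemma degree_monom_minus_1: "K > 0 \<Longrightarrow> degree (monom (1::'f::idom) K - 1) = K"
  using degree_add_eq_left[of "- 1" "monom (1::'f) K"] by (simp add: degree_monom_eq)

lemma card_roots_unity_le:
  fixes K :: nat assumes "K > 0"
  shows "finite {x :: 'f::idom. x ^ K = 1}" "card {x :: 'f. x ^ K = 1} \<le> K"
proof -
  define p where "p = monom (1::'f) K - 1"
  have deg: "degree p = K"
    unfolding p_def using assms by (rule degree_monom_minus_1)
  then have p: "p \<noteq> 0" using assms by auto
  have roots: "{x. poly p x = 0} = {x. x ^ K = 1}" by (auto simp: p_def poly_monom)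
  show "finite {x :: 'f. x ^ K = 1}" using poly_roots_finite[OF p] by (simp add: roots)
  show "card {x :: 'f. x ^ K = 1} \<le> K" using card_poly_roots_bound[OF p] by (simp add: roots deg)
qed

text \<open>The polynomial \<open>X\<^sup>K - 1\<close> is separable if \<open>K\<close> is invertible.\<close>
lemma card_roots_unity_alg_closed:
  assumes "of_nat K \<noteq> (0 :: 'f::alg_closed_field)"
  shows "card {x :: 'f. x ^ K = 1} = K"
proof -
  have K: "K > 0" using assms by (cases K) auto
  define p where "p = monom (1::'f) K - 1"
  have deg: "degree p = K"
    unfolding p_def using K by (rule degree_monom_minus_1)
  have lead: "lead_coeff p = 1"
    unfolding deg using K by (cases K) (simp_all add: p_def)
  then have p: "p \<noteq> 0" using K by auto
  have roots: "{x. poly p x = 0} = {x. x ^ K = 1}" by (auto simp: p_def poly_monom)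
  obtain A where A: "size A = K" "p = (\<Prod>x\<in>#A. [:-x, 1:])"
    using alg_closed_imp_factorization[OF p] deg lead by auto
  have "count A x \<le> 1" for x
  proof (rule ccontr)
    assume "\<not> count A x \<le> 1"
    then have "{#x, x#} \<subseteq># A"
      by (auto simp: subseteq_mset_def)
    then obtain B where "A = {#x, x#} + B" by (auto simp: mset_subset_eq_exists_conv)
    then have px: "p = [:-x, 1:] * ([:-x, 1:] * (\<Prod>x\<in>#B. [:-x, 1:]))"
      by (simp add: A(2) del: mult_pCons_left mult_pCons_right)
    have "poly p x = 0" "poly (pderiv p) x = 0"
      unfolding px by (simp_all add: pderiv_mult pderiv_pCons del: mult_pCons_left mult_pCons_right)
    moreover have "poly (pderiv p) x = of_nat K * x ^ (K - 1)"
      by (simp add: p_def pderiv_diff pderiv_monom poly_monom)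
    ultimately show False
      using assms K by (auto simp: p_def poly_monom power_0_left)
  qed
  then have "A = mset_set (set_mset A)"
    by (intro multiset_eqI) (metis count_mset_set(1,3) finite_set_mset le_neq_implies_less less_one count_eq_zero_iff)
  moreover have "set_mset A = {x. poly p x = 0}"
    by (auto simp: A(2) poly_prod_mset prod_mset_zero_iff)
  ultimately have "card {x. poly p x = 0} = K" using A(1) by (metis size_mset_set)
  then show ?thesis by (simp add: roots)
qed

text \<open>
  If \<open>r\<^sup>e\<close> is the exact power of a prime \<open>r\<close> in \<open>d\<close>, some power of a \<open>K\<close>-th root of unity has order
  \<open>r\<^sup>e\<close>, because \<open>X\<^bsup>K/r\<^esup> = 1\<close> has fewer than \<open>K\<close> solutions.  The product with an element of the coprime
  order \<open>d / r\<^sup>e\<close> has order \<open>d\<close>.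
\<close>
lemma exists_primitive_root:
  assumes card: "card {x :: 'f::field. x ^ K = 1} = K" and "K > 0" "d dvd K"
  shows "\<exists>g :: 'f. g ^ d = 1 \<and> (\<forall>k. g ^ k = 1 \<longrightarrow> d dvd k)"
  using assms(3)
proof (induction d rule: less_induct)
  case (less d)
  have d: "d > 0" using less.prems \<open>K > 0\<close> by (auto intro: dvd_pos_nat)
  show ?case
  proof (cases "d = 1")
    case True
    then show ?thesis by (intro exI[of _ 1]) auto
  next
    case False
    then obtain r where r: "prime r" "r dvd d" using prime_factor_nat by blast
    define e where "e = multiplicity r d"
    obtain m where m: "d = r ^ e * m" "\<not> r dvd m"
      using d r unfolding e_def by (metis multiplicity_decompose' neq0_conv not_prime_unit)
    have e: "e > 0" using m r by (cases e) auto
    have cop: "coprime (r ^ e) m" using m r by (simp add: prime_imp_coprime coprime_power_left_iff)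
    have "m > 0" "m < d" using m d e r(1) prime_gt_1_nat[OF r(1)] one_less_power[of r e] by auto
    moreover have "m dvd K" using m(1) less.prems by (metis dvd_mult_right)
    ultimately obtain h :: 'f where h: "h ^ m = 1" "\<And>k. h ^ k = 1 \<Longrightarrow> m dvd k"
      using less.IH by blast
    obtain K' where K': "K = r ^ e * K'" using m(1) less.prems by (metis dvd_mult_left dvdE)
    have "K' > 0" using K' \<open>K > 0\<close> by auto
    \<comment> \<open>\<open>K'' = K / r\<close>\<close>
    define K'' where "K'' = r ^ (e - 1) * K'"
    have K'': "K'' > 0" "K'' < K"
      using e r(1) \<open>K' > 0\<close> prime_gt_1_nat[OF r(1)] by (auto simp: K''_def K' prime_gt_0_nat)
    have "\<not> {x :: 'f. x ^ K = 1} \<subseteq> {x. x ^ K'' = 1}"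
    proof
      assume "{x :: 'f. x ^ K = 1} \<subseteq> {x. x ^ K'' = 1}"
      from card_mono[OF card_roots_unity_le(1)[OF K''(1)] this] show False
        using card_roots_unity_le(2)[OF K''(1), where ?'f = 'f] card K''(2) by simp
    qed
    then obtain x :: 'f where x: "x ^ K = 1" "x ^ K'' \<noteq> 1" by auto
    define y where "y = x ^ K'"
    have y1: "y ^ (r ^ e) = 1" using x(1) by (simp add: y_def power_mult[symmetric] K' mult.commute)
    have y2: "y ^ (r ^ (e - 1)) \<noteq> 1" using x(2) by (simp add: y_def power_mult[symmetric] K''_def mult.commute)
    have y: "r ^ e dvd k" if k: "y ^ k = 1" for k
    proof -
      obtain i where i: "i \<le> e" "gcd k (r ^ e) = r ^ i"
        using divides_primepow_nat[OF r(1)] by (metis gcd_dvd2)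
      obtain a b where ab: "a * k = b * r ^ e + gcd k (r ^ e) \<or> k = 0"
        using bezout_nat[of k "r ^ e"] by (metis mult.commute)
      have "y ^ (r ^ i) = 1"
      proof (cases "k = 0")
        case True
        then show ?thesis using i(2) y1 by simp
      next
        case False
        then have eq: "a * k = b * r ^ e + r ^ i" using ab i(2) by simp
        have "1 = y ^ (a * k)" using k by (simp add: mult.commute[of a] power_mult)
        also have "\<dots> = y ^ (r ^ i)" by (simp only: eq power_add mult.commute[of b] power_mult y1 power_one mult_1)
        finally show ?thesis by simp
      qed
      have "i = e"
      proof (rule ccontr)
        assume "i \<noteq> e"
        then have "r ^ (e - 1) = r ^ i * r ^ (e - 1 - i)" using i(1) by (simp add: power_add[symmetric])
        then have "y ^ (r ^ (e - 1)) = 1" using \<open>y ^ (r ^ i) = 1\<close> by (simp add: power_mult)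
        then show False using y2 by simp
      qed
      then show ?thesis using i(2) by (metis gcd_dvd1)
    qed
    have "(y * h) ^ d = 1"
      using y1 h(1) by (simp add: m(1) power_mult_distrib power_mult) (metis power_mult mult.commute power_one)
    moreover have "d dvd k" if k: "(y * h) ^ k = 1" for k
    proof -
      have "(y * h) ^ (k * m) = 1" "(y * h) ^ (k * r ^ e) = 1" using k by (simp_all add: power_mult)
      then have "y ^ (k * m) * (h ^ m) ^ k = 1" "(y ^ (r ^ e)) ^ k * h ^ (k * r ^ e) = 1"
        by (simp_all add: power_mult_distrib power_mult[symmetric] mult.commute)
      then have "r ^ e dvd k * m" "m dvd k * r ^ e" using y h y1 by simp_all
      then have "r ^ e dvd k" "m dvd k"
        using cop by (simp_all add: coprime_dvd_mult_left_iff coprime_commute)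
      then show ?thesis using cop m(1) by (simp add: divides_mult)
    qed
    ultimately show ?thesis by blast
  qed
qed

text \<open>
  For \<open>0 < k < K\<close> the sum does not change under multiplication by \<open>w\<^sup>k \<noteq> 1\<close>, for a \<open>K\<close>-th root of
  unity \<open>w\<close>.
\<close>
lemma sum_powers_roots_unity:
  assumes "K > 0" "k < K"
  shows "(\<Sum>z :: complex | z ^ K = 1. z ^ k) = (if k = 0 then of_nat K else 0)"
proof (cases "k = 0")
  case True
  then show ?thesis using card_roots_unity_eq[OF assms(1)] by simp
next
  case False
  have fin: "finite {z :: complex. z ^ K = 1}" "finite {z :: complex. z ^ k = 1}"
    using assms False by (auto intro: card_roots_unity_le)
  have "\<not> {z :: complex. z ^ K = 1} \<subseteq> {z. z ^ k = 1}"
  proof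
    assume "{z :: complex. z ^ K = 1} \<subseteq> {z. z ^ k = 1}"
    from card_mono[OF fin(2) this] show False
      using card_roots_unity_eq[OF assms(1)] card_roots_unity_eq[of k] False assms(2) by simp
  qed
  then obtain w :: complex where w: "w ^ K = 1" "w ^ k \<noteq> 1" by auto
  have w0: "w \<noteq> 0" using w(1) assms(1) by (auto simp: power_0_left)
  have "(\<Sum>z :: complex | z ^ K = 1. z ^ k) = (\<Sum>z | z ^ K = 1. (w * z) ^ k)"
    by (rule sum.reindex_bij_witness[of _ "\<lambda>z. w * z" "\<lambda>z. z / w"])
      (use w w0 in \<open>auto simp: power_mult_distrib power_divide\<close>)
  also have "\<dots> = w ^ k * (\<Sum>z | z ^ K = 1. z ^ k)"
    by (simp add: power_mult_distrib sum_distrib_left)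
  finally show ?thesis using w(2) False by simp
qed

lemma card_finite_field_ge_2: "CARD('a::finite_field) \<ge> 2"
  using card_mono[of "UNIV :: 'a set" "{0, 1}"] by simp

lemma card_finite_field_eq_0: "of_nat CARD('a::finite_field) = (0 :: 'a alg_closure)"
proof -
  have "(\<Sum>x\<in>UNIV. x :: 'a) = (\<Sum>x\<in>UNIV. x + 1)"
    by (rule sum.reindex_bij_witness[of _ "\<lambda>x. x + 1" "\<lambda>x. x - 1"]) auto
  then have "of_nat CARD('a) = (0 :: 'a)" by (simp add: sum.distrib)
  then have "to_ac (of_nat CARD('a) :: 'a) = 0" by simp
  then show ?thesis by simp
qed

lemma to_ac_power_card: "to_ac (x :: 'a::finite_field) ^ CARD('a) = to_ac x"
  by (metis finite_field_power_card_eq_same to_ac_power)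

text \<open>
  The polynomial \<open>(X + 1)\<^sup>q - X\<^sup>q - 1\<close> has degree less than \<open>q\<close>, and the \<open>q\<close> elements of the base field
  are roots of it.  This gives the injectivity of the Frobenius map.
\<close>
lemma power_card_add_1:
  "(x + 1) ^ CARD('a::finite_field) = (x :: 'a alg_closure) ^ CARD('a) + 1"
proof -
  let ?q = "CARD('a)"
  define P where "P = (\<Sum>k\<in>{1..<?q}. monom (of_nat (?q choose k)) k :: 'a alg_closure poly)"
  have q: "?q \<ge> 2" by (rule card_finite_field_ge_2)
  have P: "(x + 1) ^ ?q = x ^ ?q + 1 + poly P x" for x
  proof -
    have "{..?q} = insert 0 (insert ?q {1..<?q})" using q by auto
    then show ?thesis
      using q by (simp add: binomial_ring P_def poly_sum poly_monom)
  qed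
  have "P = 0"
  proof (rule ccontr)
    assume nz: "P \<noteq> 0"
    have "degree P < ?q"
      unfolding P_def using q
      by (intro degree_sum_less) (auto intro: le_less_trans[OF degree_monom_le])
    moreover have "range (to_ac :: 'a \<Rightarrow> _) \<subseteq> {x. poly P x = 0}"
    proof clarify
      fix a :: 'a
      show "poly P (to_ac a) = 0"
        using P[of "to_ac a"] to_ac_power_card[of a] to_ac_power_card[of "a + 1"] by simp
    qed
    then have "card (range (to_ac :: 'a \<Rightarrow> _)) \<le> card {x. poly P x = 0}"
      by (intro card_mono poly_roots_finite nz)
    then have "?q \<le> card {x. poly P x = 0}" by (simp add: card_image inj_to_ac)
    ultimately show False using card_poly_roots_bound[OF nz] by simp
  qed
  then show ?thesis using P by simp
qed

lemma frob_eq_iff: "frob x = frob y \<longleftrightarrow> x = (y :: 'a::finite_field alg_closure)"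
proof
  assume eq: "frob x = frob y"
  have q: "CARD('a) > 0" using card_finite_field_ge_2[where ?'a = 'a] by simp
  show "x = y"
  proof (cases "y = 0")
    case True
    then show ?thesis using eq q by (simp add: frob_def power_0_left)
  next
    case False
    then have "(x / y) ^ CARD('a) = 1" using eq by (simp add: frob_def power_divide)
    then have "(x / y - 1) ^ CARD('a) = 0" using power_card_add_1[of "x / y - 1"] by simp
    then show ?thesis using False by (simp add: q)
  qed
qed simp

lemma funpow_frob: "(frob ^^ k) x = (x :: 'a::finite_field alg_closure) ^ (CARD('a) ^ k)"
  by (induction k) (simp_all add: frob_def power_mult[symmetric] mult.commute)

lemma surj_frob: "surj (frob :: 'a::finite_field alg_closure \<Rightarrow> _)"
  unfolding surj_def frob_def
  using nth_root_exists[of "CARD('a)"] card_finite_field_ge_2[where ?'a = 'a] by (metis less_le_trans pos2)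

section \<open>The groups \<open>M\<^sub>n\<close>\<close>

lemma mcard_pos: "n > 0 \<Longrightarrow> CARD('a::finite_field) ^ n - 1 > 0"
  using card_finite_field_ge_2[where ?'a = 'a] one_less_power[of "CARD('a)" n] by simp

lemma card_power_Suc: "CARD('a::finite_field) ^ n = Suc (CARD('a) ^ n - 1)"
  using card_finite_field_ge_2[where ?'a = 'a] by simp

lemma M_level_iff: "n > 0 \<Longrightarrow> x \<in> M_level n \<longleftrightarrow> (x :: 'a::finite_field alg_closure) ^ (CARD('a) ^ n - 1) = 1"
proof -
  assume n: "n > 0"
  have "x ^ (CARD('a) ^ n) = x * x ^ (CARD('a) ^ n - 1)"
    using card_power_Suc[of n, where ?'a = 'a] by (metis power_Suc)
  then show ?thesis using mcard_pos[OF n, where ?'a = 'a]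
    by (auto simp: M_level_def power_0_left split: if_splits)
qed

lemma card_M_level: "n > 0 \<Longrightarrow> card {x :: 'a::finite_field alg_closure. x ^ (CARD('a) ^ n - 1) = 1} = CARD('a) ^ n - 1"
proof (rule card_roots_unity_alg_closed)
  assume "n > 0"
  have "of_nat (CARD('a) ^ n) = (0 :: 'a alg_closure)"
    using \<open>n > 0\<close> by (simp add: card_finite_field_eq_0)
  then have "of_nat (Suc (CARD('a) ^ n - 1)) = (0 :: 'a alg_closure)"
    using card_power_Suc[of n, where ?'a = 'a] by metis
  then show "of_nat (CARD('a) ^ n - 1) \<noteq> (0 :: 'a alg_closure)"
    by (metis add.right_neutral of_nat_Suc one_neq_zero)
qed

lemma M_level_frob: "frob x \<in> M_level n \<longleftrightarrow> x \<in> M_level n"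
proof -
  have "frob x ^ (CARD('a) ^ n) = frob x \<longleftrightarrow> frob (x ^ (CARD('a) ^ n)) = frob x"
    by (simp add: frob_def power_mult[symmetric] mult.commute)
  moreover have "frob x = 0 \<longleftrightarrow> x = 0" by (simp add: frob_def)
  ultimately show ?thesis by (simp add: M_level_def frob_eq_iff)
qed

text \<open>The norm map is the power map with exponent \<open>(q\<^sup>n - 1) / (q\<^sup>m - 1)\<close>.\<close>
definition norm_exp :: "'a::finite_field itself \<Rightarrow> nat \<Rightarrow> nat \<Rightarrow> nat" where
  "norm_exp _ m n = (\<Sum>i<n div m. CARD('a) ^ (m * i))"

lemma norm_map_power: "norm_map m n (x :: 'a::finite_field alg_closure) = x ^ norm_exp TYPE('a) m n"
  by (simp add: norm_map_def norm_exp_def power_sum)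

lemma norm_exp_mult:
  assumes "m dvd n"
  shows "norm_exp TYPE('a::finite_field) m n * (CARD('a) ^ m - 1) = CARD('a) ^ n - 1"
proof -
  have geom: "(\<Sum>i<k. Q ^ i) * (Q - 1) = Q ^ k - 1" if "Q \<ge> 1" for k Q :: nat
  proof -
    have "int ((\<Sum>i<k. Q ^ i) * (Q - 1)) = (int Q - 1) * (\<Sum>i<k. int Q ^ i)"
      using that by (simp add: of_nat_diff)
    also have "\<dots> = int Q ^ k - 1" by (rule power_diff_1_eq[symmetric])
    also have "\<dots> = int (Q ^ k - 1)" using that by (simp add: of_nat_diff)
    finally show ?thesis by (simp only: of_nat_eq_iff)
  qed
  have "CARD('a) ^ m \<ge> 1" using card_finite_field_ge_2[where ?'a = 'a] by simp
  from geom[OF this, of "n div m"] show ?thesis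
    using assms by (simp add: norm_exp_def power_mult[symmetric])
qed

lemma norm_exp_self: "m > 0 \<Longrightarrow> norm_exp TYPE('a::finite_field) m m = 1"
  by (simp add: norm_exp_def)

lemma norm_exp_trans:
  assumes "m > 0" "m dvd n" "n dvd k"
  shows "norm_exp TYPE('a::finite_field) m n * norm_exp TYPE('a) n k = norm_exp TYPE('a) m k"
proof -
  have "norm_exp TYPE('a) m n * norm_exp TYPE('a) n k * (CARD('a) ^ m - 1) =
      norm_exp TYPE('a) n k * (norm_exp TYPE('a) m n * (CARD('a) ^ m - 1))" by (simp only: mult_ac)
  also have "\<dots> = CARD('a) ^ k - 1" using assms by (simp only: norm_exp_mult)
  also have "\<dots> = norm_exp TYPE('a) m k * (CARD('a) ^ m - 1)"
    by (rule norm_exp_mult[OF dvd_trans[OF assms(2,3)], symmetric])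
  finally show ?thesis using mcard_pos[OF assms(1), where ?'a = 'a] by simp
qed

lemma norm_in_M_level:
  assumes "m > 0" "m dvd n" "n > 0" "(x :: 'a::finite_field alg_closure) \<in> M_level n"
  shows "x ^ norm_exp TYPE('a) m n \<in> M_level m"
  using assms by (simp only: M_level_iff power_mult[symmetric] norm_exp_mult)

lemma norm_exp_pos:
  assumes "m dvd n" "n > 0" shows "norm_exp TYPE('a::finite_field) m n > 0"
  using norm_exp_mult[OF assms(1), where ?'a = 'a] mcard_pos[OF assms(2), where ?'a = 'a] by (metis mult_is_0 neq0_conv)

text \<open>
  A root \<open>x\<close> of \<open>X\<^sup>E = y\<close> with \<open>E = (q\<^sup>n - 1) / (q\<^sup>m - 1)\<close> exists in the algebraic closure, and
  \<open>y \<in> M\<^sub>m\<close> forces it to lie in \<open>M\<^sub>n\<close>.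
\<close>
lemma norm_surj:
  assumes "m > 0" "m dvd n" "n > 0" "(y :: 'a::finite_field alg_closure) \<in> M_level m"
  obtains x where "x \<in> M_level n" "x ^ norm_exp TYPE('a) m n = y"
proof -
  obtain x where x: "x ^ norm_exp TYPE('a) m n = y"
    using nth_root_exists norm_exp_pos assms by metis
  have "x ^ (CARD('a) ^ n - 1) = y ^ (CARD('a) ^ m - 1)"
    unfolding x[symmetric] power_mult[symmetric] using assms by (simp only: norm_exp_mult)
  then have "x \<in> M_level n" using assms by (simp add: M_level_iff)
  then show ?thesis using x that by blast
qed

section \<open>Characters of \<open>M\<^sub>n\<close>\<close>

lemma M_level_1: "1 \<in> M_level n" by (simp add: M_level_def)

lemma M_level_mult: "x \<in> M_level n \<Longrightarrow> y \<in> M_level n \<Longrightarrow> x * y \<in> M_level n"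
  by (simp add: M_level_def power_mult_distrib)

lemma M_level_power: "x \<in> M_level n \<Longrightarrow> x ^ k \<in> M_level n"
  by (induction k) (simp_all add: M_level_1 M_level_mult)

lemma char_mult: "\<xi> \<in> char_level n \<Longrightarrow> x \<in> M_level n \<Longrightarrow> y \<in> M_level n \<Longrightarrow> \<xi> (x * y) = \<xi> x * \<xi> y"
  by (simp add: char_level_def)

lemma char_nonzero: "\<xi> \<in> char_level n \<Longrightarrow> x \<in> M_level n \<Longrightarrow> \<xi> x \<noteq> 0"
  by (simp add: char_level_def)

lemma char_outside: "\<xi> \<in> char_level n \<Longrightarrow> x \<notin> M_level n \<Longrightarrow> \<xi> x = 0"
  by (simp add: char_level_def)

lemma char_1: "\<xi> \<in> char_level n \<Longrightarrow> \<xi> 1 = 1"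
  using char_mult[of \<xi> n 1 1] char_nonzero[of \<xi> n 1] by (simp add: M_level_1)

lemma char_power: "\<xi> \<in> char_level n \<Longrightarrow> x \<in> M_level n \<Longrightarrow> \<xi> (x ^ k) = \<xi> x ^ k"
  by (induction k) (simp_all add: char_1 char_mult M_level_power)

lemma char_eqI:
  "\<xi> \<in> char_level n \<Longrightarrow> \<eta> \<in> char_level n \<Longrightarrow> (\<And>x. x \<in> M_level n \<Longrightarrow> \<xi> x = \<eta> x) \<Longrightarrow> \<xi> = \<eta>"
  by (rule ext) (metis char_outside)

lemma M_level_generator:
  assumes "n > 0"
  obtains g :: "'a::finite_field alg_closure"
  where "bij_betw (\<lambda>k. g ^ k) {..<CARD('a) ^ n - 1} (M_level n)" "g ^ (CARD('a) ^ n - 1) = 1"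
proof -
  let ?K = "CARD('a) ^ n - 1"
  have M: "M_level n = {x :: 'a alg_closure. x ^ ?K = 1}" using M_level_iff[OF assms] by auto
  obtain g :: "'a alg_closure" where g: "g ^ ?K = 1" "\<And>k. g ^ k = 1 \<Longrightarrow> ?K dvd k"
    using exists_primitive_root[OF card_M_level[OF assms] mcard_pos[OF assms] dvd_refl] by blast
  have g0: "g \<noteq> 0" using g(1) mcard_pos[OF assms, where ?'a = 'a] by (auto simp: power_0_left)
  have inj: "inj_on (\<lambda>k. g ^ k) {..<?K}"
  proof (rule linorder_inj_onI)
    fix i j assume ij: "i < j" "i \<in> {..<?K}" "j \<in> {..<?K}"
    show "g ^ i \<noteq> g ^ j"
    proof
      assume "g ^ i = g ^ j"
      then have "g ^ (j - i) = 1" using g0 ij by (simp add: power_diff)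
      then have "?K dvd j - i" by (rule g(2))
      then show False using ij by (auto dest: dvd_imp_le)
    qed
  qed auto
  have "(\<lambda>k. g ^ k) ` {..<?K} = M_level n"
  proof (rule card_seteq)
    show "finite (M_level n :: 'a alg_closure set)" unfolding M by (rule card_roots_unity_le(1)[OF mcard_pos[OF assms]])
    show "(\<lambda>k. g ^ k) ` {..<?K} \<subseteq> M_level n"
    proof clarify
      fix k
      have "(g ^ k) ^ ?K = (g ^ ?K) ^ k" by (simp only: power_mult[symmetric] mult.commute)
      then show "g ^ k \<in> M_level n" by (simp only: M mem_Collect_eq g(1) power_one)
    qed
    show "card (M_level n :: 'a alg_closure set) \<le> card ((\<lambda>k. g ^ k) ` {..<?K})"
      by (simp only: card_image[OF inj] M card_M_level[OF assms] card_lessThan order_refl)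
  qed
  then show ?thesis using inj g(1) that by (auto simp: bij_betw_def)
qed

text \<open>
  A character of a cyclic group is determined by its value at a generator, which may be any root of
  unity of the right order.
\<close>
lemma char_level_bij:
  fixes g :: "'a::finite_field alg_closure"
  assumes "n > 0" and g: "bij_betw (\<lambda>k. g ^ k) {..<CARD('a) ^ n - 1} (M_level n)" "g ^ (CARD('a) ^ n - 1) = 1"
  shows "bij_betw (\<lambda>\<xi>. \<xi> g) (char_level n) {z. z ^ (CARD('a) ^ n - 1) = 1}"
proof -
  let ?K = "CARD('a) ^ n - 1"
  have K: "?K > 0" by (rule mcard_pos[OF assms(1)])
  have gM: "g \<in> M_level n" using g(2) by (simp add: M_level_iff[OF assms(1)])
  have gen: "\<exists>k<?K. x = g ^ k" if "x \<in> M_level n" for x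
    using g(1) that unfolding bij_betw_def by blast
  show ?thesis
  proof (rule bij_betwI')
    fix \<xi> \<eta> :: "'a alg_closure \<Rightarrow> complex" assume \<xi>: "\<xi> \<in> char_level n" "\<eta> \<in> char_level n"
    show "\<xi> g = \<eta> g \<longleftrightarrow> \<xi> = \<eta>"
    proof
      assume "\<xi> g = \<eta> g"
      show "\<xi> = \<eta>"
      proof (rule char_eqI[OF \<xi>])
        fix x :: "'a alg_closure" assume "x \<in> M_level n"
        then obtain k where "x = g ^ k" using gen by blast
        then show "\<xi> x = \<eta> x" using \<open>\<xi> g = \<eta> g\<close> by (simp add: char_power[OF \<xi>(1) gM] char_power[OF \<xi>(2) gM])
      qed
    qed simp
  next
    fix \<xi> :: "'a alg_closure \<Rightarrow> complex" assume "\<xi> \<in> char_level n"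
    then show "\<xi> g \<in> {z. z ^ ?K = 1}"
      using char_power[of \<xi> n g ?K] gM g(2) by (simp add: char_1)
  next
    fix z :: complex assume "z \<in> {z. z ^ ?K = 1}"
    then have z: "z ^ ?K = 1" by simp
    define dlog where "dlog = inv_into {..<?K} (\<lambda>k. g ^ k)"
    have dlog: "dlog (g ^ k) = k mod ?K" for k
    proof -
      have "g ^ k = g ^ (?K * (k div ?K) + k mod ?K)" by simp
      also have "\<dots> = g ^ (k mod ?K)" by (simp only: power_add power_mult g(2) power_one mult_1)
      finally show ?thesis
        unfolding dlog_def using bij_betw_inv_into_left[OF g(1), of "k mod ?K"] K by simp
    qed
    have zmod: "z ^ (k mod ?K) = z ^ k" for k
    proof -
      have "z ^ k = z ^ (?K * (k div ?K) + k mod ?K)" by simp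
      also have "\<dots> = z ^ (k mod ?K)" by (simp only: power_add power_mult z power_one mult_1)
      finally show ?thesis by simp
    qed
    define \<xi> where "\<xi> = (\<lambda>x. if x \<in> M_level n then z ^ dlog x else 0)"
    have \<xi>g: "\<xi> (g ^ k) = z ^ k" for k
      by (simp only: \<xi>_def M_level_power[OF gM] if_True dlog zmod)
    have "\<xi> (x * y) = \<xi> x * \<xi> y" if "x \<in> M_level n" "y \<in> M_level n" for x y :: "'a alg_closure"
    proof -
      obtain i j where "x = g ^ i" "y = g ^ j" using gen \<open>x \<in> M_level n\<close> \<open>y \<in> M_level n\<close> by blast
      then show ?thesis using \<xi>g[of "i + j"] by (simp add: \<xi>g power_add)
    qed
    moreover have "z \<noteq> 0" using z K by (auto simp: power_0_left)
    ultimately have "\<xi> \<in> char_level n" by (auto simp: char_level_def \<xi>_def)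
    moreover have "z = \<xi> g" using \<xi>g[of 1] by simp
    ultimately show "\<exists>\<xi>\<in>char_level n. z = \<xi> g" by blast
  qed
qed

lemma finite_char_level:
  assumes "n > 0" shows "finite (char_level n :: ('a::finite_field alg_closure \<Rightarrow> complex) set)"
proof -
  obtain g :: "'a alg_closure" where g: "bij_betw (\<lambda>k. g ^ k) {..<CARD('a) ^ n - 1} (M_level n)" "g ^ (CARD('a) ^ n - 1) = 1"
    using M_level_generator[OF assms] .
  show ?thesis
    using char_level_bij[OF assms g] card_roots_unity_le(1)[OF mcard_pos[OF assms]] bij_betw_finite by blast
qed

text \<open>
  Write \<open>x\<close> as a power of a generator of \<open>M\<^sub>n\<close>; the sum becomes a power sum over roots of unity.
\<close>
lemma sum_char_level:
  fixes x :: "'a::finite_field alg_closure"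
  assumes "n > 0"
  shows "(\<Sum>\<xi>\<in>char_level n. \<xi> x) = (if x = 1 then of_nat CARD('a) ^ n - 1 else 0)"
proof (cases "x \<in> M_level n")
  case False
  then show ?thesis using M_level_1 by (auto simp: char_outside)
next
  case True
  let ?K = "CARD('a) ^ n - 1"
  obtain g :: "'a alg_closure" where g: "bij_betw (\<lambda>k. g ^ k) {..<?K} (M_level n)" "g ^ ?K = 1"
    using M_level_generator[OF assms] .
  have gM: "g \<in> M_level n" using g(2) by (simp add: M_level_iff[OF assms])
  obtain k where k: "k < ?K" "x = g ^ k" using g(1) True unfolding bij_betw_def by blast
  have x1: "x = 1 \<longleftrightarrow> k = 0"
    using k inj_onD[OF bij_betw_imp_inj_on[OF g(1)], of k 0] by auto
  have "(\<Sum>\<xi>\<in>char_level n. \<xi> x) = (\<Sum>\<xi>\<in>char_level n. \<xi> g ^ k)"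
    using gM by (simp add: k(2) char_power)
  also have "\<dots> = (\<Sum>z | z ^ ?K = 1. z ^ k)"
    by (rule sum.reindex_bij_betw[OF char_level_bij[OF assms g]])
  also have "\<dots> = (if k = 0 then of_nat ?K else 0)"
    by (rule sum_powers_roots_unity[OF mcard_pos[OF assms] k(1)])
  also have "of_nat ?K = (of_nat CARD('a) ^ n - 1 :: complex)"
    using card_finite_field_ge_2[where ?'a = 'a] by (simp add: of_nat_diff)
  finally show ?thesis by (simp add: x1)
qed

section \<open>Inflation and the Frobenius action on characters\<close>

lemma inflate_power:
  "inflate m n \<xi> = (\<lambda>x :: 'a::finite_field alg_closure. if x \<in> M_level n then \<xi> (x ^ norm_exp TYPE('a) m n) else 0)"
  by (simp add: inflate_def norm_map_power fun_eq_iff)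

lemma inflate_char:
  assumes "m > 0" "m dvd n" "n > 0" "\<xi> \<in> char_level m"
  shows "inflate m n \<xi> \<in> char_level n"
  using norm_in_M_level[OF assms(1-3)] char_mult[OF assms(4)] char_nonzero[OF assms(4)]
  by (auto simp: char_level_def inflate_power M_level_mult power_mult_distrib)

lemma inflate_trans:
  assumes "m > 0" "m dvd n" "n dvd k" "k > 0"
  shows "inflate n k (inflate m n \<xi>) = inflate m k \<xi>"
proof -
  have "n > 0" using assms dvd_pos_nat by blast
  show ?thesis
  proof
    fix x :: "'a alg_closure"
    show "inflate n k (inflate m n \<xi>) x = inflate m k \<xi> x"
      using norm_in_M_level[OF \<open>n > 0\<close> assms(3,4), of x] norm_exp_trans[OF assms(1-3), where ?'a = 'a]
      by (simp add: inflate_power power_mult[symmetric] mult.commute)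
  qed
qed

lemma inflate_self: "m > 0 \<Longrightarrow> \<xi> \<in> char_level m \<Longrightarrow> inflate m m \<xi> = \<xi>"
  by (rule ext) (auto simp: inflate_power norm_exp_self char_outside)

text \<open>
  The norm map is surjective.
\<close>
lemma inflate_inject:
  fixes \<xi> \<eta> :: "'a::finite_field alg_closure \<Rightarrow> complex"
  assumes "m > 0" "m dvd n" "n > 0" "\<xi> \<in> char_level m" "\<eta> \<in> char_level m"
    and eq: "inflate m n \<xi> = inflate m n \<eta>"
  shows "\<xi> = \<eta>"
proof (rule char_eqI[OF assms(4,5)])
  fix y :: "'a alg_closure" assume "y \<in> M_level m"
  then obtain x where "x \<in> M_level n" "x ^ norm_exp TYPE('a) m n = y"
    by (rule norm_surj[OF assms(1-3)])
  then show "\<xi> y = \<eta> y" using fun_cong[OF eq, of x] by (simp add: inflate_power)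
qed

definition frob_char :: "('a::finite_field alg_closure \<Rightarrow> complex) \<Rightarrow> 'a alg_closure \<Rightarrow> complex" where
  "frob_char \<xi> = (\<lambda>x. \<xi> (frob x))"

lemma frob_char_char: "\<xi> \<in> char_level n \<Longrightarrow> frob_char \<xi> \<in> char_level n"
proof -
  have "frob (x * y) = frob x * frob y" for x y :: "'a alg_closure" by (simp add: frob_def power_mult_distrib)
  then show "\<xi> \<in> char_level n \<Longrightarrow> frob_char \<xi> \<in> char_level n"
    by (simp add: char_level_def frob_char_def M_level_frob)
qed

lemma funpow_frob_char: "(frob_char ^^ k) \<xi> = (\<lambda>x. \<xi> ((frob ^^ k) x))"
  by (induction k arbitrary: \<xi>) (simp_all add: frob_char_def funpow_swap1)

lemma funpow_frob_char_char: "\<xi> \<in> char_level n \<Longrightarrow> (frob_char ^^ k) \<xi> \<in> char_level n"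
  by (induction k) (simp_all add: frob_char_char)

lemma frob_char_level: "\<xi> \<in> char_level n \<Longrightarrow> (frob_char ^^ n) \<xi> = \<xi>"
  by (rule char_eqI[of _ n]) (simp_all add: funpow_frob_char_char, simp add: funpow_frob_char funpow_frob M_level_def)

text \<open>
  The Frobenius map is surjective.
\<close>
lemma frob_char_inject:
  fixes \<xi> \<eta> :: "'a::finite_field alg_closure \<Rightarrow> complex"
  shows "frob_char \<xi> = frob_char \<eta> \<longleftrightarrow> \<xi> = \<eta>"
proof
  assume eq: "frob_char \<xi> = frob_char \<eta>"
  show "\<xi> = \<eta>"
  proof
    fix x :: "'a alg_closure"
    obtain y where "x = frob y" using surj_frob by (metis surjD)
    then show "\<xi> x = \<eta> x" using fun_cong[OF eq, of y] by (simp add: frob_char_def)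
  qed
qed simp

lemma inflate_frob_char: "inflate m n (frob_char \<xi>) = frob_char (inflate m n \<xi>)"
proof
  fix x :: "'a alg_closure"
  have "frob x ^ k = frob (x ^ k)" for k by (simp add: frob_def power_mult[symmetric] mult.commute)
  then show "inflate m n (frob_char \<xi>) x = frob_char (inflate m n \<xi>) x"
    by (simp add: inflate_power frob_char_def M_level_frob)
qed

lemma inflate_funpow_frob_char: "inflate m n ((frob_char ^^ k) \<xi>) = (frob_char ^^ k) (inflate m n \<xi>)"
  by (induction k) (simp_all add: inflate_frob_char)

text \<open>
  A character fixed by the \<open>N\<close>-th power of the Frobenius map is trivial on the elements
  \<open>v\<^bsup>q^N - 1\<^esup>\<close>.  By Hilbert 90 these form the kernel of the norm map to level \<open>N\<close>; here this is seen
  by extracting a root \<open>v\<close> in the algebraic closure.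
\<close>
lemma char_descent:
  fixes \<zeta> :: "'a::finite_field alg_closure \<Rightarrow> complex"
  assumes N: "N > 0" "N dvd L" "L > 0" and \<zeta>: "\<zeta> \<in> char_level L" "(frob_char ^^ N) \<zeta> = \<zeta>"
  obtains \<xi> where "\<xi> \<in> char_level N" "inflate N L \<xi> = \<zeta>"
proof -
  let ?E = "norm_exp TYPE('a) N L"
  have wd: "\<zeta> x = \<zeta> y" if xy: "x \<in> M_level L" "y \<in> M_level L" "x ^ ?E = y ^ ?E" for x y
  proof -
    have y0: "y \<noteq> 0" using xy(2) by (simp add: M_level_def)
    define u where "u = x / y"
    have u: "x = u * y" "u ^ ?E = 1" using y0 xy(3) by (simp_all add: u_def power_divide)
    obtain v where v: "v ^ (CARD('a) ^ N - 1) = u"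
      using nth_root_exists[OF mcard_pos[OF N(1)]] by metis
    have "v ^ (CARD('a) ^ L - 1) = 1"
      using norm_exp_mult[OF N(2), where ?'a = 'a] u(2) v by (metis power_mult mult.commute)
    then have vM: "v \<in> M_level L" using N by (simp add: M_level_iff)
    have uM: "u \<in> M_level L" unfolding v[symmetric] by (rule M_level_power[OF vM])
    have "\<zeta> v = \<zeta> ((frob ^^ N) v)" using fun_cong[OF \<zeta>(2), of v] by (simp add: funpow_frob_char)
    also have "(frob ^^ N) v = v * u"
      using card_power_Suc[of N, where ?'a = 'a] v by (metis funpow_frob power_Suc)
    finally have "\<zeta> u = 1" using char_mult[OF \<zeta>(1) vM uM] char_nonzero[OF \<zeta>(1) vM] by simp
    then show ?thesis using char_mult[OF \<zeta>(1) uM xy(2)] u(1) by simp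
  qed
  define lift :: "'a alg_closure \<Rightarrow> 'a alg_closure" where "lift y = (SOME x. x \<in> M_level L \<and> x ^ ?E = y)" for y
  have lift: "lift y \<in> M_level L" "lift y ^ ?E = y" if "y \<in> M_level N" for y
  proof -
    have "\<exists>x. x \<in> M_level L \<and> x ^ ?E = y" by (rule norm_surj[OF N that]) blast
    from someI_ex[OF this] show "lift y \<in> M_level L" "lift y ^ ?E = y" by (simp_all add: lift_def)
  qed
  define \<xi> where "\<xi> = (\<lambda>y. if y \<in> M_level N then \<zeta> (lift y) else 0)"
  have \<xi>: "\<xi> y = \<zeta> x" if "x \<in> M_level L" "y = x ^ ?E" for x y
  proof -
    have "y \<in> M_level N" using that norm_in_M_level[OF N] by simp
    then show ?thesis using wd[OF lift(1) that(1)] lift(2) that(2) by (simp add: \<xi>_def)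
  qed
  have "\<xi> \<in> char_level N"
    unfolding char_level_def
  proof (intro CollectI conjI ballI allI impI)
    fix x y :: "'a alg_closure" assume xy: "x \<in> M_level N" "y \<in> M_level N"
    have "x * y = (lift x * lift y) ^ ?E" using lift(2)[OF xy(1)] lift(2)[OF xy(2)] by (simp add: power_mult_distrib)
    from \<xi>[OF M_level_mult[OF lift(1)[OF xy(1)] lift(1)[OF xy(2)]] this]
    show "\<xi> (x * y) = \<xi> x * \<xi> y"
      using char_mult[OF \<zeta>(1) lift(1)[OF xy(1)] lift(1)[OF xy(2)]] xy by (simp add: \<xi>_def)
  next
    fix x :: "'a alg_closure" assume "x \<in> M_level N"
    then show "\<xi> x \<noteq> 0" using char_nonzero[OF \<zeta>(1) lift(1)] by (simp add: \<xi>_def)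
  qed (simp add: \<xi>_def)
  moreover have "inflate N L \<xi> = \<zeta>"
    by (rule ext) (use \<xi> char_outside[OF \<zeta>(1)] in \<open>auto simp: inflate_power\<close>)
  ultimately show ?thesis using that by blast
qed

section \<open>Classes of characters and their orbits\<close>

abbreviation char_class :: "nat \<Rightarrow> ('a::finite_field alg_closure \<Rightarrow> complex) \<Rightarrow> 'a lchar set" where
  "char_class n \<xi> \<equiv> char_eq `` {(n, \<xi>)}"

lemma char_eq_iff:
  "((m, \<xi>), (n, \<eta>)) \<in> char_eq \<longleftrightarrow> m > 0 \<and> n > 0 \<and> \<xi> \<in> char_level m \<and> \<eta> \<in> char_level n \<and>
     (\<exists>k>0. m dvd k \<and> n dvd k \<and> inflate m k \<xi> = inflate n k \<eta>)"
  by (auto simp: char_eq_def level_chars_def)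

lemma equiv_char_eq: "equiv level_chars char_eq"
proof (rule equivI)
  show "char_eq \<subseteq> level_chars \<times> level_chars" by (auto simp: char_eq_def)
  show "refl_on level_chars char_eq"
    by (auto simp: refl_on_def level_chars_def char_eq_iff intro!: exI)
  show "sym char_eq"
    unfolding sym_def by (auto simp: char_eq_iff)
  show "trans char_eq"
    unfolding trans_def
  proof clarify
    fix m \<xi> n \<eta> p \<theta> assume "((m, \<xi>), (n, \<eta>)) \<in> char_eq" "((n, \<eta>), (p, \<theta>)) \<in> char_eq"
    then obtain k l where a: "m > 0" "n > 0" "p > 0" "\<xi> \<in> char_level m" "\<theta> \<in> char_level p"
      and k: "k > 0" "m dvd k" "n dvd k" "inflate m k \<xi> = inflate n k \<eta>"
      and l: "l > 0" "n dvd l" "p dvd l" "inflate n l \<eta> = inflate p l \<theta>"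
      by (auto simp: char_eq_iff)
    have kl: "k * l > 0" "k dvd k * l" "l dvd k * l" using k l by auto
    have "inflate m (k * l) \<xi> = inflate n (k * l) \<eta>"
      using inflate_trans[OF a(1) k(2) kl(2,1), of \<xi>] inflate_trans[OF a(2) k(3) kl(2,1), of \<eta>] k(4) by simp
    also have "\<dots> = inflate p (k * l) \<theta>"
      using inflate_trans[OF a(2) l(2) kl(3,1), of \<eta>] inflate_trans[OF a(3) l(3) kl(3,1), of \<theta>] l(4) by simp
    finally show "((m, \<xi>), (p, \<theta>)) \<in> char_eq"
      using a kl k l by (auto simp: char_eq_iff intro!: exI[of _ "k * l"])
  qed
qed

lemma char_class_eq_iff:
  assumes "m > 0" "n > 0" "\<xi> \<in> char_level m" "\<eta> \<in> char_level n"
  shows "char_class m \<xi> = char_class n \<eta> \<longleftrightarrow> ((m, \<xi>), (n, \<eta>)) \<in> char_eq"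
  using assms by (intro eq_equiv_class_iff[OF equiv_char_eq]) (auto simp: level_chars_def)

lemma char_class_inject:
  assumes "n > 0" "\<xi> \<in> char_level n" "\<eta> \<in> char_level n"
  shows "char_class n \<xi> = char_class n \<eta> \<longleftrightarrow> \<xi> = \<eta>"
  using assms by (auto simp: char_class_eq_iff char_eq_iff intro: inflate_inject)

lemma char_class_inflate:
  assumes "m > 0" "m dvd n" "n > 0" "\<xi> \<in> char_level m"
  shows "char_class m \<xi> = char_class n (inflate m n \<xi>)"
  using assms inflate_char[OF assms] inflate_self[OF assms(3) inflate_char[OF assms]]
  by (auto simp: char_class_eq_iff char_eq_iff intro!: exI[of _ n])

text \<open>
  For the inclusion from right to left one needs a preimage under the Frobenius action, which is
  obtained from the finite order of this action on characters of a fixed level.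
\<close>
lemma frob_star_class:
  assumes "n > 0" "\<xi> \<in> char_level n"
  shows "frob_star (char_class n \<xi>) = char_class n (frob_char \<xi>)"
proof (intro Set.set_eqI iffI)
  fix x assume "x \<in> frob_star (char_class n \<xi>)"
  then obtain k \<eta> where "x = (k, frob_char \<eta>)" "((n, \<xi>), (k, \<eta>)) \<in> char_eq"
    by (auto simp: frob_star_def frob_char_def)
  then show "x \<in> char_class n (frob_char \<xi>)"
    by (auto simp: char_eq_iff frob_char_char inflate_frob_char)
next
  fix x assume x: "x \<in> char_class n (frob_char \<xi>)"
  obtain k \<theta> where k: "x = (k, \<theta>)" by (cases x)
  with x have \<theta>: "k > 0" "\<theta> \<in> char_level k" and
    ex: "\<exists>l>0. n dvd l \<and> k dvd l \<and> inflate n l (frob_char \<xi>) = inflate k l \<theta>"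
    by (auto simp: char_eq_iff)
  define \<eta> where "\<eta> = (frob_char ^^ (k - 1)) \<theta>"
  have "frob_char \<eta> = (frob_char ^^ Suc (k - 1)) \<theta>" by (simp add: \<eta>_def)
  then have \<eta>: "\<eta> \<in> char_level k" "frob_char \<eta> = \<theta>"
    using \<theta> frob_char_level[OF \<theta>(2)] by (simp_all add: \<eta>_def funpow_frob_char_char)
  have "((n, \<xi>), (k, \<eta>)) \<in> char_eq"
    using ex assms \<theta>(1) \<eta>(1) unfolding \<eta>(2)[symmetric] inflate_frob_char frob_char_inject char_eq_iff by blast
  then have "(k, frob_char \<eta>) \<in> frob_star (char_class n \<xi>)"
    unfolding frob_star_def frob_char_def by (intro image_eqI[of _ _ "(k, \<eta>)"]) auto
  then show "x \<in> frob_star (char_class n \<xi>)" by (simp add: k \<eta>(2))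
qed

lemma funpow_frob_star_class:
  assumes "n > 0" "\<xi> \<in> char_level n"
  shows "(frob_star ^^ k) (char_class n \<xi>) = char_class n ((frob_char ^^ k) \<xi>)"
  by (induction k) (simp_all add: frob_star_class assms funpow_frob_char_char)

text \<open>
  The size of the orbit is the least period of \<open>x\<close>.
\<close>
lemma periodic_orbit:
  assumes "n > 0" "(f ^^ n) x = x"
  shows "card (orbit f x) > 0" "card (orbit f x) dvd n" "(f ^^ card (orbit f x)) x = x"
proof -
  define d where "d = (LEAST d. d > 0 \<and> (f ^^ d) x = x)"
  have d: "d > 0" "(f ^^ d) x = x"
    using LeastI[of "\<lambda>d. d > 0 \<and> (f ^^ d) x = x" n] assms by (auto simp: d_def)
  have least: "\<not> (0 < m \<and> (f ^^ m) x = x)" if "m < d" for m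
    using that unfolding d_def by (rule not_less_Least)
  have orb: "orbit f x = (\<lambda>m. (f ^^ m) x) ` {..<d}"
    using orbit_altdef_bounded[OF d(2,1)] by auto
  have "inj_on (\<lambda>m. (f ^^ m) x) {..<d}"
  proof (rule linorder_inj_onI)
    fix i j assume ij: "i < j" "i \<in> {..<d}" "j \<in> {..<d}"
    show "(f ^^ i) x \<noteq> (f ^^ j) x"
    proof
      assume eq: "(f ^^ i) x = (f ^^ j) x"
      have "(f ^^ (d - j + i)) x = (f ^^ (d - j)) ((f ^^ j) x)"
        unfolding eq[symmetric] by (simp add: funpow_add)
      also have "\<dots> = x" using ij d(2) by (simp add: funpow_add[symmetric] flip: comp_apply[of "f ^^ _"])
      finally show False using least[of "d - j + i"] ij by auto
    qed
  qed auto
  then have card: "card (orbit f x) = d" by (simp add: orb card_image)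
  show "card (orbit f x) > 0" "(f ^^ card (orbit f x)) x = x" using d card by simp_all
  have "(f ^^ (n mod d)) x = x" using funpow_mod_eq[OF d(2), of n] assms(2) by simp
  then have "n mod d = 0" using least[of "n mod d"] d(1) by auto
  then show "card (orbit f x) dvd n" unfolding card by auto
qed

lemma periodic_in_orbit: "n > 0 \<Longrightarrow> (f ^^ n) x = x \<Longrightarrow> x \<in> orbit f x"
proof -
  assume "n > 0" "(f ^^ n) x = x"
  moreover have "(f ^^ n) x \<in> orbit f x" using \<open>n > 0\<close> by (auto simp: orbit_altdef)
  ultimately show ?thesis by simp
qed

lemma orbit_eq_of_mem:
  assumes "n > 0" "(f ^^ n) x = x" "y \<in> orbit f x"
  shows "orbit f y = orbit f x"
proof -
  have "x \<in> orbit f y"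
    by (rule orbit_swap[OF periodic_in_orbit[OF assms(1,2)] assms(3)])
  then show ?thesis
    using orbit_trans[OF _ assms(3)] orbit_trans[of _ f x y] by blast
qed

lemma Phi_star_set_char_orbit:
  assumes "n > 0" "\<xi> \<in> char_level n"
  shows "Phi_star_set (char_orbit n \<xi>) = orbit frob_star (char_class n \<xi>)"
proof -
  have "char_class n \<xi> \<in> M_star"
    unfolding M_star_def by (rule quotientI) (simp add: level_chars_def assms)
  then show ?thesis
    unfolding char_orbit_def by (intro Abs_Phi_star_inverse) blast
qed

lemma frob_star_periodic:
  "n > 0 \<Longrightarrow> \<xi> \<in> char_level n \<Longrightarrow> (frob_star ^^ n) (char_class n \<xi>) = char_class n \<xi>"
  by (simp add: funpow_frob_star_class frob_char_level)

lemma char_orbit_size: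
  assumes "n > 0" "\<xi> \<in> char_level n"
  shows "Phi_star_size (char_orbit n \<xi>) > 0" "Phi_star_size (char_orbit n \<xi>) dvd n"
  using periodic_orbit[OF assms(1) frob_star_periodic[OF assms]]
  by (simp_all add: Phi_star_size_def Phi_star_set_char_orbit assms)

lemma Phi_star_cases:
  obtains n \<xi> where "n > 0" "\<xi> \<in> char_level n" "\<phi> = char_orbit n \<xi>"
proof -
  obtain C where C: "Phi_star_set \<phi> = orbit frob_star C" "C \<in> M_star"
    using Phi_star_set[of \<phi>] by auto
  then obtain n \<xi> where n: "n > 0" "\<xi> \<in> char_level n" "C = char_class n \<xi>"
    unfolding M_star_def by (auto elim!: quotientE simp: level_chars_def)
  then have "Phi_star_set \<phi> = Phi_star_set (char_orbit n \<xi>)"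
    by (simp add: C(1) Phi_star_set_char_orbit)
  then show ?thesis using that n by (simp add: Phi_star_set_inject)
qed

lemma Phi_star_size_pos: "Phi_star_size \<phi> > 0"
  by (metis Phi_star_cases char_orbit_size(1))

text \<open>
  A representative of \<open>\<phi>\<close> at a common multiple of its level and \<open>N\<close> is fixed by the \<open>N\<close>-th power of
  the Frobenius map, so by \<open>char_descent\<close> the orbit has a representative at level \<open>N\<close>.  Then all of its
  elements have one, and exactly one, as different characters of the same level have different classes.
\<close>
lemma card_chars_in_orbit:
  fixes \<phi> :: "'a::finite_field Phi_star"
  assumes N: "N > 0" "Phi_star_size \<phi> dvd N"
  shows "card {\<xi> \<in> char_level N. char_orbit N \<xi> = \<phi>} = Phi_star_size \<phi>"
proof -
  obtain n \<eta> where \<eta>: "n > 0" "\<eta> \<in> char_level n" "\<phi> = char_orbit n \<eta>" by (rule Phi_star_cases)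
  define C where "C = char_class n \<eta>"
  have orb: "Phi_star_set \<phi> = orbit frob_star C"
    by (simp add: \<eta> Phi_star_set_char_orbit C_def)
  define d where "d = Phi_star_size \<phi>"
  have "(frob_star ^^ d) C = C"
    using periodic_orbit(3)[OF \<eta>(1) frob_star_periodic[OF \<eta>(1,2)]]
    by (simp add: d_def Phi_star_size_def orb C_def)
  then have "(frob_char ^^ d) \<eta> = \<eta>"
    using \<eta> by (simp add: C_def funpow_frob_star_class char_class_inject funpow_frob_char_char)
  moreover obtain e where "N = d * e" using N(2) by (auto simp: d_def)
  ultimately have "(frob_char ^^ N) \<eta> = \<eta>"
    by (induction e arbitrary: N) (simp_all add: funpow_add)
  then have fixed: "(frob_char ^^ N) (inflate n (n * N) \<eta>) = inflate n (n * N) \<eta>"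
    by (simp add: inflate_funpow_frob_char[symmetric])
  have L: "N dvd n * N" "n dvd n * N" "n * N > 0" using N \<eta> by auto
  obtain \<xi>0 where \<xi>0: "\<xi>0 \<in> char_level N" "inflate N (n * N) \<xi>0 = inflate n (n * N) \<eta>"
    using char_descent[OF N(1) L(1,3) inflate_char[OF \<eta>(1) L(2,3) \<eta>(2)] fixed] by blast
  have C: "C = char_class N \<xi>0"
    unfolding C_def char_class_inflate[OF \<eta>(1) L(2,3) \<eta>(2)] char_class_inflate[OF N(1) L(1,3) \<xi>0(1)] \<xi>0(2) ..
  have per: "(frob_star ^^ N) C = C" unfolding C by (rule frob_star_periodic[OF N(1) \<xi>0(1)])
  have "bij_betw (char_class N) {\<xi> \<in> char_level N. char_orbit N \<xi> = \<phi>} (orbit frob_star C)"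
  proof (rule bij_betw_imageI)
    show "inj_on (char_class N) {\<xi> \<in> char_level N. char_orbit N \<xi> = \<phi>}"
      using char_class_inject[OF N(1)] by (auto simp: inj_on_def)
    show "char_class N ` {\<xi> \<in> char_level N. char_orbit N \<xi> = \<phi>} = orbit frob_star C"
    proof (intro Set.set_eqI iffI)
      fix y assume "y \<in> char_class N ` {\<xi> \<in> char_level N. char_orbit N \<xi> = \<phi>}"
      then obtain \<xi> where \<xi>: "\<xi> \<in> char_level N" "char_orbit N \<xi> = \<phi>" "y = char_class N \<xi>" by auto
      have "orbit frob_star y = orbit frob_star C"
        using Phi_star_set_char_orbit[OF N(1) \<xi>(1)] \<xi> orb by simp
      moreover have "y \<in> orbit frob_star y"
        unfolding \<xi>(3) by (rule periodic_in_orbit[OF N(1) frob_star_periodic[OF N(1) \<xi>(1)]])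
      ultimately show "y \<in> orbit frob_star C" by simp
    next
      fix y assume y: "y \<in> orbit frob_star C"
      then obtain k where k: "y = (frob_star ^^ k) C" by (auto simp: orbit_altdef)
      define \<xi> where "\<xi> = (frob_char ^^ k) \<xi>0"
      have \<xi>: "\<xi> \<in> char_level N" "y = char_class N \<xi>"
        using \<xi>0(1) N(1) by (simp_all add: \<xi>_def funpow_frob_char_char k C funpow_frob_star_class)
      have "Phi_star_set (char_orbit N \<xi>) = Phi_star_set \<phi>"
        using orbit_eq_of_mem[OF N(1) per y] orb \<xi> by (simp add: Phi_star_set_char_orbit N(1))
      then have "char_orbit N \<xi> = \<phi>" by (simp add: Phi_star_set_inject)
      then show "y \<in> char_class N ` {\<xi> \<in> char_level N. char_orbit N \<xi> = \<phi>}" using \<xi> by auto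
    qed
  qed
  then show ?thesis by (simp add: bij_betw_same_card Phi_star_size_def orb)
qed

section \<open>The orbit of \<open>1\<close>\<close>

lemma orbit_frob_1: "orbit frob 1 = {1}"
  by (simp add: orbit_eq_singleton_iff frob_def)

lemma Phi_set_f1: "Phi_set f1 = {1}"
proof -
  have "{x :: 'a alg_closure. poly (map_poly to_ac [:-1, 1:]) x = 0} = {1}"
    by (auto simp: map_poly_pCons)
  moreover have "Phi_set (Abs_Phi {1 :: 'a alg_closure}) = {1}"
    by (rule Abs_Phi_inverse) (auto intro!: exI[of _ 1] simp: orbit_frob_1)
  ultimately show ?thesis by (simp add: f1_def)
qed

lemma Phi_root_neq_1:
  assumes "f \<noteq> f1" shows "(SOME x. x \<in> Phi_set f) \<noteq> 1"
proof -
  obtain y where y: "Phi_set f = orbit frob y" using Phi_set[of f] by auto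
  have "1 \<notin> Phi_set f"
  proof
    assume "1 \<in> Phi_set f"
    then obtain k where "(frob ^^ k) y = 1" by (auto simp: y orbit_altdef)
    then have "y = 1"
    proof (induction k)
      case (Suc k)
      have "frob (1 :: 'a alg_closure) = 1" by (simp add: frob_def)
      then have "frob ((frob ^^ k) y) = frob 1" using Suc.prems by simp
      then show ?case unfolding frob_eq_iff by (rule Suc.IH)
    qed simp
    then have "Phi_set f = Phi_set f1" by (simp add: y orbit_frob_1 Phi_set_f1)
    then show False using assms by (simp add: Phi_set_inject)
  qed
  moreover have "\<exists>x. x \<in> Phi_set f" using orbit_nonempty[of frob y] y by auto
  ultimately show ?thesis by (metis someI_ex)
qed

section \<open>The contraction coefficients\<close>

text \<open>The coefficients of \<open>(1 - X) / (1 - t X)\<close>.\<close>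
definition ratio_coeff :: "complex \<Rightarrow> nat \<Rightarrow> complex" where
  "ratio_coeff t n = (if n = 0 then 1 else t ^ n - t ^ (n - 1))"

lemma sum_ratio_coeff: "(\<Sum>i\<le>n. ratio_coeff t i) = t ^ n"
  by (induction n) (simp_all add: ratio_coeff_def)

text \<open>
  The differential equation of \<open>(1 - X) / (1 - t X) = exp (\<Sum>\<^sub>n (t\<^sup>n - 1) X\<^sup>n / n)\<close>.
\<close>
lemma ratio_coeff_rec:
  "of_nat n * ratio_coeff t n = (\<Sum>i\<le>n. of_nat i * ((t ^ i - 1) / of_nat i * ratio_coeff t (n - i)))"
proof -
  have 1: "(\<Sum>i\<le>n. t ^ i * ratio_coeff t (n - i)) = t ^ n + of_nat n * ratio_coeff t n"
  proof (cases n)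
    case 0
    then show ?thesis by (simp add: ratio_coeff_def)
  next
    case (Suc m)
    have "t ^ i * ratio_coeff t (Suc m - i) = ratio_coeff t n" if "i \<le> m" for i
      using that by (simp add: ratio_coeff_def Suc Suc_diff_le algebra_simps power_add[symmetric])
    then show ?thesis by (simp add: Suc ratio_coeff_def)
  qed
  have 2: "(\<Sum>i\<le>n. ratio_coeff t (n - i)) = t ^ n"
    using sum.atLeastAtMost_rev[of "ratio_coeff t" 0 n] sum_ratio_coeff[of t n]
    by (simp add: atMost_atLeast0)
  have "(\<Sum>i\<le>n. of_nat i * ((t ^ i - 1) / of_nat i * ratio_coeff t (n - i))) =
      (\<Sum>i\<le>n. t ^ i * ratio_coeff t (n - i) - ratio_coeff t (n - i))"
    by (rule sum.cong) (auto simp: algebra_simps)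
  also have "\<dots> = of_nat n * ratio_coeff t n"
    unfolding sum_subtractf 1 2 by simp
  finally show ?thesis ..
qed

lemma fps_ratio_coeff: "Abs_fps (ratio_coeff t) = (1 - fps_X) / (1 - fps_const t * fps_X)"
proof -
  let ?d = "1 - fps_const t * fps_X :: complex fps"
  have "Abs_fps (ratio_coeff t) * ?d = 1 - fps_X"
  proof (rule fps_ext)
    fix n
    have "fps_nth (Abs_fps (ratio_coeff t) * ?d) n =
        ratio_coeff t n - t * (if n = 0 then 0 else ratio_coeff t (n - 1))"
      by (simp add: right_diff_distrib mult.left_commute[of _ "fps_const t"])
    also have "\<dots> = fps_nth (1 - fps_X) n"
    proof (cases n)
      case (Suc m)
      then show ?thesis by (cases m) (simp_all add: ratio_coeff_def fps_X_def algebra_simps)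
    qed (simp add: ratio_coeff_def)
    finally show "fps_nth (Abs_fps (ratio_coeff t) * ?d) n = fps_nth (1 - fps_X) n" .
  qed
  moreover have "?d \<noteq> 0"
  proof
    assume "?d = 0"
    then have "fps_nth ?d 0 = 0" by simp
    then show False by simp
  qed
  ultimately show ?thesis
    by (metis nonzero_mult_div_cancel_right)
qed

lemma cnj_ratio_coeff: "cnj t = t \<Longrightarrow> cnj (ratio_coeff t n) = ratio_coeff t n"
  by (simp add: ratio_coeff_def)

section \<open>A recursion for the pairings\<close>

text \<open>
  For \<open>F(w) = \<Sum> f\<^sub>k w\<^sup>k\<close>, where \<open>z\<close> acts by shifting the second argument, the recursion says that
  \<open>w F' / F\<close> is \<open>-\<kappa> \<Sum>\<^sub>j u\<^sup>j\<close> with \<open>u = \<sigma> w\<^bsup>\<kappa>\<^esup> z\<^bsup>\<zeta>\<^esup>\<close>.  This is the logarithmic derivative of \<open>1 - u\<close>, and so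
  \<open>F(w) = (1 - u) F(0)\<close>.
\<close>
lemma two_term_recursion:
  fixes f :: "nat \<Rightarrow> int \<Rightarrow> complex"
  assumes "\<kappa> > 0"
    and rec: "\<And>k z. of_nat k * f k z = - of_nat \<kappa> * (\<Sum>i\<le>k. if i > 0 \<and> \<kappa> dvd i
        then \<sigma> ^ (i div \<kappa>) * f (k - i) (z - int (i div \<kappa>) * int \<zeta>) else 0)"
  shows "f k z = (if k = 0 then f 0 z else 0) - (if k = \<kappa> then \<sigma> * f 0 (z - int \<zeta>) else 0)"
proof (induction k arbitrary: z rule: less_induct)
  case (less k)
  define g where "g i = (if i > 0 \<and> \<kappa> dvd i
        then \<sigma> ^ (i div \<kappa>) * f (k - i) (z - int (i div \<kappa>) * int \<zeta>) else 0)" for i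
  have rec': "of_nat k * f k z = - of_nat \<kappa> * (\<Sum>i\<le>k. g i)"
    unfolding g_def by (rule rec)
  have g: "g i = (if i = k \<and> \<kappa> dvd k then \<sigma> ^ (k div \<kappa>) * f 0 (z - int (k div \<kappa>) * int \<zeta>) else 0) -
      (if i + \<kappa> = k \<and> \<kappa> dvd k \<and> k \<noteq> \<kappa> then \<sigma> ^ (k div \<kappa>) * f 0 (z - int (k div \<kappa>) * int \<zeta>) else 0)"
    if "i \<le> k" "k > 0" for i
  proof (cases "i > 0 \<and> \<kappa> dvd i")
    case True
    then have i: "i > 0" "\<kappa> dvd i" by auto
    have IH: "f (k - i) z' = (if k - i = 0 then f 0 z' else 0) -
        (if k - i = \<kappa> then \<sigma> * f 0 (z' - int \<zeta>) else 0)" for z'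
      using less[of "k - i"] i(1) that by simp
    consider "i = k" | "i + \<kappa> = k" | "i \<noteq> k" "i + \<kappa> \<noteq> k" by blast
    then show ?thesis
    proof cases
      case 1
      then show ?thesis using i \<open>\<kappa> > 0\<close> by (simp add: g_def)
    next
      case 2
      then have "k div \<kappa> = Suc (i div \<kappa>)" "\<kappa> dvd k" "k - i = \<kappa>"
        using i \<open>\<kappa> > 0\<close> by auto
      moreover have "f \<kappa> z' = - (\<sigma> * f 0 (z' - int \<zeta>))" for z'
        using IH[of z'] \<open>k - i = \<kappa>\<close> \<open>\<kappa> > 0\<close> by simp
      ultimately show ?thesis using i \<open>\<kappa> > 0\<close> 2 by (simp add: g_def algebra_simps)
    next
      case 3
      then show ?thesis using i that by (auto simp: g_def IH)
    qed
  next
    case False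
    then show ?thesis using that \<open>\<kappa> > 0\<close> by (auto simp: g_def dvd_add_left_iff dest: dvd_imp_le)
  qed
  show ?case
  proof (cases "k = 0")
    case False
    let ?v = "\<sigma> ^ (k div \<kappa>) * f 0 (z - int (k div \<kappa>) * int \<zeta>)"
    have "(\<Sum>i\<le>k. g i) = (\<Sum>i\<le>k. (if i = k then if \<kappa> dvd k then ?v else 0 else 0) -
        (if i = k - \<kappa> then if \<kappa> < k \<and> \<kappa> dvd k then ?v else 0 else 0))"
      by (rule sum.cong) (use False g in \<open>auto dest: dvd_imp_le\<close>)
    also have "\<dots> = (if \<kappa> dvd k then ?v else 0) - (if \<kappa> < k \<and> \<kappa> dvd k then ?v else 0)"
      by (simp add: sum_subtractf)
    also have "\<dots> = (if k = \<kappa> then \<sigma> * f 0 (z - int \<zeta>) else 0)"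
      using False \<open>\<kappa> > 0\<close> by (auto dest: dvd_imp_le)
    finally have "of_nat k * f k z = of_nat k * - (if k = \<kappa> then \<sigma> * f 0 (z - int \<zeta>) else 0)"
      using rec' by auto
    then have "f k z = - (if k = \<kappa> then \<sigma> * f 0 (z - int \<zeta>) else 0)"
      using False by (subst (asm) mult_cancel_left) simp
    then show ?thesis using False by simp
  qed (use \<open>\<kappa> > 0\<close> in simp)
qed

section \<open>The operators \<open>S\<close>\<close>

lemma pdiff_1 [simp]: "pdiff v 1 = 0"
  using pdiff_cst[of v 1] by simp

lemma pdiff_uminus: "pdiff v (- u) = - pdiff v u"
  by (rule poly_mapping_eqI) (simp add: lookup_pdiff)

definition aS :: "'a::finite_field Phi_star \<Rightarrow> nat \<Rightarrow> 'a FG" where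
  "aS \<phi> n = cst (1 / of_nat n) * p_star n \<phi>"

definition DS :: "'a::finite_field Phi_star \<Rightarrow> 'a opseries" where
  "DS \<phi> n u = - d_star n \<phi> u"

interpretation S: vertex_ops "aS \<phi>" "DS \<phi>" "\<lambda>n. (0 ^ n - 1) / of_nat n" "ratio_coeff 0" for \<phi>
proof
  fix n k :: nat and u v :: "'a FG" and x w
  show "DS \<phi> n (u + v) = DS \<phi> n u + DS \<phi> n v"
    by (simp add: DS_def d_star_def pdiff_add)
  show "DS \<phi> n (u * v) = DS \<phi> n u * v + u * DS \<phi> n v"
    by (simp add: DS_def d_star_def pdiff_mult)
  show "DS \<phi> n (cst x) = 0"
    by (simp add: DS_def d_star_def)
  show "DS \<phi> n (DS \<phi> k u) = DS \<phi> k (DS \<phi> n u)"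
    by (simp add: DS_def d_star_def pdiff_uminus pdiff_commute)
  show "\<exists>x. DS \<phi> n (var w) = cst x"
    by (rule exI[of _ "if (\<phi>, n - 1) = w then - 1 else 0"]) (simp add: DS_def d_star_def pdiff_var cst_uminus)
  have "{n. DS \<phi> n (var w) \<noteq> 0} \<subseteq> {0, Suc (snd w)}"
    by (auto simp: DS_def d_star_def pdiff_var split: if_splits)
  then show "finite {n. DS \<phi> n (var w) \<noteq> 0}" by (rule finite_subset) simp
  show "ratio_coeff 0 0 = 1" by (simp add: ratio_coeff_def)
  show "of_nat n * ratio_coeff 0 n =
      (\<Sum>i\<le>n. of_nat i * ((0 ^ i - 1) / of_nat i * ratio_coeff 0 (n - i)))"
    by (rule ratio_coeff_rec)
  assume "n > 0" "k > 0"
  moreover have "(0 ^ n - 1) / of_nat n = - (1 / of_nat n :: complex)"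
    using \<open>n > 0\<close> by (simp add: power_0_left)
  ultimately show "DS \<phi> n (aS \<phi> k) = (if n = k then cst ((0 ^ n - 1) / of_nat n) else 0)"
    by (auto simp: DS_def d_star_def aS_def p_star_def pdiff_cst_mult pdiff_var cst_uminus[symmetric])
qed

lemma S_op_eq: "S_op \<phi> = S.vop \<phi>"
  using S.vertex_op_eq_vop[of \<phi>]
  by (intro ext) (simp add: S_op_def aS_def[abs_def] DS_def[abs_def])

section \<open>The derivation with respect to \<open>p\<^sub>n(f\<^sub>1)\<close>\<close>

text \<open>
  This is \<open>(-1)\<^bsup>n-1\<^esup> \<Sum>\<^sub>\<phi> \<partial>/\<partial>p\<^bsub>n/|\<phi>|\<^esub>(\<phi>)\<close>, summed over the orbits with \<open>|\<phi>|\<close> dividing \<open>n\<close>: each orbit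
  occurs for \<open>|\<phi>|\<close> characters \<open>\<xi>\<close>, which the denominator compensates.  It represents \<open>\<partial>/\<partial>p\<^sub>n(f\<^sub>1)\<close>
  because the coefficient of \<open>p\<^sub>n(f\<^sub>1)\<close> in \<open>p\<^bsub>n/|\<phi>|\<^esub>(\<phi>)\<close> is \<open>(-1)\<^bsup>n-1\<^esup>\<close>.
\<close>
definition unip_deriv :: "nat \<Rightarrow> 'a::finite_field FG \<Rightarrow> 'a FG" where
  "unip_deriv n u = (\<Sum>\<xi>\<in>char_level n. cst ((-1) ^ (n - 1) / of_nat (Phi_star_size (char_orbit n \<xi>))) *
     pdiff (char_orbit n \<xi>, n div Phi_star_size (char_orbit n \<xi>) - 1) u)"

lemma unip_deriv_add: "unip_deriv n (u + v) = unip_deriv n u + unip_deriv n v"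
  by (simp add: unip_deriv_def pdiff_add distrib_left sum.distrib)

lemma unip_deriv_mult: "unip_deriv n (u * v) = unip_deriv n u * v + u * unip_deriv n v"
  by (simp add: unip_deriv_def pdiff_mult distrib_left sum.distrib sum_distrib_left sum_distrib_right mult_ac)

lemma unip_deriv_cst [simp]: "unip_deriv n (cst x) = 0"
  by (simp add: unip_deriv_def)

lemma unip_deriv_1 [simp]: "unip_deriv n 1 = 0"
  using unip_deriv_cst[of n 1] by simp

lemma unip_deriv_scale: "unip_deriv n (cst x * u) = cst x * unip_deriv n u"
  by (simp add: unip_deriv_mult)

lemma unip_deriv_sum: "unip_deriv n (sum f I) = (\<Sum>x\<in>I. unip_deriv n (f x))"
  using unip_deriv_cst[of n 0]
  by (induction I rule: infinite_finite_induct) (simp_all add: unip_deriv_add)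

lemma unip_deriv_commute: "unip_deriv n (unip_deriv m u) = unip_deriv m (unip_deriv n u)"
proof -
  have "unip_deriv n (unip_deriv m u) = (\<Sum>\<xi>\<in>char_level n. \<Sum>\<eta>\<in>char_level m.
      cst ((-1) ^ (n - 1) / of_nat (Phi_star_size (char_orbit n \<xi>))) *
      (cst ((-1) ^ (m - 1) / of_nat (Phi_star_size (char_orbit m \<eta>))) *
       pdiff (char_orbit n \<xi>, n div Phi_star_size (char_orbit n \<xi>) - 1)
         (pdiff (char_orbit m \<eta>, m div Phi_star_size (char_orbit m \<eta>) - 1) u)))" for n m
    by (simp only: unip_deriv_def pdiff_sum pdiff_cst_mult sum_distrib_left)
  note eq = this
  show ?thesis
    unfolding eq[of n m] eq[of m n]
    by (subst sum.swap) (intro sum.cong refl, simp only: mult.left_commute pdiff_commute)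
qed

lemma div_pos_of_dvd: "(n::nat) > 0 \<Longrightarrow> d dvd n \<Longrightarrow> n div d > 0"
  by (auto elim!: dvdE)

text \<open>
  A pair \<open>(\<phi>, k)\<close> arises at level \<open>n\<close> only for \<open>n = (k + 1) |\<phi>|\<close>, and then from \<open>|\<phi>|\<close> characters.
\<close>
lemma sum_chars_of_orbit:
  fixes u :: "'v cpoly" and \<phi> :: "'a::finite_field Phi_star"
  assumes "n > 0"
  shows "(\<Sum>\<xi>\<in>char_level n. if (char_orbit n \<xi>, n div Phi_star_size (char_orbit n \<xi>) - 1) = (\<phi>, k) then u else 0) =
    (if n = (k + 1) * Phi_star_size \<phi> then of_nat (Phi_star_size \<phi>) * u else 0)"
proof -
  let ?d = "Phi_star_size \<phi>"
  have d: "?d > 0" by (rule Phi_star_size_pos)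
  have iff: "(char_orbit n \<xi>, n div Phi_star_size (char_orbit n \<xi>) - 1) = (\<phi>, k) \<longleftrightarrow>
      char_orbit n \<xi> = \<phi> \<and> n = (k + 1) * ?d" if \<xi>: "\<xi> \<in> char_level n" for \<xi> :: "'a alg_closure \<Rightarrow> complex"
  proof (cases "char_orbit n \<xi> = \<phi>")
    case True
    then obtain j where j: "n = ?d * j" using char_orbit_size(2)[OF assms \<xi>] by (auto elim: dvdE)
    then have "j > 0" using assms by (cases j) auto
    then obtain i where "j = Suc i" by (cases j) auto
    then show ?thesis using d by (auto simp: True j)
  qed simp
  have "(\<Sum>\<xi>\<in>char_level n. if (char_orbit n \<xi>, n div Phi_star_size (char_orbit n \<xi>) - 1) = (\<phi>, k) then u else 0) =
      (\<Sum>\<xi>\<in>char_level n. if char_orbit n \<xi> = \<phi> \<and> n = (k + 1) * ?d then u else 0)"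
    by (intro sum.cong refl if_cong iff)
  also have "\<dots> = (if n = (k + 1) * ?d then \<Sum>\<xi> | \<xi> \<in> char_level n \<and> char_orbit n \<xi> = \<phi>. u else 0)"
    unfolding sum.inter_filter[OF finite_char_level[OF assms]]
    by (cases "n = (k + 1) * ?d") (simp_all only: simp_thms if_True if_False sum.neutral_const)
  also have "\<dots> = (if n = (k + 1) * ?d then of_nat ?d * u else 0)"
  proof (rule if_cong[OF refl _ refl])
    assume "n = (k + 1) * ?d"
    then have "?d dvd n" by simp
    then show "(\<Sum>\<xi> | \<xi> \<in> char_level n \<and> char_orbit n \<xi> = \<phi>. u) = of_nat ?d * u"
      by (simp only: sum_constant card_chars_in_orbit[OF assms])
  qed
  finally show ?thesis .
qed

lemma unip_deriv_var:
  assumes "n > 0"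
  shows "unip_deriv n (var (\<phi>, k)) = (if n = (k + 1) * Phi_star_size \<phi> then cst ((-1) ^ (n - 1)) else 0)"
proof -
  let ?d = "Phi_star_size \<phi>"
  have "unip_deriv n (var (\<phi>, k)) = (\<Sum>\<xi>\<in>char_level n.
      if (char_orbit n \<xi>, n div Phi_star_size (char_orbit n \<xi>) - 1) = (\<phi>, k) then cst ((-1) ^ (n - 1) / of_nat ?d) else 0)"
    unfolding unip_deriv_def pdiff_var by (intro sum.cong refl) auto
  also have "\<dots> = (if n = (k + 1) * ?d then cst ((-1) ^ (n - 1)) else 0)"
    unfolding sum_chars_of_orbit[OF assms]
    using Phi_star_size_pos[of \<phi>] by (simp add: cst_of_nat[symmetric] cst_mult[symmetric])
  finally show ?thesis .
qed

lemma p_Phi_f1: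
  assumes "n > 0"
  shows "p_Phi n (f1 :: 'a::finite_field Phi) = cst ((-1) ^ (n - 1) / (of_nat CARD('a) ^ n - 1)) *
     (\<Sum>\<xi>\<in>char_level n. var (char_orbit n \<xi>, n div Phi_star_size (char_orbit n \<xi>) - 1))"
  by (simp add: p_Phi_def Phi_size_def Phi_set_f1 Let_def char_1 p_star_def)

lemma q_power_neq_1: "n > 0 \<Longrightarrow> (of_nat CARD('a::finite_field) ^ n - 1 :: complex) \<noteq> 0"
proof -
  assume "n > 0"
  then have "CARD('a) ^ n \<noteq> 1" using card_finite_field_ge_2[where ?'a = 'a] by simp
  then have "(of_nat (CARD('a) ^ n) :: complex) \<noteq> of_nat 1" unfolding of_nat_eq_iff .
  then show ?thesis by simp
qed

text \<open>
  Each \<open>p\<close> that occurs in \<open>p\<^sub>k(f)\<close> has derivative \<open>(-1)\<^bsup>n-1\<^esup>\<close> if \<open>k |f| = n\<close> and \<open>0\<close> otherwise; what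
  remains is the sum of the conjugates of \<open>\<xi>(x)\<close> over all \<open>\<xi>\<close>, where \<open>x\<close> is a root of \<open>f\<close>.  It vanishes for
  \<open>x \<noteq> 1\<close>, that is, for \<open>f \<noteq> f\<^sub>1\<close>.
\<close>
lemma unip_deriv_p_Phi:
  fixes f :: "'a::finite_field Phi"
  assumes "n > 0" "k > 0"
  shows "unip_deriv n (p_Phi k f) = (if f = f1 \<and> k = n then 1 else 0)"
proof -
  define N where "N = k * Phi_size f"
  define x where "x = (SOME x. x \<in> Phi_set f)"
  define \<alpha> where "\<alpha> = ((-1) ^ (N - 1) / (of_nat CARD('a) ^ N - 1) :: complex)"
  have p: "p_Phi k f = cst \<alpha> * (\<Sum>\<eta>\<in>char_level N. cst (cnj (\<eta> x)) *
      var (char_orbit N \<eta>, N div Phi_star_size (char_orbit N \<eta>) - 1))"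
    by (simp add: p_Phi_def N_def x_def \<alpha>_def Let_def p_star_def)
  have size1: "Phi_size (f1 :: 'a Phi) = 1" by (simp add: Phi_size_def Phi_set_f1)
  have x: "x = 1 \<longleftrightarrow> f = f1"
    using Phi_root_neq_1[of f] by (auto simp: x_def Phi_set_f1)
  show ?thesis
  proof (cases "N = 0")
    case True
    then have "p_Phi k f = cst 0" by (simp add: p \<alpha>_def)
    moreover have "f \<noteq> f1" using True \<open>k > 0\<close> size1 by (auto simp: N_def)
    ultimately show ?thesis using unip_deriv_cst[of n 0] by simp
  next
    case False
    have var: "unip_deriv n (var (char_orbit N \<eta>, N div Phi_star_size (char_orbit N \<eta>) - 1)) =
        (if N = n then cst ((-1) ^ (n - 1)) else 0)" if "\<eta> \<in> char_level N" for \<eta> :: "'a alg_closure \<Rightarrow> complex"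
    proof -
      let ?d = "Phi_star_size (char_orbit N \<eta>)"
      have "?d dvd N" "N div ?d > 0"
        using char_orbit_size[of N \<eta>] div_pos_of_dvd[of N ?d] False that by auto
      then have "(N div ?d - 1 + 1) * ?d = N" by simp
      then show ?thesis using unip_deriv_var[OF assms(1), of "char_orbit N \<eta>" "N div ?d - 1"] by auto
    qed
    have "unip_deriv n (p_Phi k f) = cst \<alpha> * (\<Sum>\<eta>\<in>char_level N. cst (cnj (\<eta> x)) *
        (if N = n then cst ((-1) ^ (n - 1)) else 0))"
      by (simp add: p unip_deriv_scale unip_deriv_sum var del: One_nat_def)
    also have "\<dots> = (if N = n then cst (\<alpha> * (-1) ^ (n - 1) * cnj (\<Sum>\<eta>\<in>char_level N. \<eta> x)) else 0)"
      by (simp add: cst_mult cst_sum[symmetric] sum_distrib_right[symmetric] mult_ac)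
    also have "\<dots> = (if N = n \<and> x = 1 then cst (\<alpha> * (-1) ^ (n - 1) * (of_nat CARD('a) ^ n - 1)) else 0)"
      using False by (subst sum_char_level) auto
    also have "\<dots> = (if N = n \<and> x = 1 then 1 else 0)"
    proof -
      have "\<alpha> * (-1) ^ (n - 1) * (of_nat CARD('a) ^ n - 1) = 1" if "N = n"
        using q_power_neq_1[OF assms(1), where ?'a = 'a] that
        by (simp add: \<alpha>_def power_mult_distrib[symmetric])
      then show ?thesis by simp
    qed
    finally show ?thesis using x size1 by (auto simp: N_def)
  qed
qed

section \<open>The operators \<open>Q\<close>\<close>

abbreviation q_inv :: "'a::finite_field itself \<Rightarrow> complex" where
  "q_inv _ \<equiv> 1 / of_nat CARD('a)"

definition aQ :: "nat \<Rightarrow> 'a::finite_field FG" where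
  "aQ n = cst ((of_nat CARD('a) ^ n - 1) / of_nat n) * p_Phi n f1"

definition DQ :: "'a::finite_field opseries" where
  "DQ n u = cst (- (q_inv TYPE('a) ^ n)) * unip_deriv n u"

lemma unip_deriv_aQ:
  "n > 0 \<Longrightarrow> k > 0 \<Longrightarrow> unip_deriv n (aQ k :: 'a::finite_field FG) =
     (if k = n then cst ((of_nat CARD('a) ^ n - 1) / of_nat n) else 0)"
  by (simp add: aQ_def unip_deriv_scale unip_deriv_p_Phi)

interpretation Q: vertex_ops "aQ :: nat \<Rightarrow> 'a::finite_field FG" DQ
  "\<lambda>n. (q_inv TYPE('a) ^ n - 1) / of_nat n" "ratio_coeff (q_inv TYPE('a))"
proof
  fix n k :: nat and u v :: "'a FG" and x w
  show "DQ n (u + v) = DQ n u + DQ n v"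
    by (simp add: DQ_def unip_deriv_add distrib_left)
  show "DQ n (u * v) = DQ n u * v + u * DQ n v"
    by (simp add: DQ_def unip_deriv_mult algebra_simps)
  show "DQ n (cst x :: 'a FG) = 0"
    by (simp add: DQ_def)
  show "DQ n (DQ k u) = DQ k (DQ n u)"
    by (simp only: DQ_def unip_deriv_scale mult.left_commute unip_deriv_commute[of n k])
  have var: "n > 0 \<Longrightarrow> DQ n (var w :: 'a FG) = (if n = (snd w + 1) * Phi_star_size (fst w)
      then cst (- (q_inv TYPE('a) ^ n) * (-1) ^ (n - 1)) else 0)" for n
    using unip_deriv_var[of n "fst w" "snd w"] by (simp add: DQ_def cst_mult[symmetric])
  have "(if P then 1 else 0 :: 'a FG) = cst (if P then 1 else 0)" for P by simp
  then show "\<exists>x. DQ n (var w :: 'a FG) = cst x"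
    unfolding DQ_def unip_deriv_def pdiff_var by (simp only: cst_mult[symmetric] cst_sum[symmetric]) blast
  have "{n. DQ n (var w :: 'a FG) \<noteq> 0} \<subseteq> {0, (snd w + 1) * Phi_star_size (fst w)}"
    using var by (auto split: if_splits)
  then show "finite {n. DQ n (var w :: 'a FG) \<noteq> 0}" by (rule finite_subset) simp
  show "ratio_coeff (q_inv TYPE('a)) 0 = 1" by (simp add: ratio_coeff_def)
  show "of_nat n * ratio_coeff (q_inv TYPE('a)) n = (\<Sum>i\<le>n. of_nat i *
      ((q_inv TYPE('a) ^ i - 1) / of_nat i * ratio_coeff (q_inv TYPE('a)) (n - i)))"
    by (rule ratio_coeff_rec)
  assume nk: "n > 0" "k > 0"
  have "- (q_inv TYPE('a) ^ n) * ((of_nat CARD('a) ^ n - 1) / of_nat n) = (q_inv TYPE('a) ^ n - 1) / of_nat n"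
    using nk by (simp add: field_simps)
  then show "DQ n (aQ k :: 'a FG) = (if n = k then cst ((q_inv TYPE('a) ^ n - 1) / of_nat n) else 0)"
    using nk by (auto simp: DQ_def unip_deriv_aQ cst_mult[symmetric])
qed

text \<open>
  The operators \<open>\<partial>/\<partial>p\<^sub>n(f\<^sub>1)\<close> of the definition are identified with derivations of \<open>\<F>\<^sub>G\<close> on a
  subalgebra only; this lemma carries the identification over to their exponentials.
\<close>
lemma op_exp_cong_on:
  assumes zero: "0 \<in> R" and add: "\<And>u v. u \<in> R \<Longrightarrow> v \<in> R \<Longrightarrow> u + v \<in> R"
    and scale: "\<And>x u. u \<in> R \<Longrightarrow> cst x * u \<in> R"
    and AB: "\<And>n u. n > 0 \<Longrightarrow> u \<in> R \<Longrightarrow> A n u = B n u" "\<And>n u. n > 0 \<Longrightarrow> u \<in> R \<Longrightarrow> B n u \<in> R"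
    and u: "u \<in> R"
  shows "op_exp A k u = op_exp B k u" "op_exp B k u \<in> R"
proof -
  have closed: "sum f I \<in> R" if "\<And>i. i \<in> I \<Longrightarrow> f i \<in> R" for f :: "nat \<Rightarrow> 'a FG" and I
    using that by (induction I rule: infinite_finite_induct) (auto intro: zero add)
  let ?A = "\<lambda>n v. if n = 0 then 0 else A n v" and ?B = "\<lambda>n v. if n = 0 then 0 else B n v"
  have pow: "(op_mult ?A ^^ j) op_one k u = (op_mult ?B ^^ j) op_one k u \<and> (op_mult ?B ^^ j) op_one k u \<in> R" for j k
  proof (induction j arbitrary: k)
    case 0
    then show ?case by (simp add: op_one_def u zero)
  next
    case (Suc j)
    have step: "(op_mult C ^^ Suc j) op_one k u = (\<Sum>i\<le>k. C i ((op_mult C ^^ j) op_one (k - i) u))"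
      for C :: "'a opseries"
      by (simp add: op_mult_def[of C "(op_mult C ^^ j) op_one"])
    have *: "?A i ((op_mult ?A ^^ j) op_one (k - i) u) = ?B i ((op_mult ?B ^^ j) op_one (k - i) u)"
      "?B i ((op_mult ?B ^^ j) op_one (k - i) u) \<in> R" for i
      using Suc[of "k - i"] AB zero by auto
    show ?case
      unfolding step by (intro conjI closed) (simp_all only: *)
  qed
  show "op_exp A k u = op_exp B k u" unfolding op_exp_def using pow by simp
  show "op_exp B k u \<in> R" unfolding op_exp_def using pow by (auto intro!: closed scale)
qed

definition Phi_gens :: "'a::finite_field Phi \<times> nat \<Rightarrow> 'a FG" where
  "Phi_gens = (\<lambda>(g, k). p_Phi (k + 1) g)"

text \<open>
  All \<open>Q\<^bsub>\<mu>\<^esub>.1\<close> lie in this subalgebra, and on it \<open>\<partial>/\<partial>p\<^sub>n(f\<^sub>1)\<close> acts as \<open>unip_deriv n\<close>.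
\<close>
definition Phi_algebra :: "'a::finite_field FG set" where
  "Phi_algebra = range (peval Phi_gens)"

lemma Phi_algebra_add: "u \<in> Phi_algebra \<Longrightarrow> v \<in> Phi_algebra \<Longrightarrow> u + v \<in> Phi_algebra"
  by (auto simp: Phi_algebra_def peval_add[symmetric])

lemma Phi_algebra_mult: "u \<in> Phi_algebra \<Longrightarrow> v \<in> Phi_algebra \<Longrightarrow> u * v \<in> Phi_algebra"
  by (auto simp: Phi_algebra_def peval_mult[symmetric])

lemma Phi_algebra_cst: "cst x \<in> Phi_algebra"
proof -
  have "cst x = peval Phi_gens (cst x)" by simp
  then show ?thesis unfolding Phi_algebra_def by (rule range_eqI)
qed

lemma Phi_algebra_0 [simp]: "0 \<in> Phi_algebra"
  using Phi_algebra_cst[of 0] by simp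

lemma Phi_algebra_1 [simp]: "1 \<in> Phi_algebra"
  using Phi_algebra_cst[of 1] by simp

lemma Phi_algebra_gen: "n > 0 \<Longrightarrow> p_Phi n f \<in> Phi_algebra"
proof -
  assume "n > 0"
  then have "p_Phi n f = peval Phi_gens (var (f, n - 1))" by (simp add: Phi_gens_def)
  then show ?thesis by (simp only: Phi_algebra_def rangeI)
qed

lemma Phi_algebra_sum: "(\<And>i. i \<in> I \<Longrightarrow> f i \<in> Phi_algebra) \<Longrightarrow> sum f I \<in> Phi_algebra"
  by (induction I rule: infinite_finite_induct) (auto intro!: Phi_algebra_add)

lemma unip_deriv_gens: "n > 0 \<Longrightarrow> unip_deriv n (Phi_gens v) = (if v = (f1, n - 1) then 1 else 0)"
  by (cases v) (auto simp: Phi_gens_def unip_deriv_p_Phi)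

lemma d_Phi_eq:
  assumes "n > 0" "u \<in> Phi_algebra"
  shows "d_Phi n f1 u = unip_deriv n u"
  unfolding d_Phi_def Phi_gens_def[symmetric]
  by (rule pdiff_wrt_eq_derivation[OF unip_deriv_add unip_deriv_mult unip_deriv_cst
        unip_deriv_gens[OF assms(1)] assms(2)[unfolded Phi_algebra_def]])

lemma unip_deriv_Phi_algebra:
  assumes "n > 0" "u \<in> Phi_algebra"
  shows "unip_deriv n u \<in> Phi_algebra"
proof -
  obtain P where "u = peval Phi_gens P" using assms(2) by (auto simp: Phi_algebra_def)
  then have "unip_deriv n u = peval Phi_gens (pdiff (f1, n - 1) P)"
    using derivation_peval[OF unip_deriv_add unip_deriv_mult unip_deriv_cst unip_deriv_gens[OF assms(1)]]
    by simp
  then show ?thesis by (simp add: Phi_algebra_def)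
qed

lemma Q_op_eq:
  assumes "u \<in> Phi_algebra"
  shows "Q_op m u = Q.vop m u" "Q.vop m u \<in> Phi_algebra"
proof -
  let ?B = "\<lambda>n u. - (cst (1 / of_nat CARD('a) ^ n) * d_Phi n f1 u) :: 'a FG"
  have B: "?B n u = DQ n u" if "n > 0" "u \<in> Phi_algebra" for n u
    using that by (simp add: d_Phi_eq DQ_def cst_uminus power_one_over)
  have D: "DQ n u \<in> Phi_algebra" if "n > 0" "u \<in> Phi_algebra" for n and u :: "'a FG"
    unfolding DQ_def using that by (intro Phi_algebra_mult Phi_algebra_cst unip_deriv_Phi_algebra)
  have M: "aQ n * u \<in> Phi_algebra" if "n > 0" "u \<in> Phi_algebra" for n and u :: "'a FG"
    unfolding aQ_def using that by (intro Phi_algebra_mult Phi_algebra_cst Phi_algebra_gen)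
  have zero: "(0 :: 'a FG) \<in> Phi_algebra" by simp
  have T: "op_exp ?B j u = op_exp DQ j u" "op_exp DQ j u \<in> Phi_algebra" for j
    using op_exp_cong_on[of Phi_algebra ?B DQ u j, OF zero Phi_algebra_add
        Phi_algebra_mult[OF Phi_algebra_cst] B D assms] by auto
  have E: "(Q.E k :: 'a FG) \<in> Phi_algebra" for k
    using op_exp_cong_on(2)[of Phi_algebra "\<lambda>n u. aQ n * u" "\<lambda>n u. aQ n * u" 1 "nat k", OF zero Phi_algebra_add
        Phi_algebra_mult[OF Phi_algebra_cst] refl M] by (simp add: Q.E_def)
  show "Q_op m u = Q.vop m u"
    unfolding Q.vertex_op_eq_vop[symmetric] Q_op_def vertex_op_def
    by (simp add: T aQ_def[abs_def])
  show "Q.vop m u \<in> Phi_algebra"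
    unfolding Q.vop_def by (intro Phi_algebra_sum Phi_algebra_mult E T)
qed

lemma Q_seq_eq:
  fixes u :: "'a::finite_field FG"
  assumes "u \<in> Phi_algebra"
  shows "Q_seq \<mu> u = foldr (\<lambda>k. Q.vop (int k)) \<mu> u \<and> Q_seq \<mu> u \<in> Phi_algebra"
proof (induction \<mu>)
  case Nil
  then show ?case using assms by (simp add: Q_seq_def)
next
  case (Cons k \<mu>)
  have "Q_seq (k # \<mu>) u = Q_op (int k) (Q_seq \<mu> u)" by (simp add: Q_seq_def)
  also have "\<dots> = Q.vop (int k) (Q_seq \<mu> u)" using Cons Q_op_eq(1) by blast
  finally show ?case using Cons Q_op_eq(2)[of "Q_seq \<mu> u" "int k"] by auto
qed

section \<open>The two pairings\<close>

lemma aQ_eq: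
  assumes "n > 0"
  shows "(aQ n :: 'a::finite_field FG) = cst ((-1) ^ (n - 1) / of_nat n) *
      (\<Sum>\<xi>\<in>char_level n. var (char_orbit n \<xi>, n div Phi_star_size (char_orbit n \<xi>) - 1))"
proof -
  have "(of_nat CARD('a) ^ n - 1) / of_nat n * ((-1) ^ (n - 1) / (of_nat CARD('a) ^ n - 1)) =
      ((-1) ^ (n - 1) / of_nat n :: complex)"
    using q_power_neq_1[OF assms, where ?'a = 'a] by simp
  then show ?thesis
    unfolding aQ_def p_Phi_f1[OF assms] mult.assoc[symmetric] cst_mult[symmetric] by simp
qed

text \<open>
  Multiplication by \<open>p\<^sub>k(\<phi>)\<close> is adjoint to \<open>k \<partial>/\<partial>p\<^sub>k(\<phi>)\<close>; with \<open>k = n / |\<phi>|\<close> the sums on both sides agree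
  term by term.
\<close>
lemma inner_aQ:
  fixes u v :: "'a::finite_field FG"
  assumes "n > 0"
  shows "inner_FG v (aQ n * u) = inner_FG (unip_deriv n v) u"
proof -
  have "aQ n * u = cst ((-1) ^ (n - 1) / of_nat n) *
      (\<Sum>\<xi>\<in>char_level n. var (char_orbit n \<xi>, n div Phi_star_size (char_orbit n \<xi>) - 1) * u)"
    by (simp add: aQ_eq[OF assms] mult.assoc sum_distrib_right)
  then have "inner_FG v (aQ n * u) = (\<Sum>\<xi>\<in>char_level n. (-1) ^ (n - 1) / of_nat n *
      inner_FG v (var (char_orbit n \<xi>, n div Phi_star_size (char_orbit n \<xi>) - 1) * u))"
    by (simp add: inner_cst_right inner_sum_right sum_distrib_left)
  also have "\<dots> = (\<Sum>\<xi>\<in>char_level n. (-1) ^ (n - 1) / of_nat (Phi_star_size (char_orbit n \<xi>)) *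
      inner_FG (pdiff (char_orbit n \<xi>, n div Phi_star_size (char_orbit n \<xi>) - 1) v) u)"
  proof (rule sum.cong)
    fix \<xi> :: "'a alg_closure \<Rightarrow> complex" assume \<xi>: "\<xi> \<in> char_level n"
    let ?d = "Phi_star_size (char_orbit n \<xi>)"
    have d: "?d dvd n" "n div ?d > 0" "?d > 0"
      using char_orbit_size[OF assms \<xi>] div_pos_of_dvd[OF assms, of ?d] by auto
    then have "of_nat (n div ?d - 1 + 1) / of_nat n = (1 / of_nat ?d :: complex)"
      using assms of_nat_mult[of ?d "n div ?d", where ?'a = complex] by (simp add: field_simps)
    then have "(-1) ^ (n - 1) / of_nat n * (of_nat (n div ?d - 1 + 1) * w) = (-1) ^ (n - 1) / of_nat ?d * w"
      for w :: complex
      by (metis (no_types, lifting) mult.assoc mult_1 times_divide_eq_left times_divide_eq_right)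
    then show "(-1) ^ (n - 1) / of_nat n * inner_FG v (var (char_orbit n \<xi>, n div ?d - 1) * u) =
      (-1) ^ (n - 1) / of_nat ?d * inner_FG (pdiff (char_orbit n \<xi>, n div ?d - 1) v) u"
      unfolding inner_var_right .
  qed simp
  also have "\<dots> = inner_FG (unip_deriv n v) u"
    by (simp add: unip_deriv_def inner_sum_left inner_cst_left)
  finally show ?thesis .
qed

lemma inner_aS:
  assumes "n > 0"
  shows "inner_FG (aS \<phi> n * u) v = inner_FG u (pdiff (\<phi>, n - 1) v)"
  using assms by (simp add: aS_def p_star_def mult.assoc inner_cst_left inner_var_left del: of_nat_add)

lemma unip_deriv_aS:
  assumes "n > 0" "k > 0"
  shows "unip_deriv n (aS \<phi> k) = (if n = k * Phi_star_size \<phi> then cst ((-1) ^ (n - 1) / of_nat k) else 0)"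
  using assms by (simp add: aS_def p_star_def unip_deriv_scale unip_deriv_var cst_mult[symmetric])

lemma unip_deriv_S_E:
  assumes "n > 0"
  shows "unip_deriv n (S.E \<phi> z) = (if Phi_star_size \<phi> dvd n
     then cst ((-1) ^ (n - 1) * of_nat (Phi_star_size \<phi>) / of_nat n) * S.E \<phi> (z - int (n div Phi_star_size \<phi>)) else 0)"
proof -
  let ?d = "Phi_star_size \<phi>"
  have d: "?d > 0" by (rule Phi_star_size_pos)
  show ?thesis
  proof (cases "?d dvd n")
    case True
    then obtain j where j: "n = ?d * j" by (auto elim: dvdE)
    have "j > 0" using j assms by (cases j) auto
    have "unip_deriv n (S.E \<phi> z) = cst ((-1) ^ (n - 1) / of_nat j) * S.E \<phi> (z - int j)"
      by (rule S.derivation_E)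
        (use d j \<open>j > 0\<close> assms in \<open>auto simp: unip_deriv_add unip_deriv_mult unip_deriv_aS\<close>)
    then show ?thesis using d j by simp
  next
    case False
    have "unip_deriv n (S.E \<phi> z) = cst 0 * S.E \<phi> (z - int 1)"
      by (rule S.derivation_E)
        (use False assms in \<open>auto simp: unip_deriv_add unip_deriv_mult unip_deriv_aS\<close>)
    then show ?thesis using False by simp
  qed
qed

lemma pdiff_aQ:
  assumes "n > 0" "k > 0"
  shows "pdiff (\<phi>, n - 1) (aQ k) = (if k = n * Phi_star_size \<phi> then cst ((-1) ^ (k - 1) / of_nat n) else 0)"
proof -
  let ?d = "Phi_star_size \<phi>"
  have "pdiff (\<phi>, n - 1) (aQ k) = cst ((-1) ^ (k - 1) / of_nat k) * (\<Sum>\<xi>\<in>char_level k.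
      if (char_orbit k \<xi>, k div Phi_star_size (char_orbit k \<xi>) - 1) = (\<phi>, n - 1) then 1 else 0)"
    unfolding aQ_eq[OF assms(2)] pdiff_cst_mult pdiff_sum pdiff_var
    by (intro arg_cong[of _ _ "\<lambda>u. _ * u"] sum.cong refl) auto
  also have "\<dots> = (if k = n * ?d then cst ((-1) ^ (k - 1) / of_nat n) else 0)"
    unfolding sum_chars_of_orbit[OF assms(2)]
    using Phi_star_size_pos[of \<phi>] assms by (auto simp: cst_of_nat[symmetric] cst_mult[symmetric])
  finally show ?thesis .
qed

lemma pdiff_Q_E:
  assumes "n > 0"
  shows "pdiff (\<phi>, n - 1) (Q.E z) =
    cst ((-1) ^ (n * Phi_star_size \<phi> - 1) / of_nat n) * Q.E (z - int (n * Phi_star_size \<phi>))"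
  by (rule Q.derivation_E)
    (use assms Phi_star_size_pos[of \<phi>] in \<open>auto simp: pdiff_add pdiff_mult pdiff_aQ simp del: One_nat_def\<close>)

lemma inner_of_nat_right: "inner_FG u (of_nat k * v) = of_nat k * inner_FG u v"
  using inner_cst_right[of u "of_nat k" v] by (simp add: cst_of_nat)

lemma inner_of_nat_left: "inner_FG (of_nat k * u) v = of_nat k * inner_FG u v"
  using inner_cst_left[of "of_nat k" u v] by (simp add: cst_of_nat)

lemma minus_one_power_pred: "n > 0 \<Longrightarrow> (-1) ^ (n - Suc 0) = (- ((-1) ^ n) :: complex)"
  by (cases n) simp_all

text \<open>
  Take the recursion of \<open>Q.E\<close>, pass to adjoints, and use that \<open>S.E\<close> is an eigenvector of \<open>unip_deriv n\<close>:
  the result is a two-term recursion with \<open>\<kappa> = |\<phi>|\<close> and \<open>\<zeta> = 1\<close>.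
\<close>
lemma inner_S_E_Q_E:
  "inner_FG (S.E \<phi> z) (Q.E k * u) = (if k = 0 then inner_FG (S.E \<phi> z) u else 0) -
     (if k = int (Phi_star_size \<phi>) then (-1) ^ Phi_star_size \<phi> * inner_FG (S.E \<phi> (z - int 1)) u else 0)"
proof (cases "k < 0")
  case False
  define k' where "k' = nat k"
  have k: "k = int k'" using False by (simp add: k'_def)
  let ?d = "Phi_star_size \<phi>"
  define f where "f k z = inner_FG (S.E \<phi> z) (Q.E (int k) * u)" for k z
  have "f k' z = (if k' = 0 then f 0 z else 0) - (if k' = ?d then (-1) ^ ?d * f 0 (z - int 1) else 0)"
  proof (rule two_term_recursion)
    fix k :: nat and z
    have "of_nat k * f k z = inner_FG (S.E \<phi> z) ((of_nat k * Q.E (int k)) * u)"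
      by (simp add: f_def inner_of_nat_right mult.assoc)
    also have "\<dots> = (\<Sum>i\<le>k. of_nat i * inner_FG (S.E \<phi> z) (aQ i * (Q.E (int k - int i) * u)))"
      by (simp add: Q.E_rec sum_distrib_right inner_sum_right inner_of_nat_right mult.assoc)
    also have "\<dots> = (\<Sum>i\<le>k. - of_nat ?d * (if i > 0 \<and> ?d dvd i
        then ((-1) ^ ?d) ^ (i div ?d) * f (k - i) (z - int (i div ?d) * int 1) else 0))"
    proof (rule sum.cong)
      fix i assume i: "i \<in> {..k}"
      show "of_nat i * inner_FG (S.E \<phi> z) (aQ i * (Q.E (int k - int i) * u)) =
        - of_nat ?d * (if i > 0 \<and> ?d dvd i
          then ((-1) ^ ?d) ^ (i div ?d) * f (k - i) (z - int (i div ?d) * int 1) else 0)"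
      proof (cases "i = 0")
        case False
        have "((-1) ^ ?d) ^ (i div ?d) = ((-1) ^ i :: complex)" if "?d dvd i"
          using that by (simp add: power_mult[symmetric])
        then show ?thesis
          using False i unfolding inner_aQ[OF False[unfolded neq0_conv]] unip_deriv_S_E[OF False[unfolded neq0_conv]]
          by (auto simp: inner_cst_left minus_one_power_pred f_def of_nat_diff)
      qed simp
    qed simp
    also have "\<dots> = - of_nat ?d * (\<Sum>i\<le>k. if i > 0 \<and> ?d dvd i
        then ((-1) ^ ?d) ^ (i div ?d) * f (k - i) (z - int (i div ?d) * int 1) else 0)"
      by (rule sum_distrib_left[symmetric])
    finally show "of_nat k * f k z = \<dots>" .
  qed (rule Phi_star_size_pos)
  then show ?thesis by (simp add: k f_def)
qed simp

text \<open>
  The same argument with the roles of \<open>S.E\<close> and \<open>Q.E\<close> interchanged; now \<open>\<kappa> = 1\<close> and \<open>\<zeta> = |\<phi>|\<close>.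
\<close>
lemma inner_S_E_mult_Q_E:
  "inner_FG (S.E \<phi> k * u) (Q.E z) = (if k = 0 then inner_FG u (Q.E z) else 0) -
     (if k = int 1 then (-1) ^ Phi_star_size \<phi> * inner_FG u (Q.E (z - int (Phi_star_size \<phi>))) else 0)"
proof (cases "k < 0")
  case False
  define k' where "k' = nat k"
  have k: "k = int k'" using False by (simp add: k'_def)
  let ?d = "Phi_star_size \<phi>"
  define f where "f k z = inner_FG (S.E \<phi> (int k) * u) (Q.E z)" for k z
  have "f k' z = (if k' = 0 then f 0 z else 0) - (if k' = 1 then (-1) ^ ?d * f 0 (z - int ?d) else 0)"
  proof (rule two_term_recursion)
    fix k :: nat and z
    have "of_nat k * f k z = inner_FG ((of_nat k * S.E \<phi> (int k)) * u) (Q.E z)"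
      by (simp add: f_def inner_of_nat_left mult.assoc)
    also have "\<dots> = (\<Sum>i\<le>k. of_nat i * inner_FG (aS \<phi> i * (S.E \<phi> (int k - int i) * u)) (Q.E z))"
      by (simp add: S.E_rec sum_distrib_right inner_sum_left inner_of_nat_left mult.assoc)
    also have "\<dots> = (\<Sum>i\<le>k. - of_nat 1 * (if i > 0 \<and> 1 dvd i
        then ((-1) ^ ?d) ^ (i div 1) * f (k - i) (z - int (i div 1) * int ?d) else 0))"
    proof (rule sum.cong)
      fix i assume i: "i \<in> {..k}"
      show "of_nat i * inner_FG (aS \<phi> i * (S.E \<phi> (int k - int i) * u)) (Q.E z) =
        - of_nat 1 * (if i > 0 \<and> 1 dvd i
          then ((-1) ^ ?d) ^ (i div 1) * f (k - i) (z - int (i div 1) * int ?d) else 0)"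
      proof (cases "i = 0")
        case False
        have "((-1) ^ ?d) ^ i = ((-1) ^ (i * ?d) :: complex)"
          by (simp add: power_mult[symmetric] mult.commute)
        moreover have "i * ?d > 0" using False Phi_star_size_pos[of \<phi>] by simp
        ultimately show ?thesis
          using False i unfolding inner_aS[OF False[unfolded neq0_conv]] pdiff_Q_E[OF False[unfolded neq0_conv]]
          by (simp add: inner_cst_right minus_one_power_pred f_def of_nat_diff)
      qed simp
    qed simp
    also have "\<dots> = - of_nat 1 * (\<Sum>i\<le>k. if i > 0 \<and> 1 dvd i
        then ((-1) ^ ?d) ^ (i div 1) * f (k - i) (z - int (i div 1) * int ?d) else 0)"
      by (rule sum_distrib_left[symmetric])
    finally show "of_nat k * f k z = \<dots>" .
  qed simp
  then show ?thesis by (simp add: k f_def)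
qed simp

lemma inner_S_E_1: "inner_FG (S.E \<phi> z) 1 = (if z = 0 then 1 else 0)"
proof (cases "z \<le> 0")
  case True
  then show ?thesis by (cases "z = 0") (simp_all add: inner_1_1)
next
  case False
  then obtain k where k: "z = int k" "k > 0" by (metis nonneg_int_cases not_le zero_less_imp_eq_int)
  have "of_nat i * inner_FG (aS \<phi> i * S.E \<phi> (int k - int i)) 1 = 0" for i
    by (cases "i = 0") (simp_all add: inner_aS)
  then have "of_nat k * inner_FG (S.E \<phi> z) 1 = 0"
    by (simp add: k(1) inner_of_nat_left[symmetric] S.E_rec inner_sum_left)
  then show ?thesis using k by simp
qed

lemma inner_1_Q_E: "inner_FG 1 (Q.E z :: 'a::finite_field FG) = (if z = 0 then 1 else 0)"
proof (cases "z \<le> 0")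
  case True
  then show ?thesis by (cases "z = 0") (simp_all add: inner_1_1)
next
  case False
  then obtain k where k: "z = int k" "k > 0" by (metis nonneg_int_cases not_le zero_less_imp_eq_int)
  have "of_nat i * inner_FG 1 (aQ i * Q.E (int k - int i) :: 'a FG) = 0" for i
    by (cases "i = 0") (simp_all add: inner_aQ)
  then have "of_nat k * inner_FG 1 (Q.E z :: 'a FG) = 0"
    by (simp add: k(1) inner_of_nat_right[symmetric] Q.E_rec inner_sum_right)
  then show ?thesis using k by simp
qed

interpretation SQ: vertex_pairing "aQ :: nat \<Rightarrow> 'a::finite_field FG" DQ
  "\<lambda>n. (q_inv TYPE('a) ^ n - 1) / of_nat n" "ratio_coeff (q_inv TYPE('a))"
  "\<lambda>z. inner_FG (S.E \<phi> z)" "Phi_star_size \<phi>" 1 "(-1) ^ Phi_star_size \<phi>" for \<phi> :: "'a::finite_field Phi_star"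
  by unfold_locales
    (simp_all add: Phi_star_size_pos inner_add_right inner_cst_right cnj_ratio_coeff inner_S_E_1 inner_S_E_Q_E)

interpretation QS: vertex_pairing "aS \<phi>" "DS \<phi>" "\<lambda>n. (0 ^ n - 1) / of_nat n" "ratio_coeff 0"
  "\<lambda>z u. inner_FG u (Q.E z)" 1 "Phi_star_size \<phi>" "(-1) ^ Phi_star_size \<phi>" for \<phi> :: "'a::finite_field Phi_star"
  by unfold_locales
    (simp_all add: inner_add_left inner_cst_left inner_1_Q_E inner_S_E_mult_Q_E)

section \<open>Character values\<close>

lemma char_value_single_color:
  fixes \<phi> :: "'a::finite_field Phi_star"
  shows "char_value (single_color \<nu> \<phi>) \<mu> = of_nat CARD('a) ^ n_part \<mu> *
    inner_FG (foldr (\<lambda>k. S.vop \<phi> (int k)) \<nu> 1) (foldr (\<lambda>k. Q.vop (int k)) \<mu> 1)"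
proof -
  have "(\<Prod>\<psi> | single_color \<nu> \<phi> \<psi> \<noteq> []. S_seq \<psi> (single_color \<nu> \<phi> \<psi>) 1) = S_seq \<phi> \<nu> 1"
  proof (cases "\<nu> = []")
    case False
    then have "{\<psi>. single_color \<nu> \<phi> \<psi> \<noteq> []} = {\<phi>}" by (auto simp: single_color_def)
    then show ?thesis by (simp add: single_color_def)
  qed (simp add: single_color_def S_seq_def)
  then show ?thesis
    using Q_seq_eq[OF Phi_algebra_cst[of 1], of \<mu>, where ?'a = 'a]
    by (simp add: char_value_def S_seq_def S_op_eq)
qed

lemma char_value_row:
  fixes \<phi> :: "'a::finite_field Phi_star"
  shows "char_value (single_color [m] \<phi>) \<mu> = series1 CARD('a) (Phi_star_size \<phi>) \<mu> (s_exp m \<mu>)"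
proof -
  let ?d = "Phi_star_size \<phi>"
  have "vertex_pairing.single_factor ?d 1 ((-1) ^ ?d) = (\<lambda>i. s_minus (s_monom 1 0)
      (s_monom ((-1) ^ ?d) (Poly_Mapping.single (W i) (int ?d) + Poly_Mapping.single Z 1)))"
    by (rule ext) (simp only: SQ.single_factor_def of_nat_1)
  then show ?thesis
    using SQ.coefficient_eq[where \<mu> = \<mu> and \<phi> = \<phi> and m = m]
    by (simp only: char_value_single_color series1_def Let_def s_mult_const fps_ratio_coeff)
      (simp add: S.vop_1)
qed

lemma char_value_regular:
  fixes \<phi> :: "'a::finite_field Phi_star"
  shows "char_value (single_color \<nu> \<phi>) [n] = series2 (Phi_star_size \<phi>) (length \<nu>) (s_exp n \<nu>)"
proof -
  let ?d = "Phi_star_size \<phi>"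
  have "vertex_pairing.single_factor 1 ?d ((-1) ^ ?d) = (\<lambda>i. s_minus (s_monom 1 0)
      (s_monom ((-1) ^ ?d) (Poly_Mapping.single Z (int ?d) + Poly_Mapping.single (W i) 1)))"
    by (rule ext) (simp only: QS.single_factor_def of_nat_1 add.commute)
  moreover have "Abs_fps (ratio_coeff 0) = 1 - fps_X" by (simp add: fps_ratio_coeff)
  ultimately show ?thesis
    using QS.coefficient_eq[where \<mu> = \<nu> and \<phi> = \<phi> and m = n]
    by (simp only: char_value_single_color series2_def) (simp add: Q.vop_1 n_part_def)
qed

lemma char_value_regular_size_1:
  fixes \<phi> :: "'a::finite_field Phi_star"
  assumes "Phi_star_size \<phi> = 1" "is_partition \<nu> m"
  shows "char_value (single_color \<nu> \<phi>) [m] = (if \<nu> = replicate m 1 then 1 else 0)"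
proof -
  have ind: "inner_FG (foldr (\<lambda>k. S.vop \<phi> (int k)) \<nu> 1) (Q.E z) =
      (if \<nu> = replicate (length \<nu>) 1 \<and> z = int (length \<nu>) then 1 else 0)" if "0 \<notin> set \<nu>" for z
    using that
  proof (induction \<nu> arbitrary: z)
    case Nil
    then show ?case by (simp add: inner_1_Q_E)
  next
    case (Cons k \<nu>)
    have "inner_FG (foldr (\<lambda>k. S.vop \<phi> (int k)) (k # \<nu>) 1) (Q.E z) =
        (if int k = 1 then inner_FG (foldr (\<lambda>k. S.vop \<phi> (int k)) \<nu> 1) (Q.E (z - 1)) else 0)"
      using QS.L_vop_pos[where n = "int k" and z = z and \<phi> = \<phi>] Cons.prems assms(1) by simp
    then show ?case using Cons by auto
  qed
  have "\<nu> = replicate (length \<nu>) 1 \<and> int m = int (length \<nu>) \<longleftrightarrow> \<nu> = replicate m 1"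
    using assms(2) by (auto simp: is_partition_def) (metis length_replicate mult.right_neutral sum_list_replicate)+
  then show ?thesis
    using ind[of "int m"] assms(2)
    by (simp add: char_value_single_color Q.vop_1 n_part_def is_partition_def)
qed

theorem proposition3p5:
  fixes \<phi> :: "'a::finite_field Phi_star"
  shows
   "(\<forall>\<mu> n m. is_partition \<mu> n \<longrightarrow> m > 0 \<longrightarrow> n = m * Phi_star_size \<phi> \<longrightarrow>
       char_value (single_color [m] \<phi>) \<mu> =
         series1 CARD('a) (Phi_star_size \<phi>) \<mu> (s_exp m \<mu>)) \<and>
    (\<forall>\<nu> m n. is_partition \<nu> m \<longrightarrow> n > 0 \<longrightarrow> n = m * Phi_star_size \<phi> \<longrightarrow>
       char_value (single_color \<nu> \<phi>) [n] =
         series2 (Phi_star_size \<phi>) (length \<nu>) (s_exp n \<nu>)) \<and>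
    (Phi_star_size \<phi> = 1 \<longrightarrow>
      (\<forall>\<nu> m n. is_partition \<nu> m \<longrightarrow> n > 0 \<longrightarrow> n = m * Phi_star_size \<phi> \<longrightarrow>
         char_value (single_color \<nu> \<phi>) [n] =
           (if \<nu> = replicate m 1 then (-1) ^ (m + n) else 0)))"
proof (intro conjI allI impI)
  fix \<nu> m n assume a: "Phi_star_size \<phi> = 1" "is_partition \<nu> m" "n = m * Phi_star_size \<phi>"
  then have "(-1) ^ (m + n) = (1 :: complex)" by (simp add: power_add power_mult_distrib[symmetric])
  then show "char_value (single_color \<nu> \<phi>) [n] = (if \<nu> = replicate m 1 then (-1) ^ (m + n) else 0)"
    using char_value_regular_size_1[OF a(1,2)] a(1,3) by simp
qed (simp_all add: char_value_row char_value_regular)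

end
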